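(* Let $\mathbb{P}^\tau_v$ denote the Gaussian distribution on $\Omega$ with covariance operator $\Gamma_\tau$ and drift $v\in H$. The Bayes risk $$\int_\Omega\mathbb{E}_z\left[\int_0^T|\xi_t-z_t|^2\mu(dt)\right]d\mathbb{P}^\tau_v(z)$$ of any estimator $(\xi_t)_{t\in[0,T]}$ on $\Omega$ under the prior distribution $\mathbb{P}^\tau_v$ is uniquely minimized by $$\xi^{\tau,v}_t:=\langle\chi_t,(\Gamma_\tau+\Gamma)^{-1}\Gamma v\rangle+X\big((\Gamma_\tau+\Gamma)^{-1}\Gamma_\tau\chi_t\big),\qquad t\in[0,T],$$ which has risk $$\int_0^T\langle\chi_t,\Gamma(\Gamma_\tau+\Gamma)^{-1}\Gamma_\tau\chi_t\rangle\,\mu(dt)=\inf_\xi\int_\Omega\mathbb{E}_z\left[\int_0^T|\xi_t-z_t|^2\mu(dt)\right]d\mathbb{P}^\tau_v(z).$$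
   Context: Let $T>0$, let $\mu$ be a finite Borel measure on $[0,T]$, let $\chi_t(s)=\min(s,t)$ for $s,t\in[0,T]$, and $\langle h,g\rangle=\langle\dot h,\dot g\rangle_{L^2([0,T],dt)}$. Let $\gamma(s,t)=\int_0^{s\wedge t}K(t,r)K(s,r)dr$ be a covariance function given by a deterministic kernel $K$, let $(Kh)(t)=\int_0^tK(t,s)\dot h(s)ds$ (differentiable in $t$), let $K^*$ be the adjoint of $K$ with respect to $\langle\cdot,\cdot\rangle$, and let $\Gamma=KK^*$. $H$ is the completion of the linear span of $\{\chi_t:t\in[0,T]\}$ for the scalar product with $\langle\chi_t,\chi_s\rangle_H=\gamma(s,t)$, which satisfies $\langle h,g\rangle_H=\langle h,\Gamma g\rangle$. $(X_t)_{t\in[0,T]}$ is the observed process on $\Omega$ (coordinate process on path space), and $X(f)$ is the linear extension of $X(\chi_t)=X_t$. A Gaussian process $Y$ has covariance operator $\Gamma$ and drift $v$ if $\mathbb{E}[e^{iY(f)}]=\exp\left(i\langle f,v\rangle-\tfrac12\langle f,\Gamma f\rangle\right)$ for all $f$, i.e. $Y$ is $v$ plus a centered Gaussian process with covariance operator $\Gamma$. For $z\in\Omega$, $\mathbb{E}_z$ denotes expectation under the law $\mathbb{P}_z$ under which $X$ has drift $z$ and covariance operator $\Gamma$, i.e. $X-z$ is a centered Gaussian process with covariance function $\gamma$. $\Gamma_\tau$ is another covariance operator, in the same sense. An estimator is a process $(\xi_t)_{t\in[0,T]}$ that is a functional of the observed path $X$; no adaptedness or unbiasedness restriction is imposed,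 in particular in the infimum. "Uniquely" means that $\xi^{\tau,v}$ is the only estimator minimizing the Bayes risk.
   Formalization: The drift term ⟨χ_t,(Γ_τ+Γ)^{-1}Γv⟩ is wrong if Γ, Γ_τ do not commute; it is kept for commuting operators and replaced in general by ⟨(Γ_τ+Γ)^{-1}Γχ_t,v⟩. The drift v has a square-integrable derivative, so that ⟨f,v⟩ is defined. *)

theory Defs
  imports "HOL-Probability.Probability"
begin

text \<open>
  The scalar product \<open>\<langle>h, g\<rangle> = \<integral> h' g'\<close> lives on the Cameron-Martin space of absolutely continuous
  functions on \<open>[0,T]\<close> that vanish at 0 and have a square integrable derivative. Functions are
  normalised to be 0 outside \<open>[0,T]\<close>, so that equality of elements is equality of HOL functions.
\<close>

definition has_cm_deriv :: "real \<Rightarrow> (real \<Rightarrow> real) \<Rightarrow> (real \<Rightarrow> real) \<Rightarrow> bool" where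
  "has_cm_deriv T h g \<longleftrightarrow>
     g \<in> borel_measurable borel \<and> set_integrable lborel {0..T} (\<lambda>s. (g s)\<^sup>2) \<and>
     (\<forall>t\<in>{0..T}. h t = (LINT s:{0..t}|lborel. g s))"

definition cm_space :: "real \<Rightarrow> (real \<Rightarrow> real) set" where
  "cm_space T = {h. (\<forall>t. t \<notin> {0..T} \<longrightarrow> h t = 0) \<and> (\<exists>g. has_cm_deriv T h g)}"

text \<open>The derivative is determined almost everywhere on \<open>[0,T]\<close>; it is only used under integrals.\<close>

definition cm_deriv :: "real \<Rightarrow> (real \<Rightarrow> real) \<Rightarrow> (real \<Rightarrow> real)" where
  "cm_deriv T h = (SOME g. has_cm_deriv T h g)"

definition cm_inner :: "real \<Rightarrow> (real \<Rightarrow> real) \<Rightarrow> (real \<Rightarrow> real) \<Rightarrow> real" where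
  "cm_inner T h g = (LINT s:{0..T}|lborel. cm_deriv T h s * cm_deriv T g s)"

definition chi :: "real \<Rightarrow> real \<Rightarrow> (real \<Rightarrow> real)" where
  "chi T t = (\<lambda>s. if s \<in> {0..T} then min s t else 0)"

text \<open>
  A list \<open>c\<close> of pairs \<open>(a, t)\<close> encodes the linear combination \<open>\<Sum> a \<chi>\<^sub>t\<close>; on a path \<open>\<omega>\<close> the linear
  extension \<open>X(\<Sum> a \<chi>\<^sub>t) = \<Sum> a X\<^sub>t\<close> takes the value \<open>\<Sum> a \<omega>(t)\<close>.
\<close>

definition times_in :: "real \<Rightarrow> (real \<times> real) list \<Rightarrow> bool" where
  "times_in T c \<longleftrightarrow> snd ` set c \<subseteq> {0..T}"

definition chi_comb :: "real \<Rightarrow> (real \<times> real) list \<Rightarrow> (real \<Rightarrow> real)" where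
  "chi_comb T c = (\<lambda>s. \<Sum>(a, t)\<leftarrow>c. a * chi T t s)"

definition path_comb :: "(real \<times> real) list \<Rightarrow> (real \<Rightarrow> real) \<Rightarrow> real" where
  "path_comb c \<omega> = (\<Sum>(a, t)\<leftarrow>c. a * \<omega> t)"

definition kernel_op :: "real \<Rightarrow> (real \<Rightarrow> real \<Rightarrow> real) \<Rightarrow> (real \<Rightarrow> real) \<Rightarrow> (real \<Rightarrow> real)" where
  "kernel_op T K h =
     (\<lambda>t. if t \<in> {0..T} then LINT s:{0..t}|lborel. K t s * cm_deriv T h s else 0)"

text \<open>
  Square integrability of \<open>K(t, \<cdot>)\<close> is what makes \<open>\<gamma>(s,t)\<close> well defined; the last clause is the
  differentiability of \<open>Kh\<close>, with \<open>(Kh)'\<close> in \<open>L\<^sup>2\<close>, so that \<open>K\<close> is an operator for \<open>\<langle>\<cdot>,\<cdot>\<rangle>\<close>.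
\<close>

definition admissible_kernel :: "real \<Rightarrow> (real \<Rightarrow> real \<Rightarrow> real) \<Rightarrow> bool" where
  "admissible_kernel T K \<longleftrightarrow>
     (\<forall>t\<in>{0..T}. set_borel_measurable lborel {0..t} (K t) \<and>
        set_integrable lborel {0..t} (\<lambda>r. (K t r)\<^sup>2)) \<and>
     (\<forall>h\<in>cm_space T. kernel_op T K h \<in> cm_space T)"

definition kernel_cov :: "(real \<Rightarrow> real \<Rightarrow> real) \<Rightarrow> real \<Rightarrow> real \<Rightarrow> real" where
  "kernel_cov K s t = (LINT r:{0..min s t}|lborel. K t r * K s r)"

definition is_cm_adjoint ::
  "real \<Rightarrow> ((real \<Rightarrow> real) \<Rightarrow> (real \<Rightarrow> real)) \<Rightarrow> ((real \<Rightarrow> real) \<Rightarrow> (real \<Rightarrow> real)) \<Rightarrow> bool" where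
  "is_cm_adjoint T L L' \<longleftrightarrow>
     (\<forall>g\<in>cm_space T. L' g \<in> cm_space T) \<and>
     (\<forall>h\<in>cm_space T. \<forall>g\<in>cm_space T. cm_inner T (L h) g = cm_inner T h (L' g))"

definition kernel_cov_op ::
  "real \<Rightarrow> (real \<Rightarrow> real \<Rightarrow> real) \<Rightarrow> ((real \<Rightarrow> real) \<Rightarrow> (real \<Rightarrow> real)) \<Rightarrow>
   (real \<Rightarrow> real) \<Rightarrow> (real \<Rightarrow> real)" where
  "kernel_cov_op T K Kstar = (\<lambda>h. kernel_op T K (Kstar h))"

lemma enn2real_eqD: "enn2real a = enn2real b \<Longrightarrow> a < \<infinity> \<Longrightarrow> b < \<infinity> \<Longrightarrow> a = b"
  by (cases a; cases b) auto

lemma cm_deriv_unique: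
  assumes g: "has_cm_deriv T h g" and g': "has_cm_deriv T h g'" and T: "0 \<le> T"
  shows "AE s in lborel. s \<in> {0..T} \<longrightarrow> g s = g' s"
proof -
  have sqi: "set_integrable lborel {0..T} q"
    if "q \<in> borel_measurable borel" "set_integrable lborel {0..T} (\<lambda>s. (q s)\<^sup>2)" for q :: "real \<Rightarrow> real"
  proof -
    have i1: "set_integrable lborel {0..T} (\<lambda>s. 1 + (q s)\<^sup>2)"
      using that(2)
      by (intro set_integral_add) (auto simp: set_integrable_def emeasure_lborel_Icc_eq intro!: integrable_real_indicator)
    have "\<bar>x\<bar> \<le> 1 + x\<^sup>2" for x :: real
    proof -
      have "0 \<le> (\<bar>x\<bar> - 1)\<^sup>2" by simp
      then have "2 * \<bar>x\<bar> \<le> 1 + x\<^sup>2" by (simp add: power2_eq_square algebra_simps)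
      then show ?thesis by simp
    qed
    then show ?thesis
      using i1 that(1) unfolding set_integrable_def
      by (elim Bochner_Integration.integrable_bound) (auto simp: indicator_def abs_le_iff)
  qed
  define f where "f = (\<lambda>s. indicator {0..T} s * (g s - g' s))"
  have ig: "set_integrable lborel {0..T} g" "set_integrable lborel {0..T} g'"
    using g g' sqi unfolding has_cm_deriv_def by auto
  have "set_integrable lborel {0..T} (\<lambda>s. g s - g' s)" using ig by (rule set_integral_diff)
  then have f_int: "integrable lborel f" unfolding f_def set_integrable_def by simp
  then have f_meas[measurable]: "f \<in> borel_measurable borel" by simp
  have zero: "(LINT s|lborel. indicator {0..t} s * f s) = 0" if t: "t \<in> {0..T}" for t
  proof -
    have sub: "set_integrable lborel {0..t} g" "set_integrable lborel {0..t} g'"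
      using ig t by (auto elim!: set_integrable_subset)
    have "(LINT s|lborel. indicator {0..t} s * f s) = (LINT s:{0..t}|lborel. g s - g' s)"
      unfolding set_lebesgue_integral_def f_def using t
      by (intro Bochner_Integration.integral_cong) (auto simp: indicator_def)
    also have "\<dots> = h t - h t"
      using sub g g' t unfolding has_cm_deriv_def by (subst set_integral_diff) auto
    finally show ?thesis by simp
  qed
  have tail: "(LINT s|lborel. indicator {x<..} s * f s) = 0" for x
  proof -
    have c1: "integrable lborel (\<lambda>s. indicator {0..t} s * f s)" for t
      using integrable_mult_indicator[OF _ f_int, of "{0..t}"] by simp
    consider "x < 0" | "x \<in> {0..T}" | "x > T" by fastforce
    then show ?thesis
    proof cases
      case 1
      then have "(LINT s|lborel. indicator {x<..} s * f s) = (LINT s|lborel. indicator {0..T} s * f s)"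
        by (intro Bochner_Integration.integral_cong) (auto simp: indicator_def f_def)
      then show ?thesis using zero[of T] T by simp
    next
      case 2
      then have "(LINT s|lborel. indicator {x<..} s * f s) =
          (LINT s|lborel. indicator {0..T} s * f s - indicator {0..x} s * f s)"
        by (intro Bochner_Integration.integral_cong) (auto simp: indicator_def f_def)
      then show ?thesis using zero[of T] zero[of x] c1 T 2 by simp
    next
      case 3
      then have "(\<lambda>s. indicator {x<..} s * f s) = (\<lambda>s. 0)"
        by (auto simp: indicator_def f_def)
      then show ?thesis by simp
    qed
  qed
  let ?p = "\<lambda>s. ennreal (f s)" and ?n = "\<lambda>s. ennreal (- f s)"
  have fin: "(\<integral>\<^sup>+s. ennreal (q * f s) * indicator A s \<partial>lborel) < \<infinity>"
    if "A \<in> sets borel" "\<bar>q\<bar> = 1" for A q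
  proof -
    have "(\<integral>\<^sup>+s. ennreal (q * f s) * indicator A s \<partial>lborel) \<le> (\<integral>\<^sup>+s. ennreal (norm (f s)) \<partial>lborel)"
      using that(2) by (intro nn_integral_mono) (auto simp: indicator_def abs_if split: if_splits intro!: ennreal_leI)
    also have "\<dots> < \<infinity>" using f_int by (simp add: integrable_iff_bounded)
    finally show ?thesis .
  qed
  have eq: "density lborel ?p = density lborel ?n"
  proof (rule measure_eqI_lessThan)
    fix x :: real
    show "emeasure (density lborel ?p) {x<..} < \<infinity>"
      using fin[of "{x<..}" 1] by (simp add: emeasure_density)
    let ?F = "\<lambda>s. indicator {x<..} s * f s"
    have F_int: "integrable lborel ?F"
      using integrable_mult_indicator[OF _ f_int, of "{x<..}"] by simp
    have a: "(\<integral>\<^sup>+s. ennreal (?F s) \<partial>lborel) = (\<integral>\<^sup>+s. ?p s * indicator {x<..} s \<partial>lborel)"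
      "(\<integral>\<^sup>+s. ennreal (- ?F s) \<partial>lborel) = (\<integral>\<^sup>+s. ?n s * indicator {x<..} s \<partial>lborel)"
      by (auto intro!: nn_integral_cong simp: indicator_def)
    have "enn2real (\<integral>\<^sup>+s. ?p s * indicator {x<..} s \<partial>lborel) =
        enn2real (\<integral>\<^sup>+s. ?n s * indicator {x<..} s \<partial>lborel)"
      using real_lebesgue_integral_def[OF F_int] tail[of x] a by simp
    then have "(\<integral>\<^sup>+s. ?p s * indicator {x<..} s \<partial>lborel) = (\<integral>\<^sup>+s. ?n s * indicator {x<..} s \<partial>lborel)"
      using fin[of "{x<..}" 1] fin[of "{x<..}" "-1"]
      by (intro enn2real_eqD) auto
    then show "emeasure (density lborel ?p) {x<..} = emeasure (density lborel ?n) {x<..}"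
      by (simp add: emeasure_density)
  qed simp_all
  have "AE s in lborel. ?p s = ?n s"
    using eq by (subst (asm) sigma_finite_measure.density_unique_iff)
      (auto intro: lborel.sigma_finite_measure_axioms)
  then show ?thesis
  proof eventually_elim
    case (elim s)
    then have "f s = 0" by (cases "f s" "0::real" rule: linorder_cases) (auto simp: ennreal_neg)
    then show ?case by (auto simp: f_def)
  qed
qed

lemma cm_inner_eq:
  assumes "has_cm_deriv T h p" "has_cm_deriv T g q" "0 \<le> T"
  shows "cm_inner T h g = (LINT s:{0..T}|lborel. p s * q s)"
proof -
  have d: "has_cm_deriv T h (cm_deriv T h)" "has_cm_deriv T g (cm_deriv T g)"
    using someI[of "has_cm_deriv T h", OF assms(1)] someI[of "has_cm_deriv T g", OF assms(2)]
    by (simp_all add: cm_deriv_def)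
  then have m[measurable]: "cm_deriv T h \<in> borel_measurable borel" "cm_deriv T g \<in> borel_measurable borel"
    "p \<in> borel_measurable borel" "q \<in> borel_measurable borel"
    using assms unfolding has_cm_deriv_def by auto
  show ?thesis unfolding cm_inner_def set_lebesgue_integral_def
  proof (rule integral_cong_AE)
    show "AE s in lborel. indicator {0..T} s *\<^sub>R (cm_deriv T h s * cm_deriv T g s) =
        indicator {0..T} s *\<^sub>R (p s * q s)"
      using cm_deriv_unique[OF d(1) assms(1,3)] cm_deriv_unique[OF d(2) assms(2,3)]
      by eventually_elim (auto simp: indicator_def)
  qed simp_all
qed

lemma cm_inner_commute: "cm_inner T h g = cm_inner T g h"
  by (simp add: cm_inner_def mult.commute)

text \<open>The operator \<open>\<Gamma> = K K\<^sup>*\<close> has the covariance function \<open>\<gamma>\<close>.\<close>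

lemma kernel_cov_op_chi:
  assumes T: "0 \<le> T" and K: "admissible_kernel T K" and adj: "is_cm_adjoint T (kernel_op T K) Kstar"
    and st: "s \<in> {0..T}" "t \<in> {0..T}"
  shows "cm_inner T (chi T s) (kernel_cov_op T K Kstar (chi T t)) = kernel_cov K s t"
proof -
  have dd: "has_cm_deriv T h (cm_deriv T h)" if "h \<in> cm_space T" for h
    using that someI_ex[of "has_cm_deriv T h"] by (auto simp: cm_deriv_def cm_space_def)
  have chid: "has_cm_deriv T (chi T u) (indicator {0..u})" if "u \<in> {0..T}" for u
  proof -
    have "chi T u x = (LINT r:{0..x}|lborel. indicator {0..u} r)" if "x \<in> {0..T}" for x
    proof -
      have "(LINT r:{0..x}|lborel. indicator {0..u} r :: real) = (LINT r|lborel. indicator {0..min u x} r)"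
        unfolding set_lebesgue_integral_def by (intro Bochner_Integration.integral_cong) (auto simp: indicator_def)
      then show ?thesis using that \<open>u \<in> {0..T}\<close> by (simp add: chi_def)
    qed
    moreover have "set_integrable lborel {0..T} (\<lambda>s. (indicator {0..u} s :: real)\<^sup>2)"
    proof -
      have "(\<lambda>s. indicator {0..T} s *\<^sub>R (indicator {0..u} s :: real)\<^sup>2) = indicator ({0..T} \<inter> {0..u})"
        by (auto simp: indicator_def)
      then show ?thesis unfolding set_integrable_def
        by (auto simp: emeasure_lborel_Icc_eq intro!: integrable_real_indicator)
    qed
    ultimately show ?thesis by (simp add: has_cm_deriv_def)
  qed
  have chi: "chi T u \<in> cm_space T" if "u \<in> {0..T}" for u
    using chid[OF that] that by (auto simp: cm_space_def chi_def)
  have eval: "cm_inner T h (chi T u) = h u" if "h \<in> cm_space T" "u \<in> {0..T}" for h u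
  proof -
    have "cm_inner T h (chi T u) = (LINT r:{0..T}|lborel. cm_deriv T h r * indicator {0..u} r)"
      by (rule cm_inner_eq[OF dd chid T]) (use that in auto)
    also have "\<dots> = (LINT r:{0..u}|lborel. cm_deriv T h r)"
      unfolding set_lebesgue_integral_def using that
      by (intro Bochner_Integration.integral_cong) (auto simp: indicator_def)
    also have "\<dots> = h u" using dd[OF that(1)] that(2) by (simp add: has_cm_deriv_def)
    finally show ?thesis .
  qed
  define kd where "kd u r = indicator {0..u} r * K u r" for u r
  define k where "k u = (\<lambda>x. if x \<in> {0..T} then LINT r:{0..x}|lborel. kd u r else 0)" for u
  have kd: "has_cm_deriv T (k u) (kd u)" if "u \<in> {0..T}" for u
  proof -
    have "(\<lambda>s. indicator {0..T} s *\<^sub>R (kd u s)\<^sup>2) = (\<lambda>r. indicator {0..u} r *\<^sub>R (K u r)\<^sup>2)"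
      using that by (auto simp: kd_def indicator_def)
    then show ?thesis
      using K that unfolding has_cm_deriv_def admissible_kernel_def set_integrable_def
        set_borel_measurable_def by (auto simp: kd_def[abs_def] k_def)
  qed
  have k: "k u \<in> cm_space T" if "u \<in> {0..T}" for u
    using kd[OF that] by (auto simp: cm_space_def k_def)
  have kop: "kernel_op T K h u = cm_inner T h (k u)" if "h \<in> cm_space T" "u \<in> {0..T}" for h u
  proof -
    have "cm_inner T h (k u) = (LINT r:{0..T}|lborel. cm_deriv T h r * kd u r)"
      by (rule cm_inner_eq[OF dd kd T]) (use that in auto)
    also have "\<dots> = (LINT r:{0..u}|lborel. K u r * cm_deriv T h r)"
      unfolding set_lebesgue_integral_def kd_def using that
      by (intro Bochner_Integration.integral_cong) (auto simp: indicator_def)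
    finally show ?thesis using that by (simp add: kernel_op_def)
  qed
  have op: "kernel_op T K h \<in> cm_space T" if "h \<in> cm_space T" for h
    using K that by (simp add: admissible_kernel_def)
  have Ks: "Kstar (chi T t) \<in> cm_space T" using adj chi[OF st(2)] by (simp add: is_cm_adjoint_def)
  have "cm_inner T (chi T s) (kernel_cov_op T K Kstar (chi T t)) = kernel_op T K (Kstar (chi T t)) s"
    using eval[OF op[OF Ks] st(1)] by (simp add: cm_inner_commute kernel_cov_op_def)
  also have "\<dots> = cm_inner T (k s) (Kstar (chi T t))"
    using kop[OF Ks st(1)] by (simp add: cm_inner_commute)
  also have "\<dots> = cm_inner T (kernel_op T K (k s)) (chi T t)"
    using adj k[OF st(1)] chi[OF st(2)] by (simp add: is_cm_adjoint_def)
  also have "\<dots> = cm_inner T (k s) (k t)"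
    using eval[OF op[OF k[OF st(1)]] st(2)] kop[OF k[OF st(1)] st(2)] by simp
  also have "\<dots> = (LINT r:{0..T}|lborel. kd s r * kd t r)"
    by (rule cm_inner_eq[OF kd kd T]) (use st in auto)
  also have "\<dots> = kernel_cov K s t"
    unfolding kernel_cov_def set_lebesgue_integral_def kd_def using st
    by (intro Bochner_Integration.integral_cong) (auto simp: indicator_def)
  finally show ?thesis .
qed

definition covariance_operator :: "real \<Rightarrow> ((real \<Rightarrow> real) \<Rightarrow> (real \<Rightarrow> real)) \<Rightarrow> bool" where
  "covariance_operator T G \<longleftrightarrow>
     (\<forall>h\<in>cm_space T. G h \<in> cm_space T) \<and>
     (\<forall>a b. \<forall>h\<in>cm_space T. \<forall>g\<in>cm_space T.
        G (\<lambda>s. a * h s + b * g s) = (\<lambda>s. a * G h s + b * G g s)) \<and>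
     (\<forall>h\<in>cm_space T. \<forall>g\<in>cm_space T. cm_inner T (G h) g = cm_inner T h (G g)) \<and>
     (\<forall>h\<in>cm_space T. 0 \<le> cm_inner T h (G h))"

text \<open>
  The elements of the completion \<open>H\<close> of the span of the \<open>\<chi>\<^sub>t\<close> for
  \<open>\<langle>h, g\<rangle>\<^sub>H = \<langle>h, G g\<rangle>\<close> for which the pairing \<open>\<langle>f, v\<rangle>\<close> used to define a drift makes sense:
  members of the Cameron-Martin space that are limits of elements of the span in the norm of \<open>H\<close>.
\<close>

definition H_space :: "real \<Rightarrow> ((real \<Rightarrow> real) \<Rightarrow> (real \<Rightarrow> real)) \<Rightarrow> (real \<Rightarrow> real) set" where
  "H_space T G = {h \<in> cm_space T. \<exists>c. (\<forall>n::nat. times_in T (c n)) \<and>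
     (\<lambda>n. cm_inner T (\<lambda>s. h s - chi_comb T (c n) s) (G (\<lambda>s. h s - chi_comb T (c n) s)))
       \<longlonglongrightarrow> 0}"

definition op_sum ::
  "((real \<Rightarrow> real) \<Rightarrow> (real \<Rightarrow> real)) \<Rightarrow> ((real \<Rightarrow> real) \<Rightarrow> (real \<Rightarrow> real)) \<Rightarrow>
   (real \<Rightarrow> real) \<Rightarrow> (real \<Rightarrow> real)" where
  "op_sum G G' = (\<lambda>h s. G h s + G' h s)"

text \<open>Only meaningful for \<open>A\<close> injective on the Cameron-Martin space and arguments in its range.\<close>

definition op_inv ::
  "real \<Rightarrow> ((real \<Rightarrow> real) \<Rightarrow> (real \<Rightarrow> real)) \<Rightarrow> (real \<Rightarrow> real) \<Rightarrow> (real \<Rightarrow> real)" where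
  "op_inv T A = the_inv_into (cm_space T) A"

text \<open>
  A path space: some set of paths with the \<open>\<sigma>\<close>-algebra generated by the coordinates \<open>X\<^sub>t\<close>,
  \<open>t \<in> [0,T]\<close>, on which the coordinate process is jointly measurable, as is needed for
  \<open>\<integral> |\<xi>\<^sub>t - z\<^sub>t|\<^sup>2 \<mu>(dt)\<close> to be measurable in \<open>z\<close>. Continuous paths are an instance.
\<close>

definition path_space :: "real \<Rightarrow> (real \<Rightarrow> real) measure \<Rightarrow> bool" where
  "path_space T \<Omega> \<longleftrightarrow>
     sets \<Omega> = sigma_sets (space \<Omega>)
       {{\<omega> \<in> space \<Omega>. \<omega> t \<in> B} | t B. t \<in> {0..T} \<and> B \<in> sets borel} \<and>
     (\<lambda>(t, \<omega>). \<omega> t) \<in> borel_measurable (restrict_space borel {0..T} \<Otimes>\<^sub>M \<Omega>)"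

text \<open>
  The law \<open>P\<close> on path space under which \<open>X\<close> has covariance operator \<open>G\<close> and drift \<open>m\<close>:
  \<open>E[exp(i X(f))] = exp(i \<langle>f, m\<rangle> - \<langle>f, G f\<rangle> / 2)\<close> for \<open>f = \<Sum> a \<chi>\<^sub>t\<close>. The drift may be any path,
  with \<open>\<langle>f, m\<rangle> = \<Sum> a m(t)\<close>; this is consistent since \<open>\<langle>\<chi>\<^sub>t, m\<rangle> = m(t)\<close> on the Cameron-Martin space.
\<close>

definition gaussian_law ::
  "real \<Rightarrow> (real \<Rightarrow> real) measure \<Rightarrow> (real \<Rightarrow> real) measure \<Rightarrow> (real \<Rightarrow> real) \<Rightarrow>
   ((real \<Rightarrow> real) \<Rightarrow> (real \<Rightarrow> real)) \<Rightarrow> bool" where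
  "gaussian_law T \<Omega> P m G \<longleftrightarrow>
     prob_space P \<and> sets P = sets \<Omega> \<and>
     (\<forall>c. times_in T c \<longrightarrow>
        (CLINT \<omega>|P. exp (\<i> * complex_of_real (path_comb c \<omega>))) =
        exp (\<i> * complex_of_real (path_comb c m) -
             complex_of_real (cm_inner T (chi_comb T c) (G (chi_comb T c)) / 2)))"

text \<open>
  \<open>Y\<close> is a version of \<open>X(f)\<close>, the extension of \<open>X\<close> from the span of the \<open>\<chi>\<^sub>t\<close> by \<open>L\<^sup>2\<close>-limits. The
  observation has drift \<open>z\<close> drawn from \<open>Q\<close>, hence its law is the mixture of the \<open>P z\<close>; versions are
  unique up to null sets of this mixture.
\<close>

definition is_X_of ::
  "real \<Rightarrow> (real \<Rightarrow> real) measure \<Rightarrow> (real \<Rightarrow> real) measure \<Rightarrow>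
   ((real \<Rightarrow> real) \<Rightarrow> (real \<Rightarrow> real) measure) \<Rightarrow>
   (real \<Rightarrow> real) \<Rightarrow> ((real \<Rightarrow> real) \<Rightarrow> real) \<Rightarrow> bool" where
  "is_X_of T \<Omega> Q P f Y \<longleftrightarrow>
     Y \<in> borel_measurable \<Omega> \<and>
     (\<exists>c. (\<forall>n::nat. times_in T (c n)) \<and>
        (\<lambda>n. cm_inner T (\<lambda>s. f s - chi_comb T (c n) s) (\<lambda>s. f s - chi_comb T (c n) s))
          \<longlonglongrightarrow> 0 \<and>
        (\<lambda>n. \<integral>\<^sup>+z. (\<integral>\<^sup>+\<omega>. ennreal ((path_comb (c n) \<omega> - Y \<omega>)\<^sup>2) \<partial>P z) \<partial>Q)
          \<longlonglongrightarrow> 0)"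

definition estimators ::
  "real measure \<Rightarrow> (real \<Rightarrow> real) measure \<Rightarrow> (real \<Rightarrow> (real \<Rightarrow> real) \<Rightarrow> real) set" where
  "estimators \<mu> \<Omega> = {\<xi>. (\<lambda>(t, \<omega>). \<xi> t \<omega>) \<in> borel_measurable (\<mu> \<Otimes>\<^sub>M \<Omega>)}"

definition bayes_risk ::
  "real measure \<Rightarrow> (real \<Rightarrow> real) measure \<Rightarrow> ((real \<Rightarrow> real) \<Rightarrow> (real \<Rightarrow> real) measure) \<Rightarrow>
   (real \<Rightarrow> (real \<Rightarrow> real) \<Rightarrow> real) \<Rightarrow> ennreal" where
  "bayes_risk \<mu> Q P \<xi> =
     (\<integral>\<^sup>+z. (\<integral>\<^sup>+\<omega>. (\<integral>\<^sup>+t. ennreal ((\<xi> t \<omega> - z t)\<^sup>2) \<partial>\<mu>) \<partial>P z) \<partial>Q)"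

text \<open>\<open>\<xi>\<close> is the process \<open>\<xi>\<^sub>t = d(t) + X(f\<^sub>t)\<close>.\<close>

definition is_drift_plus_X ::
  "real \<Rightarrow> real measure \<Rightarrow> (real \<Rightarrow> real) measure \<Rightarrow> (real \<Rightarrow> real) measure \<Rightarrow>
   ((real \<Rightarrow> real) \<Rightarrow> (real \<Rightarrow> real) measure) \<Rightarrow> (real \<Rightarrow> real) \<Rightarrow> (real \<Rightarrow> (real \<Rightarrow> real)) \<Rightarrow>
   (real \<Rightarrow> (real \<Rightarrow> real) \<Rightarrow> real) \<Rightarrow> bool" where
  "is_drift_plus_X T \<mu> \<Omega> Q P d f \<xi> \<longleftrightarrow>
     \<xi> \<in> estimators \<mu> \<Omega> \<and>
     (\<forall>t\<in>{0..T}. is_X_of T \<Omega> Q P (f t) (\<lambda>\<omega>. \<xi> t \<omega> - d t))"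

text \<open>
  Uniqueness is up to null sets, as it must be: changing an estimator on a null set of \<open>\<mu>\<close>
  times the law of the observation does not change its risk.
\<close>

definition unique_minimizer ::
  "real measure \<Rightarrow> (real \<Rightarrow> real) measure \<Rightarrow> (real \<Rightarrow> real) measure \<Rightarrow>
   ((real \<Rightarrow> real) \<Rightarrow> (real \<Rightarrow> real) measure) \<Rightarrow> (real \<Rightarrow> (real \<Rightarrow> real) \<Rightarrow> real) \<Rightarrow> bool" where
  "unique_minimizer \<mu> \<Omega> Q P \<xi> \<longleftrightarrow>
     \<xi> \<in> estimators \<mu> \<Omega> \<and>
     (\<forall>\<eta>\<in>estimators \<mu> \<Omega>. bayes_risk \<mu> Q P \<xi> \<le> bayes_risk \<mu> Q P \<eta>) \<and>
     (\<forall>\<eta>\<in>estimators \<mu> \<Omega>. bayes_risk \<mu> Q P \<eta> \<le> bayes_risk \<mu> Q P \<xi> \<longrightarrow>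
        (AE z in Q. AE \<omega> in P z. AE t in \<mu>. \<eta> t \<omega> = \<xi> t \<omega>))"

end

theory Submission
  imports Defs
begin

text \<open>
  Let \<open>Z\<close> be the drift, drawn from the prior \<open>Q\<close>, and \<open>X\<close> the observation, drawn from \<open>P Z\<close>. The pair
  \<open>(Z, X)\<close> is Gaussian (\<open>joint_cos\<close>): \<open>X(y)\<close> has variance \<open>\<langle>y, (\<Gamma>\<tau> + \<Gamma>) y\<rangle>\<close> and its covariance with \<open>Z\<^sub>t\<close> is \<open>\<langle>\<Gamma>\<tau> \<chi>\<^sub>t, y\<rangle>\<close>.
  Hence if \<open>(\<Gamma>\<tau> + \<Gamma>) f\<^sub>t = \<Gamma>\<tau> \<chi>\<^sub>t\<close>, the centred difference of \<open>Z\<^sub>t\<close> and \<open>X(f\<^sub>t)\<close> is uncorrelated with all \<open>X(y)\<close> and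
  therefore, being jointly Gaussian with them, orthogonal to all functions of \<open>X\<close>: the estimator \<open>\<xi>\<^sub>t\<close> of the
  theorem is the posterior mean of \<open>Z\<^sub>t\<close> (\<open>posterior_error\<close>, \<open>orthogonal_to_observation\<close>). For any estimator \<open>\<eta>\<close>,
  Pythagoras gives \<open>E (\<eta>\<^sub>t - Z\<^sub>t)\<^sup>2 = E (\<eta>\<^sub>t - \<xi>\<^sub>t)\<^sup>2 + \<langle>\<chi>\<^sub>t, \<Gamma> f\<^sub>t\<rangle>\<close> (\<open>pythagoras\<close>), and integration over \<open>\<mu>\<close> yields
  minimality, uniqueness and the value of the risk at once (\<open>drift_plus_X_optimal\<close>).

  Most of the work lies in making sense of this picture.

  \<^item> The laws \<open>P z\<close> are given only through their characteristic functions. A monotone class theorem for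
    trigonometric functions of the path (\<open>indicator_in_trig_closure\<close>) shows that \<open>z \<mapsto> P z\<close> is a Markov
    kernel, so that the joint law exists, and later extends orthogonality from trigonometric functions of \<open>X\<close>
    to all functions of \<open>X\<close>. Second moments come from the characteristic functions as well
    (\<open>second_moment_from_char\<close>, \<open>cross_moment_from_char\<close>).

  \<^item> \<open>\<Gamma>\<close> and \<open>\<Gamma>\<tau>\<close> are symmetric and everywhere defined on the Hilbert space of Cameron-Martin functions, hence
    bounded (\<open>hellinger_toeplitz\<close>). Consequently \<open>X\<close> extends to that space by \<open>L\<^sup>2\<close> limits.

  \<^item> The inverse of \<open>\<Gamma>\<tau> + \<Gamma>\<close> is in general unbounded. The Landweber iterates (\<open>landweber_tends\<close>) are
    bounded approximate inverses that commute with everything that \<open>\<Gamma>\<tau> + \<Gamma>\<close> commutes with. They show that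
    \<open>f\<^sub>t\<close> depends measurably on \<open>t\<close>, and identify the two forms of the drift term when \<open>\<Gamma>\<close> and \<open>\<Gamma>\<tau>\<close> commute.

  \<^item> An estimator must be measurable in time and path jointly. The version of \<open>X(f\<^sub>t)\<close> used for existence
    (\<open>drift_plus_X_exists\<close>) is a limit of \<open>X\<close> of polygons interpolating \<open>f\<^sub>t\<close> (\<open>pw_lin_tends\<close>), on grids that are
    chosen measurably in \<open>t\<close>.
\<close>

section \<open>Hilbert spaces of functions\<close>

text \<open>
  A nonnegative quadratic polynomial in \<open>r\<close> has no two distinct real roots. This is the core of both
  Cauchy-Schwarz inequalities below.
\<close>

lemma discriminant_le:
  fixes a b c :: real
  assumes "\<And>r. 0 \<le> a + 2 * r * b + r\<^sup>2 * c" "0 \<le> c"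
  shows "b\<^sup>2 \<le> a * c"
proof (cases "c = 0")
  case True
  have "b = 0"
  proof (rule ccontr)
    assume "b \<noteq> 0"
    then show False using assms(1)[of "- (a + 1) / (2 * b)"] True by (simp add: field_simps)
  qed
  then show ?thesis using True by simp
next
  case False
  then show ?thesis using assms(1)[of "- b / c"] assms(2) by (simp add: field_simps power2_eq_square)
qed

text \<open>
  Pointwise operations on functions, and equality of functions, are what the elements of the
  Cameron-Martin space come with; the axioms are those of a real Hilbert space of such functions.
\<close>

locale hilbert_function_space =
  fixes V :: "('a \<Rightarrow> real) set" and ip :: "('a \<Rightarrow> real) \<Rightarrow> ('a \<Rightarrow> real) \<Rightarrow> real"
  assumes zero_mem: "(\<lambda>_. 0) \<in> V"
    and lin_mem: "f \<in> V \<Longrightarrow> g \<in> V \<Longrightarrow> (\<lambda>s. a * f s + b * g s) \<in> V"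
    and ip_lin: "f \<in> V \<Longrightarrow> g \<in> V \<Longrightarrow> h \<in> V \<Longrightarrow> ip (\<lambda>s. a * f s + b * g s) h = a * ip f h + b * ip g h"
    and ip_commute: "ip f g = ip g f"
    and ip_nonneg: "f \<in> V \<Longrightarrow> 0 \<le> ip f f"
    and ip_definite: "f \<in> V \<Longrightarrow> ip f f = 0 \<Longrightarrow> f = (\<lambda>_. 0)"
    and ip_complete: "(\<And>n::nat. x n \<in> V) \<Longrightarrow>
      (\<And>e. 0 < e \<Longrightarrow> \<exists>N. \<forall>m\<ge>N. \<forall>n\<ge>N. ip (\<lambda>s. x m s - x n s) (\<lambda>s. x m s - x n s) < e) \<Longrightarrow>
      \<exists>y\<in>V. (\<lambda>n. ip (\<lambda>s. x n s - y s) (\<lambda>s. x n s - y s)) \<longlonglongrightarrow> 0"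
begin

definition nrm :: "('a \<Rightarrow> real) \<Rightarrow> real" where "nrm f = sqrt (ip f f)"

lemma diff_mem: "f \<in> V \<Longrightarrow> g \<in> V \<Longrightarrow> (\<lambda>s. f s - g s) \<in> V"
  using lin_mem[of f g 1 "-1"] by simp

lemma add_mem: "f \<in> V \<Longrightarrow> g \<in> V \<Longrightarrow> (\<lambda>s. f s + g s) \<in> V"
  using lin_mem[of f g 1 1] by simp

lemma scale_mem: "f \<in> V \<Longrightarrow> (\<lambda>s. a * f s) \<in> V"
  using lin_mem[of f f a 0] by simp

lemma ip_diff: "f \<in> V \<Longrightarrow> g \<in> V \<Longrightarrow> h \<in> V \<Longrightarrow> ip (\<lambda>s. f s - g s) h = ip f h - ip g h"
  using ip_lin[of f g h 1 "-1"] by simp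

lemma ip_add: "f \<in> V \<Longrightarrow> g \<in> V \<Longrightarrow> h \<in> V \<Longrightarrow> ip (\<lambda>s. f s + g s) h = ip f h + ip g h"
  using ip_lin[of f g h 1 1] by simp

lemma ip_scale: "f \<in> V \<Longrightarrow> h \<in> V \<Longrightarrow> ip (\<lambda>s. a * f s) h = a * ip f h"
  using ip_lin[of f f h a 0] by simp

lemma ip_zero: "h \<in> V \<Longrightarrow> ip (\<lambda>_. 0) h = 0"
  using ip_scale[of h h 0] by simp

lemma ip_diff_right: "f \<in> V \<Longrightarrow> g \<in> V \<Longrightarrow> h \<in> V \<Longrightarrow> ip h (\<lambda>s. f s - g s) = ip h f - ip h g"
  using ip_diff ip_commute by metis

lemma ip_add_right: "f \<in> V \<Longrightarrow> g \<in> V \<Longrightarrow> h \<in> V \<Longrightarrow> ip h (\<lambda>s. f s + g s) = ip h f + ip h g"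
  using ip_add ip_commute by metis

lemma ip_scale_right: "f \<in> V \<Longrightarrow> h \<in> V \<Longrightarrow> ip h (\<lambda>s. a * f s) = a * ip h f"
  using ip_scale ip_commute by metis

lemma nrm_zero: "nrm (\<lambda>_. 0) = 0"
  using ip_zero[OF zero_mem] by (simp add: nrm_def)

lemma nrm_nonneg: "f \<in> V \<Longrightarrow> 0 \<le> nrm f"
  by (simp add: nrm_def ip_nonneg)

lemma nrm_sq: "f \<in> V \<Longrightarrow> (nrm f)\<^sup>2 = ip f f"
  by (simp add: nrm_def ip_nonneg)

lemma eq_by_ip:
  assumes "f \<in> V" "g \<in> V" "\<And>h. h \<in> V \<Longrightarrow> ip f h = ip g h"
  shows "f = g"
proof -
  have d: "(\<lambda>s. f s - g s) \<in> V" using assms diff_mem by blast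
  have "ip (\<lambda>s. f s - g s) (\<lambda>s. f s - g s) = 0"
    using ip_diff[OF assms(1,2) d] assms(3)[OF d] by simp
  then have "(\<lambda>s. f s - g s) = (\<lambda>_. 0)" using ip_definite d by blast
  then show ?thesis by (auto simp: fun_eq_iff)
qed

lemma cauchy_schwarz:
  assumes "f \<in> V" "g \<in> V"
  shows "\<bar>ip f g\<bar> \<le> nrm f * nrm g"
proof -
  have "(ip f g)\<^sup>2 \<le> ip f f * ip g g"
  proof (rule discriminant_le)
    fix r
    have "0 \<le> ip (\<lambda>s. f s + r * g s) (\<lambda>s. f s + r * g s)"
      using assms by (intro ip_nonneg add_mem scale_mem)
    also have "\<dots> = ip f f + 2 * r * ip f g + r\<^sup>2 * ip g g"
      using assms scale_mem add_mem
      by (simp add: ip_add ip_add_right ip_scale ip_scale_right ip_commute[of g f] power2_eq_square distrib_left)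
    finally show "0 \<le> ip f f + 2 * r * ip f g + r\<^sup>2 * ip g g" .
  qed (rule ip_nonneg[OF assms(2)])
  then have "sqrt ((ip f g)\<^sup>2) \<le> sqrt (ip f f * ip g g)" by (rule real_sqrt_le_mono)
  then show ?thesis by (simp add: nrm_def real_sqrt_mult)
qed

lemma nrm_add:
  assumes "f \<in> V" "g \<in> V"
  shows "nrm (\<lambda>s. f s + g s) \<le> nrm f + nrm g"
proof (rule power2_le_imp_le)
  have "(nrm (\<lambda>s. f s + g s))\<^sup>2 = ip f f + 2 * ip f g + ip g g"
    using assms add_mem by (simp add: nrm_sq ip_add ip_add_right ip_commute[of g f])
  also have "\<dots> \<le> (nrm f)\<^sup>2 + 2 * (nrm f * nrm g) + (nrm g)\<^sup>2"
    using cauchy_schwarz[OF assms] assms by (simp add: nrm_sq)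
  finally show "(nrm (\<lambda>s. f s + g s))\<^sup>2 \<le> (nrm f + nrm g)\<^sup>2" by (simp add: power2_sum)
qed (use assms nrm_nonneg in auto)

lemma nrm_scale: "f \<in> V \<Longrightarrow> nrm (\<lambda>s. a * f s) = \<bar>a\<bar> * nrm f"
  by (simp add: nrm_def ip_scale ip_scale_right scale_mem real_sqrt_mult real_sqrt_abs2)

lemma nrm_diff_commute:
  assumes "f \<in> V" "g \<in> V" shows "nrm (\<lambda>s. f s - g s) = nrm (\<lambda>s. g s - f s)"
  using assms by (simp add: nrm_def ip_diff ip_diff_right diff_mem ip_commute[of f g] algebra_simps)

lemma nrm_triangle:
  assumes "f \<in> V" "g \<in> V" "h \<in> V"
  shows "nrm (\<lambda>s. f s - h s) \<le> nrm (\<lambda>s. f s - g s) + nrm (\<lambda>s. g s - h s)"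
  using nrm_add[OF diff_mem[OF assms(1,2)] diff_mem[OF assms(2,3)]] by simp

definition tends :: "(nat \<Rightarrow> 'a \<Rightarrow> real) \<Rightarrow> ('a \<Rightarrow> real) \<Rightarrow> bool" where
  "tends x y \<longleftrightarrow> (\<lambda>n. nrm (\<lambda>s. x n s - y s)) \<longlonglongrightarrow> 0"

lemma tends_iff_sq:
  assumes "\<And>n. x n \<in> V" "y \<in> V"
  shows "tends x y \<longleftrightarrow> (\<lambda>n. ip (\<lambda>s. x n s - y s) (\<lambda>s. x n s - y s)) \<longlonglongrightarrow> 0"
proof
  assume "tends x y"
  from tendsto_power[OF this[unfolded tends_def], of 2]
  show "(\<lambda>n. ip (\<lambda>s. x n s - y s) (\<lambda>s. x n s - y s)) \<longlonglongrightarrow> 0"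
    using assms diff_mem by (simp add: nrm_sq)
next
  assume "(\<lambda>n. ip (\<lambda>s. x n s - y s) (\<lambda>s. x n s - y s)) \<longlonglongrightarrow> 0"
  from tendsto_real_sqrt[OF this] show "tends x y" by (simp add: tends_def nrm_def)
qed

lemma tends_ip:
  assumes "\<And>n. x n \<in> V" "y \<in> V" "tends x y" "h \<in> V"
  shows "(\<lambda>n. ip (x n) h) \<longlonglongrightarrow> ip y h"
proof -
  have "(\<lambda>n. ip (x n) h - ip y h) \<longlonglongrightarrow> 0"
  proof (rule Lim_null_comparison)
    show "\<forall>\<^sub>F n in sequentially. norm (ip (x n) h - ip y h) \<le> nrm (\<lambda>s. x n s - y s) * nrm h"
      using cauchy_schwarz[OF diff_mem[OF assms(1,2)] assms(4)] ip_diff assms by (auto intro!: always_eventually)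
    show "(\<lambda>n. nrm (\<lambda>s. x n s - y s) * nrm h) \<longlonglongrightarrow> 0"
      using tendsto_mult_left_zero[OF assms(3)[unfolded tends_def]] .
  qed
  then show ?thesis by (simp add: LIM_zero_iff)
qed

lemma tends_nrm:
  assumes "\<And>n. x n \<in> V" "y \<in> V" "tends x y"
  shows "(\<lambda>n. nrm (x n)) \<longlonglongrightarrow> nrm y"
proof -
  have bd: "\<bar>nrm (x n) - nrm y\<bar> \<le> nrm (\<lambda>s. x n s - y s)" for n
    using nrm_add[OF diff_mem[OF assms(1,2)] assms(2), of n]
      nrm_add[OF diff_mem[OF assms(2,1)] assms(1), of n n] nrm_diff_commute[OF assms(1,2), of n]
    by auto
  have "(\<lambda>n. nrm (x n) - nrm y) \<longlonglongrightarrow> 0"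
  proof (rule Lim_null_comparison)
    show "\<forall>\<^sub>F n in sequentially. norm (nrm (x n) - nrm y) \<le> nrm (\<lambda>s. x n s - y s)"
      using bd by (auto intro!: always_eventually)
    show "(\<lambda>n. nrm (\<lambda>s. x n s - y s)) \<longlonglongrightarrow> 0" using assms(3) by (simp add: tends_def)
  qed
  then show ?thesis by (simp add: LIM_zero_iff)
qed

lemma tends_ip2:
  assumes "\<And>n. x n \<in> V" "y \<in> V" "tends x y" "\<And>n. x' n \<in> V" "y' \<in> V" "tends x' y'"
  shows "(\<lambda>n. ip (x n) (x' n)) \<longlonglongrightarrow> ip y y'"
proof -
  have "(\<lambda>n. ip (\<lambda>s. x n s - y s) (x' n)) \<longlonglongrightarrow> 0"
  proof (rule Lim_null_comparison)
    show "\<forall>\<^sub>F n in sequentially. norm (ip (\<lambda>s. x n s - y s) (x' n)) \<le> nrm (\<lambda>s. x n s - y s) * nrm (x' n)"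
      using cauchy_schwarz[OF diff_mem[OF assms(1,2)] assms(4)] by (auto intro!: always_eventually)
    show "(\<lambda>n. nrm (\<lambda>s. x n s - y s) * nrm (x' n)) \<longlonglongrightarrow> 0"
      using tendsto_mult[OF assms(3)[unfolded tends_def] tends_nrm[OF assms(4-6)]] by simp
  qed
  from tendsto_add[OF this tends_ip[OF assms(4-6,2)]] show ?thesis
    using assms by (simp add: ip_diff ip_commute[of _ y])
qed

text \<open>
  Boundedness on \<open>V\<close> is automatic, by \<open>hellinger_toeplitz\<close>.
\<close>

definition sym_op :: "(('a \<Rightarrow> real) \<Rightarrow> ('a \<Rightarrow> real)) \<Rightarrow> bool" where
  "sym_op G \<longleftrightarrow> (\<forall>h\<in>V. G h \<in> V) \<and>
     (\<forall>a b. \<forall>h\<in>V. \<forall>g\<in>V. G (\<lambda>s. a * h s + b * g s) = (\<lambda>s. a * G h s + b * G g s)) \<and>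
     (\<forall>h\<in>V. \<forall>g\<in>V. ip (G h) g = ip h (G g))"

lemma sym_op_mem: "sym_op G \<Longrightarrow> h \<in> V \<Longrightarrow> G h \<in> V"
  and sym_op_lin: "sym_op G \<Longrightarrow> h \<in> V \<Longrightarrow> g \<in> V \<Longrightarrow> G (\<lambda>s. a * h s + b * g s) = (\<lambda>s. a * G h s + b * G g s)"
  and sym_op_ip: "sym_op G \<Longrightarrow> h \<in> V \<Longrightarrow> g \<in> V \<Longrightarrow> ip (G h) g = ip h (G g)"
  by (auto simp: sym_op_def)

lemma sym_op_scale: "sym_op G \<Longrightarrow> h \<in> V \<Longrightarrow> G (\<lambda>s. a * h s) = (\<lambda>s. a * G h s)"
  using sym_op_lin[of G h h a 0] by simp

lemma sym_op_diff: "sym_op G \<Longrightarrow> h \<in> V \<Longrightarrow> g \<in> V \<Longrightarrow> G (\<lambda>s. h s - g s) = (\<lambda>s. G h s - G g s)"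
  using sym_op_lin[of G h g 1 "-1"] by simp

lemma sym_op_add: "sym_op G \<Longrightarrow> h \<in> V \<Longrightarrow> g \<in> V \<Longrightarrow> G (\<lambda>s. h s + g s) = (\<lambda>s. G h s + G g s)"
  using sym_op_lin[of G h g 1 1] by simp

lemma sym_op_zero: "sym_op G \<Longrightarrow> G (\<lambda>_. 0) = (\<lambda>_. 0)"
  using sym_op_scale[of G "\<lambda>_. 0" 0] zero_mem by simp

text \<open>
  Gliding hump. If \<open>G\<close> were unbounded there would be unit vectors \<open>u n\<close> with \<open>g n = G (u n)\<close> of norm
  above \<open>4 ^ n\<close>. Moving by \<open>3 ^ -n\<close> in the direction \<open>\<plusminus> g n\<close>, with the sign that does not cancel the
  previous position, makes the functional \<open>\<langle>g n, \<cdot>\<rangle>\<close> at least \<open>3 ^ -n * nrm (g n)\<close> at the new point, and all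
  later moves together are too short to undo more than half of it. At the limit \<open>y\<close> the numbers
  \<open>\<langle>g n, y\<rangle> = \<langle>u n, G y\<rangle>\<close> are then at least \<open>(4/3) ^ n / 2\<close>, although they are bounded by \<open>nrm (G y)\<close>.
\<close>

lemma hellinger_toeplitz:
  assumes G: "sym_op G"
  obtains C where "0 < C" "\<And>h. h \<in> V \<Longrightarrow> nrm (G h) \<le> C * nrm h"
proof -
  have "\<exists>C>0. \<forall>h\<in>V. nrm (G h) \<le> C * nrm h"
  proof (rule ccontr)
    assume unb: "\<not> (\<exists>C>0. \<forall>h\<in>V. nrm (G h) \<le> C * nrm h)"
    have "\<exists>h\<in>V. nrm h = 1 \<and> nrm (G h) > 4 ^ n" for n
    proof -
      obtain h where h: "h \<in> V" "nrm (G h) > 4 ^ n * nrm h"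
        using unb by (meson not_le zero_less_numeral zero_less_power)
      have pos: "nrm h > 0"
      proof (rule ccontr)
        assume "\<not> nrm h > 0"
        then have "ip h h = 0" using nrm_nonneg[OF h(1)] nrm_sq[OF h(1)] by auto
        then have "h = (\<lambda>_. 0)" using ip_definite h by blast
        then show False using h(2) sym_op_zero[OF G] nrm_zero by simp
      qed
      let ?h = "\<lambda>s. (1 / nrm h) * h s"
      have "?h \<in> V" using scale_mem h by blast
      moreover have "nrm ?h = 1" using nrm_scale[OF h(1), of "1 / nrm h"] pos by simp
      moreover have "nrm (G ?h) > 4 ^ n"
      proof -
        have "nrm (G ?h) = \<bar>1 / nrm h\<bar> * nrm (G h)"
          by (simp only: sym_op_scale[OF G h(1)] nrm_scale[OF sym_op_mem[OF G h(1)]])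
        then show ?thesis using h(2) pos by (simp add: pos_less_divide_eq)
      qed
      ultimately show ?thesis by blast
    qed
    then obtain u where u: "\<And>n. u n \<in> V" "\<And>n. nrm (u n) = 1" "\<And>n. nrm (G (u n)) > 4 ^ n"
      by metis
    define g where "g n = G (u n)" for n
    have gV: "g n \<in> V" for n using sym_op_mem[OF G u(1)] by (simp add: g_def)
    have gpos: "nrm (g n) > 0" for n
      using u(3)[of n] less_trans[of 0 "4 ^ n" "nrm (G (u n))"] by (simp add: g_def)
    define \<sigma> where "\<sigma> n x = (if ip (g n) x \<ge> 0 then 1 else -1 :: real)" for n x
    define step where "step n x = (\<lambda>s. x s + (\<sigma> n x * (1/3) ^ n / nrm (g n)) * g n s)" for n x
    define x where "x = rec_nat (\<lambda>_. 0) step"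
    have xS: "x (Suc n) = step n (x n)" for n by (simp add: x_def)
    have xV: "x n \<in> V" for n
    proof (induction n)
      case 0 then show ?case by (simp add: x_def zero_mem)
    next
      case (Suc n)
      then show ?case unfolding xS step_def using add_mem scale_mem gV by blast
    qed
    have inc: "nrm (\<lambda>s. x (Suc n) s - x n s) = (1/3) ^ n" for n
    proof -
      have "(\<lambda>s. x (Suc n) s - x n s) = (\<lambda>s. (\<sigma> n (x n) * (1/3) ^ n / nrm (g n)) * g n s)"
        by (simp add: xS step_def)
      then show ?thesis using nrm_scale[of "g n" "\<sigma> n (x n) * (1/3) ^ n / nrm (g n)", OF gV] gpos[of n]
        by (simp add: abs_mult \<sigma>_def)
    qed
    \<comment> \<open>The sign \<open>\<sigma>\<close> prevents cancellation, so the absolute values add up.\<close>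
    have far: "\<bar>ip (g n) (x (Suc n))\<bar> \<ge> (1/3) ^ n * nrm (g n)" for n
    proof -
      have "ip (g n) (x (Suc n)) = ip (g n) (x n) + \<sigma> n (x n) * (1/3) ^ n / nrm (g n) * (nrm (g n))\<^sup>2"
        unfolding xS step_def ip_add_right[OF xV scale_mem[OF gV] gV] ip_scale_right[OF gV gV] nrm_sq[OF gV] ..
      also have "\<dots> = ip (g n) (x n) + \<sigma> n (x n) * ((1/3) ^ n * nrm (g n))"
        using gpos[of n] by (simp add: power2_eq_square)
      finally show ?thesis using gpos[of n] by (auto simp: \<sigma>_def)
    qed
    have tail: "nrm (\<lambda>s. x (n + k) s - x n s) \<le> (3/2) * (1/3) ^ n * (1 - (1/3) ^ k)" for n k
    proof (induction k)
      case 0 then show ?case using ip_zero zero_mem by (simp add: nrm_def)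
    next
      case (Suc k)
      have "nrm (\<lambda>s. x (n + Suc k) s - x n s) \<le> (1/3) ^ (n + k) + nrm (\<lambda>s. x (n + k) s - x n s)"
        using nrm_triangle[of "x (n + Suc k)" "x (n + k)" "x n", OF xV xV xV] inc[of "n + k"] by simp
      then show ?case using Suc by (simp add: power_add algebra_simps)
    qed
    have tail': "nrm (\<lambda>s. x m s - x n s) \<le> (3/2) * (1/3) ^ n" if "m \<ge> n" for m n
    proof -
      have "(3/2) * (1/3::real) ^ n * (1 - (1/3) ^ (m - n)) \<le> (3/2) * (1/3) ^ n * 1"
        by (intro mult_left_mono) auto
      from order_trans[OF tail[of n "m - n"] this] show ?thesis using that by simp
    qed
    obtain y where y: "y \<in> V" "(\<lambda>n. ip (\<lambda>s. x n s - y s) (\<lambda>s. x n s - y s)) \<longlonglongrightarrow> 0"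
    proof -
      have "\<exists>N. \<forall>m\<ge>N. \<forall>n\<ge>N. ip (\<lambda>s. x m s - x n s) (\<lambda>s. x m s - x n s) < e" if "e > 0" for e
      proof -
        have "(\<lambda>N. (3 * (1/3::real) ^ N)\<^sup>2) \<longlonglongrightarrow> (3 * 0)\<^sup>2"
          by (intro tendsto_intros LIMSEQ_realpow_zero) auto
        then have "\<forall>\<^sub>F N in sequentially. (3 * (1/3::real) ^ N)\<^sup>2 < e"
          by (rule order_tendstoD(2)) (use that in simp)
        then obtain N where N: "(3 * (1/3::real) ^ N)\<^sup>2 < e" by (auto simp: eventually_sequentially)
        have "ip (\<lambda>s. x m s - x n s) (\<lambda>s. x m s - x n s) < e" if "m \<ge> N" "n \<ge> N" for m n
        proof -
          have "nrm (\<lambda>s. x m s - x n s) \<le> 3 * (1/3::real) ^ N"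
            using nrm_triangle[of "x m" "x N" "x n", OF xV xV xV] tail'[OF that(1)] tail'[OF that(2)]
              nrm_diff_commute[of "x N" "x n", OF xV xV] by simp
          then have "(nrm (\<lambda>s. x m s - x n s))\<^sup>2 \<le> (3 * (1/3::real) ^ N)\<^sup>2"
            by (intro power_mono nrm_nonneg diff_mem xV)
          then show ?thesis using N nrm_sq[OF diff_mem[OF xV xV]] by simp
        qed
        then show ?thesis by blast
      qed
      then show thesis using ip_complete[of x, OF xV] that by blast
    qed
    have ty: "tends x y" using tends_iff_sq[OF xV y(1)] y(2) by simp
    have close: "nrm (\<lambda>s. y s - x n s) \<le> (3/2) * (1/3) ^ n" for n
    proof -
      have t0: "tends (\<lambda>m s. x m s - x n s) (\<lambda>s. y s - x n s)"
        using ty by (simp add: tends_def)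
      have "(\<lambda>m. nrm (\<lambda>s. x m s - x n s)) \<longlonglongrightarrow> nrm (\<lambda>s. y s - x n s)"
        by (rule tends_nrm[OF diff_mem[OF xV xV] diff_mem[OF y(1) xV] t0])
      then show ?thesis
        by (rule LIMSEQ_le_const2) (use tail' in blast)
    qed
    have bound: "(4/3) ^ n / 2 \<le> nrm (G y)" for n
    proof -
      have "\<bar>ip (g n) (x (Suc n))\<bar> \<le> \<bar>ip (g n) y\<bar> + \<bar>ip (g n) (\<lambda>s. y s - x (Suc n) s)\<bar>"
        using ip_diff_right[OF y(1) xV gV] by simp
      also have "\<bar>ip (g n) (\<lambda>s. y s - x (Suc n) s)\<bar> \<le> nrm (g n) * ((3/2) * (1/3) ^ Suc n)"
        using cauchy_schwarz[of "g n" "\<lambda>s. y s - x (Suc n) s", OF gV diff_mem[OF y(1) xV]] close[of "Suc n"] gpos[of n]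
        by (meson less_imp_le mult_left_mono order_trans)
      finally have "(1/3) ^ n * nrm (g n) / 2 \<le> \<bar>ip (g n) y\<bar>"
        using far[of n] by (simp add: field_simps)
      also have "ip (g n) y = ip (u n) (G y)" using sym_op_ip[OF G u(1) y(1)] by (simp add: g_def)
      also have "\<bar>ip (u n) (G y)\<bar> \<le> nrm (G y)"
        using cauchy_schwarz[OF u(1) sym_op_mem[OF G y(1)], of n] u(2) by simp
      finally have 1: "(1/3) ^ n * nrm (g n) / 2 \<le> nrm (G y)" .
      have "(1/3) ^ n * 4 ^ n \<le> (1/3) ^ n * nrm (g n)"
        using u(3)[of n] by (intro mult_left_mono) (auto simp: g_def)
      moreover have "(1/3) ^ n * 4 ^ n = (4/3::real) ^ n" by (simp flip: power_mult_distrib)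
      ultimately show ?thesis using 1 by simp
    qed
    obtain n where "2 * nrm (G y) < (4/3::real) ^ n" using real_arch_pow[of "4/3"] by auto
    then show False using bound[of n] by simp
  qed
  then show thesis using that by blast
qed

lemma sym_op_tends:
  assumes G: "sym_op G" and x: "\<And>n. x n \<in> V" "y \<in> V" "tends x y"
  shows "tends (\<lambda>n. G (x n)) (G y)"
proof -
  obtain C where C: "0 < C" "\<And>h. h \<in> V \<Longrightarrow> nrm (G h) \<le> C * nrm h"
    using hellinger_toeplitz[OF G] by blast
  have le: "nrm (\<lambda>s. G (x n) s - G y s) \<le> C * nrm (\<lambda>s. x n s - y s)" for n
    using C(2)[OF diff_mem[OF x(1,2)], of n] sym_op_diff[OF G x(1,2), of n] by simp
  have mem: "G (x n) \<in> V" "G y \<in> V" for n using sym_op_mem[OF G] x by auto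
  show ?thesis unfolding tends_def
  proof (rule Lim_null_comparison)
    show "\<forall>\<^sub>F n in sequentially. norm (nrm (\<lambda>s. G (x n) s - G y s)) \<le> C * nrm (\<lambda>s. x n s - y s)"
      using le nrm_nonneg[OF diff_mem[OF mem(1,2)]] by (auto intro!: always_eventually)
    show "(\<lambda>n. C * nrm (\<lambda>s. x n s - y s)) \<longlonglongrightarrow> 0"
      using tendsto_mult_right_zero[OF x(3)[unfolded tends_def]] .
  qed
qed

text \<open>
  Gradient steps for \<open>A y = x\<close>. The iterates are polynomials in \<open>A\<close> applied to \<open>x\<close>, hence they make sense
  for every \<open>x\<close>, also outside the range of \<open>A\<close>, and commute with all that commutes with \<open>A\<close>.
\<close>

fun landweber :: "(('a \<Rightarrow> real) \<Rightarrow> 'a \<Rightarrow> real) \<Rightarrow> real \<Rightarrow> nat \<Rightarrow> ('a \<Rightarrow> real) \<Rightarrow> 'a \<Rightarrow> real" where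
  "landweber A \<kappa> 0 x = (\<lambda>_. 0)"
| "landweber A \<kappa> (Suc n) x =
     (\<lambda>s. landweber A \<kappa> n x s + \<kappa> * A (\<lambda>s. x s - A (landweber A \<kappa> n x) s) s)"

lemma landweber_mem:
  assumes "sym_op A" "x \<in> V" shows "landweber A \<kappa> n x \<in> V"
  by (induction n) (auto intro!: zero_mem add_mem scale_mem diff_mem sym_op_mem[OF assms(1)] assms)

lemma landweber_commute:
  assumes A: "sym_op A" and G: "sym_op G" and x: "x \<in> V"
    and comm: "\<And>h. h \<in> V \<Longrightarrow> A (G h) = G (A h)"
  shows "G (landweber A \<kappa> n x) = landweber A \<kappa> n (G x)"
proof (induction n)
  case 0
  then show ?case by (simp add: sym_op_zero[OF G])
next
  case (Suc n)
  let ?y = "landweber A \<kappa> n x"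
  have m: "?y \<in> V" "A ?y \<in> V" "(\<lambda>s. x s - A ?y s) \<in> V" "A (\<lambda>s. x s - A ?y s) \<in> V"
    "(\<lambda>s. \<kappa> * A (\<lambda>s. x s - A ?y s) s) \<in> V"
    using landweber_mem[OF A x] diff_mem sym_op_mem[OF A] scale_mem x by simp_all
  have "G (landweber A \<kappa> (Suc n) x) = (\<lambda>s. G ?y s + \<kappa> * G (A (\<lambda>s. x s - A ?y s)) s)"
    using m by (simp add: sym_op_add[OF G] sym_op_scale[OF G])
  also have "G (A (\<lambda>s. x s - A ?y s)) = A (\<lambda>s. G x s - A (G ?y) s)"
    using m x by (simp flip: comm) (simp add: sym_op_diff[OF G] flip: comm)
  finally show ?case by (simp add: Suc.IH)
qed

text \<open>
  With step \<open>\<kappa> = 1 / C\<^sup>2\<close> for a bound \<open>C\<close> of \<open>A\<close>, the residual after \<open>n\<close> steps is \<open>r n = D\<^sup>n x\<close> with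
  \<open>D = I - \<kappa> A\<^sup>2\<close> and \<open>0 \<le> D \<le> I\<close>. The numbers \<open>s n = \<langle>D\<^sup>n x, x\<rangle>\<close> decrease to a limit, and the square of the distance of
  two residuals is \<open>s (2 m) + s (2 n) - 2 s (m + n)\<close>, so the residuals converge to some \<open>y\<close>. Since
  \<open>\<kappa> \<langle>A (r n), A (r n)\<rangle> = s (2 n) - s (2 n + 1)\<close> tends to 0, \<open>A y = 0\<close>, and injectivity gives \<open>y = 0\<close>.
  In particular the range of \<open>A\<close> is dense.
\<close>

lemma landweber_tends:
  assumes A: "sym_op A" and inj: "\<And>h. h \<in> V \<Longrightarrow> A h = (\<lambda>_. 0) \<Longrightarrow> h = (\<lambda>_. 0)"
  obtains \<kappa> where "\<And>x. x \<in> V \<Longrightarrow> tends (\<lambda>n. A (landweber A \<kappa> n x)) x"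
proof -
  obtain C where C: "0 < C" "\<And>h. h \<in> V \<Longrightarrow> nrm (A h) \<le> C * nrm h"
    using hellinger_toeplitz[OF A] by blast
  define \<kappa> where "\<kappa> = 1 / C\<^sup>2"
  have \<kappa>: "0 < \<kappa>" using C by (simp add: \<kappa>_def)
  have Amem: "A h \<in> V" if "h \<in> V" for h using sym_op_mem[OF A that] .
  have A2: "\<kappa> * ip (A h) (A h) \<le> ip h h" if "h \<in> V" for h
  proof -
    have "(nrm (A h))\<^sup>2 \<le> (C * nrm h)\<^sup>2"
      using C(2)[OF that] nrm_nonneg[OF Amem[OF that]] by (rule power_mono)
    then show ?thesis using C(1) that Amem[OF that]
      by (simp add: \<kappa>_def nrm_sq power_mult_distrib field_simps)
  qed
  have "tends (\<lambda>n. A (landweber A \<kappa> n x)) x" if x: "x \<in> V" for x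
  proof -
    define r where "r n = (\<lambda>s. x s - A (landweber A \<kappa> n x) s)" for n
    define D where "D h = (\<lambda>s. h s - \<kappa> * A (A h) s)" for h
    have Dmem: "D h \<in> V" if "h \<in> V" for h
      unfolding D_def by (intro diff_mem scale_mem Amem that)
    have Dip: "ip (D h) g = ip h g - \<kappa> * ip (A h) (A g)" if "h \<in> V" "g \<in> V" for h g
      unfolding D_def ip_diff[OF that(1) scale_mem[OF Amem[OF Amem[OF that(1)]]] that(2)]
        ip_scale[OF Amem[OF Amem[OF that(1)]] that(2)] sym_op_ip[OF A Amem[OF that(1)] that(2)] ..
    have Dsym: "ip (D h) g = ip h (D g)" if "h \<in> V" "g \<in> V" for h g
      using Dip[OF that] Dip[OF that(2,1)] by (simp add: ip_commute)
    have r0: "r 0 = x" by (simp add: r_def sym_op_zero[OF A])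
    have rmem: "r n \<in> V" for n
      unfolding r_def by (intro diff_mem landweber_mem[OF A x] Amem x)
    have rS: "r (Suc n) = D (r n)" for n
      using landweber_mem[OF A x] Amem rmem[of n] scale_mem
      by (simp add: r_def[of "Suc n"] D_def sym_op_add[OF A] sym_op_scale[OF A] flip: r_def) (simp add: r_def fun_eq_iff)
    define s where "s n = ip (r n) x" for n
    have rr: "ip (r n) (r m) = s (n + m)" for n m
    proof (induction m arbitrary: n)
      case 0 then show ?case by (simp add: s_def r0)
    next
      case (Suc m)
      have "ip (r n) (r (Suc m)) = ip (r (Suc n)) (r m)" by (simp add: rS Dsym rmem)
      then show ?case using Suc by simp
    qed
    have step: "s (2 * n + 1) = s (2 * n) - \<kappa> * ip (A (r n)) (A (r n))" for n
      using Dip[OF rmem rmem, of n n] rr[of n n] rr[of "Suc n" n] by (simp add: rS mult_2)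
    \<comment> \<open>The other half of the monotonicity of \<open>s\<close>: \<open>D\<^sup>2 \<le> D\<close>, which is where the choice of \<open>\<kappa>\<close> enters.\<close>
    have step': "s (2 * n + 2) \<le> s (2 * n + 1)" for n
    proof -
      have "s (2 * n + 2) = ip (D (r n)) (D (r n))" using rr[of "Suc n" "Suc n"] by (simp add: rS mult_2)
      also have "\<dots> = ip (r n) (D (r n)) - \<kappa> * ip (A (r n)) (A (D (r n)))"
        by (rule Dip[OF rmem Dmem[OF rmem]])
      also have "ip (A (r n)) (A (D (r n))) = ip (D (r n)) (A (A (r n)))"
        using sym_op_ip[OF A Dmem[OF rmem] Amem[OF rmem], of n n] by (simp add: ip_commute)
      also have "\<dots> = ip (A (r n)) (A (r n)) - \<kappa> * ip (A (A (r n))) (A (A (r n)))"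
        using Dip[OF rmem Amem[OF Amem[OF rmem]], of n n] rmem Amem
        by (simp add: sym_op_ip[OF A])
      also have "ip (r n) (D (r n)) = s (2 * n + 1)" using rr[of n "Suc n"] by (simp add: rS mult_2)
      finally show ?thesis
        using A2[OF Amem[OF rmem[of n]]] \<kappa> by simp
    qed
    have dec: "s (Suc n) \<le> s n" for n
    proof (cases "even n")
      case True
      then obtain k where "n = 2 * k" by blast
      moreover have "0 \<le> \<kappa> * ip (A (r k)) (A (r k))" using \<kappa> ip_nonneg[OF Amem[OF rmem]] by simp
      ultimately show ?thesis using step[of k] by simp
    next
      case False
      then obtain k where "n = 2 * k + 1" using oddE by blast
      then show ?thesis using step'[of k] by simp
    qed
    then have "decseq s" by (simp add: decseq_Suc_iff)
    moreover have "\<forall>n. 0 \<le> s n"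
    proof
      fix n
      have "0 \<le> s (n + n)" using rr[of n n] ip_nonneg[OF rmem] by metis
      also have "s (n + n) \<le> s n" using \<open>decseq s\<close> by (simp add: decseq_def)
      finally show "0 \<le> s n" .
    qed
    ultimately have "\<exists>l. s \<longlonglongrightarrow> l" by (elim decseq_convergent[of s 0]) auto
    then obtain l where l: "s \<longlonglongrightarrow> l" by blast
    have diff: "ip (\<lambda>u. r m u - r n u) (\<lambda>u. r m u - r n u) = s (2 * m) + s (2 * n) - 2 * s (m + n)" for m n
    proof -
      have "ip (\<lambda>u. r m u - r n u) (\<lambda>u. r m u - r n u) =
          (ip (r m) (r m) - ip (r m) (r n)) - (ip (r n) (r m) - ip (r n) (r n))"
        by (simp only: ip_diff[OF rmem[of m] rmem[of n] diff_mem[OF rmem[of m] rmem[of n]]]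
          ip_diff_right[OF rmem[of m] rmem[of n] rmem[of m]] ip_diff_right[OF rmem[of m] rmem[of n] rmem[of n]])
      then show ?thesis unfolding rr[of m m] rr[of m n] rr[of n m] rr[of n n]
        unfolding mult_2[of m] mult_2[of n] add.commute[of n m] by linarith
    qed
    obtain y where y: "y \<in> V" "(\<lambda>n. ip (\<lambda>u. r n u - y u) (\<lambda>u. r n u - y u)) \<longlonglongrightarrow> 0"
    proof -
      have "\<exists>N. \<forall>m\<ge>N. \<forall>n\<ge>N. ip (\<lambda>u. r m u - r n u) (\<lambda>u. r m u - r n u) < e" if "e > 0" for e
      proof -
        have "\<exists>N. \<forall>n\<ge>N. norm (s n - l) < e / 4" by (rule LIMSEQ_D[OF l]) (use that in simp)
        then obtain N where N: "\<And>n. n \<ge> N \<Longrightarrow> \<bar>s n - l\<bar> < e / 4" by auto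
        have "ip (\<lambda>u. r m u - r n u) (\<lambda>u. r m u - r n u) < e" if "m \<ge> N" "n \<ge> N" for m n
          unfolding diff using N[of "2 * m"] N[of "2 * n"] N[of "m + n"] that by linarith
        then show ?thesis by blast
      qed
      then show thesis using ip_complete[of r, OF rmem] that by blast
    qed
    have ty: "tends r y" using tends_iff_sq[OF rmem y(1)] y(2) by simp
    have "(\<lambda>n. \<kappa> * ip (A (r n)) (A (r n))) = (\<lambda>n. s (2 * n) - s (2 * n + 1))"
      using step by (simp add: fun_eq_iff)
    also have "\<dots> \<longlonglongrightarrow> l - l"
    proof (intro tendsto_diff)
      show "(\<lambda>n. s (2 * n)) \<longlonglongrightarrow> l" "(\<lambda>n. s (2 * n + 1)) \<longlonglongrightarrow> l"
        using LIMSEQ_subseq_LIMSEQ[OF l, of "\<lambda>n. 2 * n"] LIMSEQ_subseq_LIMSEQ[OF l, of "\<lambda>n. 2 * n + 1"]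
        by (simp_all add: o_def strict_mono_def)
    qed
    finally have "(\<lambda>n. (1 / \<kappa>) * (\<kappa> * ip (A (r n)) (A (r n)))) \<longlonglongrightarrow> (1 / \<kappa>) * 0"
      by (intro tendsto_mult tendsto_const) simp
    then have Ar: "(\<lambda>n. ip (A (r n)) (A (r n))) \<longlonglongrightarrow> 0" using \<kappa> by simp
    have tAy: "tends (\<lambda>n. A (r n)) (A y)" using sym_op_tends[OF A rmem y(1) ty] .
    have "(\<lambda>n. ip (A (r n)) (A (r n))) \<longlonglongrightarrow> ip (A y) (A y)"
      by (rule tends_ip2) (use rmem Amem y tAy in auto)
    then have "ip (A y) (A y) = 0" using LIMSEQ_unique Ar by blast
    then have y0: "y = (\<lambda>_. 0)" using inj y(1) ip_definite[OF Amem[OF y(1)]] by blast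
    have "nrm (\<lambda>u. A (landweber A \<kappa> n x) u - x u) = nrm (\<lambda>u. r n u - y u)" for n
      using nrm_diff_commute[OF Amem[OF landweber_mem[OF A x]] x] by (simp add: r_def y0)
    then show ?thesis using ty by (simp add: tends_def)
  qed
  then show thesis using that by blast
qed

end

section \<open>Square integrable functions\<close>

definition square_integrable :: "'a measure \<Rightarrow> ('a \<Rightarrow> real) \<Rightarrow> bool" where
  "square_integrable M f \<longleftrightarrow> f \<in> borel_measurable M \<and> integrable M (\<lambda>x. (f x)\<^sup>2)"

lemma square_integrable_mult:
  assumes "square_integrable M f" "square_integrable M g"
  shows "integrable M (\<lambda>x. f x * g x)"
proof (rule Bochner_Integration.integrable_bound)
  show "integrable M (\<lambda>x. (f x)\<^sup>2 + (g x)\<^sup>2)"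
    using assms by (simp add: square_integrable_def)
  show "(\<lambda>x. f x * g x) \<in> borel_measurable M"
    using assms by (auto simp: square_integrable_def)
  show "AE x in M. norm (f x * g x) \<le> norm ((f x)\<^sup>2 + (g x)\<^sup>2)"
  proof (rule AE_I2)
    fix x
    have "\<bar>f x\<bar> * \<bar>g x\<bar> \<le> (f x)\<^sup>2 + (g x)\<^sup>2"
    proof -
      have "0 \<le> \<bar>f x\<bar> * \<bar>g x\<bar>" by simp
      moreover have "2 * (\<bar>f x\<bar> * \<bar>g x\<bar>) \<le> (f x)\<^sup>2 + (g x)\<^sup>2"
        using sum_squares_bound[of "\<bar>f x\<bar>" "\<bar>g x\<bar>"] by (simp add: mult.assoc)
      ultimately show ?thesis by linarith
    qed
    then show "norm (f x * g x) \<le> norm ((f x)\<^sup>2 + (g x)\<^sup>2)"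
      by (simp add: abs_mult)
  qed
qed

lemma square_integrable_lin:
  assumes "square_integrable M f" "square_integrable M g"
  shows "square_integrable M (\<lambda>x. a * f x + b * g x)"
proof -
  have "integrable M (\<lambda>x. a\<^sup>2 * (f x)\<^sup>2 + 2 * a * b * (f x * g x) + b\<^sup>2 * (g x)\<^sup>2)"
    using assms square_integrable_mult[OF assms] by (auto simp: square_integrable_def)
  also have "(\<lambda>x. a\<^sup>2 * (f x)\<^sup>2 + 2 * a * b * (f x * g x) + b\<^sup>2 * (g x)\<^sup>2) = (\<lambda>x. (a * f x + b * g x)\<^sup>2)"
    by (simp add: fun_eq_iff power2_eq_square algebra_simps)
  finally show ?thesis using assms by (auto simp: square_integrable_def)
qed

lemma square_integrable_diff:
  "square_integrable M f \<Longrightarrow> square_integrable M g \<Longrightarrow> square_integrable M (\<lambda>x. f x - g x)"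
  using square_integrable_lin[of M f g 1 "-1"] by simp

lemma square_integrable_add:
  "square_integrable M f \<Longrightarrow> square_integrable M g \<Longrightarrow> square_integrable M (\<lambda>x. f x + g x)"
  using square_integrable_lin[of M f g 1 1] by simp

lemma square_integrable_nnI:
  assumes "f \<in> borel_measurable M" "(\<integral>\<^sup>+x. ennreal ((f x)\<^sup>2) \<partial>M) < \<infinity>"
  shows "square_integrable M f"
  using assms by (auto simp: square_integrable_def intro!: integrableI_bounded)

lemma square_integrable_nn:
  assumes "square_integrable M f"
  shows "(\<integral>\<^sup>+x. ennreal ((f x)\<^sup>2) \<partial>M) = ennreal (\<integral>x. (f x)\<^sup>2 \<partial>M)"
  using assms by (intro nn_integral_eq_integral) (auto simp: square_integrable_def)

lemma square_integrable_integrable: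
  assumes "finite_measure M" "square_integrable M f"
  shows "integrable M f"
proof -
  interpret finite_measure M by fact
  have "square_integrable M (\<lambda>_. 1)" by (simp add: square_integrable_def)
  from square_integrable_mult[OF assms(2) this] show ?thesis by simp
qed

text \<open>
  The weighted series \<open>\<Sum> 2\<^sup>n (f (n+1) - f n)\<^sup>2\<close> has a finite integral, hence a finite sum \<open>s\<close> almost
  everywhere; there the increments are dominated by the geometric sequence \<open>\<surd>s * (\<surd>(1/2))\<^sup>n\<close>.
\<close>

lemma fast_cauchy_AE_convergent:
  fixes f :: "nat \<Rightarrow> 'a \<Rightarrow> real"
  assumes f[measurable]: "\<And>n. f n \<in> borel_measurable M"
    and fast: "\<And>n. (\<integral>\<^sup>+x. ennreal ((f (Suc n) x - f n x)\<^sup>2) \<partial>M) \<le> ennreal (C * (1/4) ^ n)"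
  shows "AE x in M. convergent (\<lambda>n. f n x)"
proof -
  have C: "summable (\<lambda>n. \<bar>C\<bar> * (1/2) ^ n)" by (intro summable_mult summable_geometric) auto
  have "(\<integral>\<^sup>+x. (\<Sum>n. ennreal (2 ^ n * (f (Suc n) x - f n x)\<^sup>2)) \<partial>M) =
      (\<Sum>n. \<integral>\<^sup>+x. ennreal (2 ^ n * (f (Suc n) x - f n x)\<^sup>2) \<partial>M)"
    by (intro nn_integral_suminf) simp
  also have "\<dots> \<le> (\<Sum>n. ennreal (\<bar>C\<bar> * (1/2) ^ n))"
  proof (intro suminf_le summableI)
    fix n
    have "(\<integral>\<^sup>+x. ennreal (2 ^ n * (f (Suc n) x - f n x)\<^sup>2) \<partial>M) =
        ennreal (2 ^ n) * (\<integral>\<^sup>+x. ennreal ((f (Suc n) x - f n x)\<^sup>2) \<partial>M)"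
      by (subst nn_integral_cmult[symmetric]) (auto simp: ennreal_mult)
    also have "\<dots> \<le> ennreal (2 ^ n) * ennreal (\<bar>C\<bar> * (1/4) ^ n)"
      using fast[of n] by (intro mult_left_mono order_trans[OF fast] ennreal_leI mult_right_mono) auto
    also have "\<dots> = ennreal (2 ^ n * (\<bar>C\<bar> * (1/4) ^ n))" by (simp add: ennreal_mult')
    also have "2 ^ n * (\<bar>C\<bar> * (1/4) ^ n) = \<bar>C\<bar> * (2 * (1/4)) ^ n" by (simp only: power_mult_distrib ac_simps)
    finally show "(\<integral>\<^sup>+x. ennreal (2 ^ n * (f (Suc n) x - f n x)\<^sup>2) \<partial>M) \<le> ennreal (\<bar>C\<bar> * (1/2) ^ n)" by simp
  qed
  also have "\<dots> = ennreal (\<Sum>n. \<bar>C\<bar> * (1/2) ^ n)" by (rule suminf_ennreal2[OF _ C]) simp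
  also have "\<dots> < \<infinity>" by simp
  finally have "AE x in M. (\<Sum>n. ennreal (2 ^ n * (f (Suc n) x - f n x)\<^sup>2)) \<noteq> \<infinity>"
    by (intro nn_integral_noteq_infinite) auto
  then show ?thesis
  proof eventually_elim
    case (elim x)
    define a where "a n = 2 ^ n * (f (Suc n) x - f n x)\<^sup>2" for n
    define s where "s = enn2real (\<Sum>n. ennreal (a n))"
    have s: "ennreal s = (\<Sum>n. ennreal (a n))" "0 \<le> s"
      using elim by (auto simp: s_def a_def less_top)
    have bd: "norm (f (Suc n) x - f n x) \<le> sqrt s * (sqrt (1/2)) ^ n" for n
    proof -
      have "(\<Sum>i\<in>{n}. ennreal (a i)) \<le> (\<Sum>n. ennreal (a n))" by (rule sum_le_suminf) auto
      then have "ennreal (a n) \<le> ennreal s" by (simp add: s(1))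
      then have "2 ^ n * (f (Suc n) x - f n x)\<^sup>2 \<le> s" using s(2) by (simp add: ennreal_le_iff a_def)
      then have "(f (Suc n) x - f n x)\<^sup>2 \<le> s * (1/2) ^ n"
        by (simp add: field_simps power_divide)
      then have "sqrt ((f (Suc n) x - f n x)\<^sup>2) \<le> sqrt (s * (1/2) ^ n)" by (rule real_sqrt_le_mono)
      then show ?thesis unfolding real_sqrt_abs real_sqrt_mult[of s] real_sqrt_power[of "1/2"] real_norm_def .
    qed
    have sm: "summable (\<lambda>n. sqrt s * (sqrt (1/2)) ^ n)"
      by (intro summable_mult summable_geometric) (auto simp: real_sqrt_divide)
    have "summable (\<lambda>n. f (Suc n) x - f n x)" by (rule summable_comparison_test'[OF sm bd])
    then have "convergent (\<lambda>n. \<Sum>i<n. f (Suc i) x - f i x)" by (simp add: summable_iff_convergent)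
    then have "convergent (\<lambda>n. f n x - f 0 x)" by (simp add: sum_lessThan_telescope[of "\<lambda>n. f n x"])
    then show ?case using convergent_add_const_right_iff[of "\<lambda>n. f n x" "- f 0 x"] by simp
  qed
qed

lemma fatou_square:
  fixes f :: "nat \<Rightarrow> 'a \<Rightarrow> real"
  assumes [measurable]: "\<And>n. f n \<in> borel_measurable M" "h \<in> borel_measurable M" "g \<in> borel_measurable M"
    and lim: "AE x in M. (\<lambda>n. f n x) \<longlonglongrightarrow> g x"
    and bd: "\<forall>\<^sub>F n in sequentially. (\<integral>\<^sup>+x. ennreal ((f n x - h x)\<^sup>2) \<partial>M) \<le> B"
  shows "(\<integral>\<^sup>+x. ennreal ((g x - h x)\<^sup>2) \<partial>M) \<le> B"
proof -
  have "(\<integral>\<^sup>+x. ennreal ((g x - h x)\<^sup>2) \<partial>M) = (\<integral>\<^sup>+x. liminf (\<lambda>n. ennreal ((f n x - h x)\<^sup>2)) \<partial>M)"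
  proof (rule nn_integral_cong_AE)
    show "AE x in M. ennreal ((g x - h x)\<^sup>2) = liminf (\<lambda>n. ennreal ((f n x - h x)\<^sup>2))"
      using lim
    proof eventually_elim
      case (elim x)
      then have "(\<lambda>n. ennreal ((f n x - h x)\<^sup>2)) \<longlonglongrightarrow> ennreal ((g x - h x)\<^sup>2)"
        by (intro tendsto_intros)
      then show ?case by (rule lim_imp_Liminf[OF sequentially_bot, symmetric])
    qed
  qed
  also have "\<dots> \<le> liminf (\<lambda>n. \<integral>\<^sup>+x. ennreal ((f n x - h x)\<^sup>2) \<partial>M)"
    by (intro nn_integral_liminf) simp
  also have "\<dots> \<le> liminf (\<lambda>n. B)" using bd by (rule Liminf_mono)
  also have "\<dots> = B" by (simp add: Liminf_const)
  finally show ?thesis .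
qed

lemma riesz_fischer:
  fixes f :: "nat \<Rightarrow> 'a \<Rightarrow> real"
  assumes f: "\<And>n. square_integrable M (f n)"
    and cauchy: "\<And>e. 0 < e \<Longrightarrow> \<exists>N. \<forall>m\<ge>N. \<forall>n\<ge>N. (\<integral>x. (f m x - f n x)\<^sup>2 \<partial>M) < e"
  obtains g where "square_integrable M g" "(\<lambda>n. \<integral>x. (f n x - g x)\<^sup>2 \<partial>M) \<longlonglongrightarrow> 0"
proof -
  have m[measurable]: "f n \<in> borel_measurable M" for n using f by (simp add: square_integrable_def)
  have "\<exists>N. \<forall>m\<ge>N. \<forall>n\<ge>N. (\<integral>x. (f m x - f n x)\<^sup>2 \<partial>M) < (1/4) ^ k" for k
    by (rule cauchy) simp
  then obtain N where N: "\<And>k m n. m \<ge> N k \<Longrightarrow> n \<ge> N k \<Longrightarrow> (\<integral>x. (f m x - f n x)\<^sup>2 \<partial>M) < (1/4) ^ k"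
    by metis
  \<comment> \<open>A sum of the thresholds dominates each of them and is monotone.\<close>
  define r where "r k = (\<Sum>j\<le>k. N j)" for k
  have r: "r k \<ge> N k" "r (Suc k) \<ge> r k" for k
    by (auto simp: r_def intro: member_le_sum)
  have nn: "(\<integral>\<^sup>+x. ennreal ((f m x - f n x)\<^sup>2) \<partial>M) = ennreal (\<integral>x. (f m x - f n x)\<^sup>2 \<partial>M)" for m n
    by (intro square_integrable_nn square_integrable_diff f)
  have conv: "AE x in M. convergent (\<lambda>k. f (r k) x)"
  proof (rule fast_cauchy_AE_convergent[where C=1])
    fix k
    have "(\<integral>x. (f (r (Suc k)) x - f (r k) x)\<^sup>2 \<partial>M) < (1/4) ^ k"
      by (rule N) (use r[of k] in auto)
    then show "(\<integral>\<^sup>+x. ennreal ((f (r (Suc k)) x - f (r k) x)\<^sup>2) \<partial>M) \<le> ennreal (1 * (1/4) ^ k)"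
      unfolding nn by (intro ennreal_leI) simp
  qed simp
  define g where "g x = lim (\<lambda>k. f (r k) x)" for x
  have gm[measurable]: "g \<in> borel_measurable M" unfolding g_def by measurable
  have lim: "AE x in M. (\<lambda>k. f (r k) x) \<longlonglongrightarrow> g x"
    using conv by eventually_elim (simp add: g_def convergent_LIMSEQ_iff)
  have close: "(\<integral>\<^sup>+x. ennreal ((g x - f n x)\<^sup>2) \<partial>M) \<le> ennreal ((1/4) ^ k)" if "n \<ge> N k" for n k
  proof (rule fatou_square[OF _ _ _ lim])
    show "\<forall>\<^sub>F j in sequentially. (\<integral>\<^sup>+x. ennreal ((f (r j) x - f n x)\<^sup>2) \<partial>M) \<le> ennreal ((1/4) ^ k)"
      using eventually_ge_at_top[of k]
    proof eventually_elim
      case (elim j)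
      have "N k \<le> r j" unfolding r_def by (rule member_le_sum) (use elim in auto)
      then show ?case unfolding nn using N[OF _ that, of "r j"] by (intro ennreal_leI) simp
    qed
  qed simp_all
  have gd: "square_integrable M (\<lambda>x. g x - f n x)" if "n \<ge> N k" for n k
    using close[OF that] by (intro square_integrable_nnI) (auto intro: le_less_trans)
  have "square_integrable M (\<lambda>x. (g x - f (N 0) x) + f (N 0) x)"
    by (intro square_integrable_add gd[of 0] f) simp
  then have g: "square_integrable M g" by simp
  have le: "(\<integral>x. (f n x - g x)\<^sup>2 \<partial>M) \<le> (1/4) ^ k" if "n \<ge> N k" for n k
    using close[OF that] square_integrable_nn[OF gd[OF that]] by (simp add: power2_commute)
  have "(\<lambda>n. \<integral>x. (f n x - g x)\<^sup>2 \<partial>M) \<longlonglongrightarrow> 0"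
  proof (rule LIMSEQ_I)
    fix e :: real assume "0 < e"
    then obtain k where k: "(1/4) ^ k < e" using real_arch_pow_inv[of e "1/4"] by auto
    show "\<exists>no. \<forall>n\<ge>no. norm ((\<integral>x. (f n x - g x)\<^sup>2 \<partial>M) - 0) < e"
      using le k by (intro exI[of _ "N k"]) (auto intro: le_less_trans)
  qed
  then show thesis using g that by blast
qed

section \<open>The Cameron-Martin space\<close>

abbreviation lebT :: "real \<Rightarrow> real measure" where
  "lebT T \<equiv> restrict_space lborel {0..T}"

lemma finite_measure_lebT: "finite_measure (lebT T)"
  by (intro finite_measureI) (simp add: space_restrict_space emeasure_restrict_space emeasure_lborel_Icc_eq)

lemma has_cm_deriv_iff:
  "has_cm_deriv T h g \<longleftrightarrow> g \<in> borel_measurable borel \<and> square_integrable (lebT T) g \<and>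
     (\<forall>t\<in>{0..T}. h t = (\<integral>s. indicator {0..t} s * g s \<partial>lebT T))"
proof -
  have eq: "(LINT s:{0..t}|lborel. g s) = (\<integral>s. indicator {0..t} s * g s \<partial>lebT T)" if "t \<in> {0..T}" for t
    unfolding set_lebesgue_integral_def using that
    by (subst integral_restrict_space) (auto intro!: Bochner_Integration.integral_cong simp: indicator_def)
  have m: "g \<in> borel_measurable (lebT T)" if "g \<in> borel_measurable borel"
    using that by (intro measurable_restrict_space1) simp
  have i: "integrable (lebT T) (\<lambda>s. (g s)\<^sup>2) \<longleftrightarrow> set_integrable lborel {0..T} (\<lambda>s. (g s)\<^sup>2)"
    unfolding set_integrable_def by (subst integrable_restrict_space) auto
  have "(\<forall>t\<in>{0..T}. h t = (LINT s:{0..t}|lborel. g s)) \<longleftrightarrow>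
      (\<forall>t\<in>{0..T}. h t = (\<integral>s. indicator {0..t} s * g s \<partial>lebT T))"
    using eq by (intro ball_cong) auto
  then show ?thesis
    unfolding has_cm_deriv_def square_integrable_def i using m by blast
qed

lemma cm_inner_lebT: "cm_inner T h g = (\<integral>s. cm_deriv T h s * cm_deriv T g s \<partial>lebT T)"
  unfolding cm_inner_def set_lebesgue_integral_def by (subst integral_restrict_space) auto

lemma cm_inner_eqT:
  assumes "has_cm_deriv T h p" "has_cm_deriv T g q" "0 \<le> T"
  shows "cm_inner T h g = (\<integral>s. p s * q s \<partial>lebT T)"
  unfolding cm_inner_eq[OF assms] set_lebesgue_integral_def by (subst integral_restrict_space) auto

lemma has_cm_deriv_cm_deriv: "h \<in> cm_space T \<Longrightarrow> has_cm_deriv T h (cm_deriv T h)"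
  using someI_ex[of "has_cm_deriv T h"] by (auto simp: cm_deriv_def cm_space_def)

lemma has_cm_deriv_lin:
  assumes "has_cm_deriv T h p" "has_cm_deriv T g q"
  shows "has_cm_deriv T (\<lambda>s. a * h s + b * g s) (\<lambda>s. a * p s + b * q s)"
proof -
  have p: "p \<in> borel_measurable borel" "q \<in> borel_measurable borel"
    "square_integrable (lebT T) p" "square_integrable (lebT T) q"
    using assms by (auto simp: has_cm_deriv_iff)
  have i: "integrable (lebT T) (\<lambda>s. indicator {0..t} s * f s)" if "square_integrable (lebT T) f" for t f
  proof -
    have "{0..t} \<inter> {0..T} \<in> sets (lebT T)" by (auto simp: sets_restrict_space)
    from integrable_mult_indicator[OF this square_integrable_integrable[OF finite_measure_lebT that]]
    show ?thesis
      by (rule Bochner_Integration.integrable_cong[THEN iffD1, rotated 2])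
        (auto simp: indicator_def space_restrict_space)
  qed
  show ?thesis unfolding has_cm_deriv_iff
  proof (intro conjI ballI square_integrable_lin p)
    fix t assume t: "t \<in> {0..T}"
    have "(\<integral>s. indicator {0..t} s * (a * p s + b * q s) \<partial>lebT T) =
        (\<integral>s. a * (indicator {0..t} s * p s) + b * (indicator {0..t} s * q s) \<partial>lebT T)"
      by (intro Bochner_Integration.integral_cong) (auto simp: algebra_simps)
    then show "a * h t + b * g t = (\<integral>s. indicator {0..t} s * (a * p s + b * q s) \<partial>lebT T)"
      using assms i[OF p(3), of t] i[OF p(4), of t] t by (simp add: has_cm_deriv_iff)
  qed (use p in simp)
qed

lemma cm_space_lin:
  assumes "h \<in> cm_space T" "g \<in> cm_space T"
  shows "(\<lambda>s. a * h s + b * g s) \<in> cm_space T"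
proof -
  have "has_cm_deriv T (\<lambda>s. a * h s + b * g s) (\<lambda>s. a * cm_deriv T h s + b * cm_deriv T g s)"
    by (intro has_cm_deriv_lin has_cm_deriv_cm_deriv assms)
  then show ?thesis using assms by (auto simp: cm_space_def)
qed

text \<open>
  A limit of the derivatives in \<open>L\<^sup>2([0,T])\<close> is the derivative of the limit. It is only measurable on
  \<open>[0,T]\<close> and is extended by 0 to a Borel function on the line.
\<close>

lemma cm_complete:
  assumes T: "0 \<le> T" and x: "\<And>n::nat. x n \<in> cm_space T"
    and cauchy: "\<And>e. 0 < e \<Longrightarrow>
      \<exists>N. \<forall>m\<ge>N. \<forall>n\<ge>N. cm_inner T (\<lambda>s. x m s - x n s) (\<lambda>s. x m s - x n s) < e"
  shows "\<exists>y\<in>cm_space T. (\<lambda>n. cm_inner T (\<lambda>s. x n s - y s) (\<lambda>s. x n s - y s)) \<longlonglongrightarrow> 0"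
proof -
  define f where "f n = cm_deriv T (x n)" for n
  have f: "has_cm_deriv T (x n) (f n)" for n
    unfolding f_def by (rule has_cm_deriv_cm_deriv[OF x])
  then have fs: "square_integrable (lebT T) (f n)" for n by (simp add: has_cm_deriv_iff)
  have dist: "cm_inner T (\<lambda>s. x n s - y s) (\<lambda>s. x n s - y s) = (\<integral>s. (f n s - g s)\<^sup>2 \<partial>lebT T)"
    if "has_cm_deriv T y g" for n y g
  proof -
    have "has_cm_deriv T (\<lambda>s. x n s - y s) (\<lambda>s. f n s - g s)"
      using has_cm_deriv_lin[OF f that, of 1 n "-1"] by simp
    from cm_inner_eqT[OF this this T] show ?thesis by (simp add: power2_eq_square)
  qed
  obtain g where g: "square_integrable (lebT T) g" "(\<lambda>n. \<integral>s. (f n s - g s)\<^sup>2 \<partial>lebT T) \<longlonglongrightarrow> 0"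
    using riesz_fischer[of "lebT T" f, OF fs] cauchy unfolding dist[OF f] by blast
  define g' where "g' s = indicator {0..T} s * g s" for s
  have g'm: "g' \<in> borel_measurable borel"
    using g(1) unfolding square_integrable_def g'_def by (simp add: borel_measurable_restrict_space_iff)
  have sp: "space (lebT T) = {0..T}" by (simp add: space_restrict_space)
  have eq: "g' s = g s" if "s \<in> space (lebT T)" for s using that by (simp add: g'_def sp)
  define y where "y t = (if t \<in> {0..T} then \<integral>s. indicator {0..t} s * g' s \<partial>lebT T else 0)" for t
  have "square_integrable (lebT T) g'"
    using g(1) measurable_cong[of "lebT T" g' g borel, OF eq]
      Bochner_Integration.integrable_cong[of "lebT T" "lebT T" "\<lambda>s. (g' s)\<^sup>2" "\<lambda>s. (g s)\<^sup>2"] eq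
    unfolding square_integrable_def by simp
  then have y: "has_cm_deriv T y g'" using g'm by (simp add: has_cm_deriv_iff y_def)
  then have "y \<in> cm_space T" by (auto simp: cm_space_def y_def)
  moreover have "(\<integral>s. (f n s - g' s)\<^sup>2 \<partial>lebT T) = (\<integral>s. (f n s - g s)\<^sup>2 \<partial>lebT T)" for n
    using eq by (intro Bochner_Integration.integral_cong) auto
  ultimately show ?thesis using g(2) by (intro bexI[of _ y]) (auto simp: dist[OF y])
qed

lemma cm_space_hilbert:
  assumes T: "0 \<le> T"
  shows "hilbert_function_space (cm_space T) (cm_inner T)"
proof
  have 0: "has_cm_deriv T (\<lambda>_. 0) (\<lambda>_. 0)" by (simp add: has_cm_deriv_iff square_integrable_def)
  then show "(\<lambda>_. 0) \<in> cm_space T" by (auto simp: cm_space_def)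
  show "(\<lambda>s. a * f s + b * g s) \<in> cm_space T" if "f \<in> cm_space T" "g \<in> cm_space T" for f g a b
    using cm_space_lin that .
  show "cm_inner T (\<lambda>s. a * f s + b * g s) h = a * cm_inner T f h + b * cm_inner T g h"
    if "f \<in> cm_space T" "g \<in> cm_space T" "h \<in> cm_space T" for f g h a b
  proof -
    note d = that[THEN has_cm_deriv_cm_deriv]
    have i: "integrable (lebT T) (\<lambda>s. cm_deriv T f s * cm_deriv T h s)"
      "integrable (lebT T) (\<lambda>s. cm_deriv T g s * cm_deriv T h s)"
      using d by (auto intro!: square_integrable_mult simp: has_cm_deriv_iff)
    have "cm_inner T (\<lambda>s. a * f s + b * g s) h =
        (\<integral>s. (a * cm_deriv T f s + b * cm_deriv T g s) * cm_deriv T h s \<partial>lebT T)"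
      by (rule cm_inner_eqT[OF has_cm_deriv_lin[OF d(1,2)] d(3) T])
    also have "\<dots> = (\<integral>s. a * (cm_deriv T f s * cm_deriv T h s) + b * (cm_deriv T g s * cm_deriv T h s) \<partial>lebT T)"
      by (intro Bochner_Integration.integral_cong) (auto simp: algebra_simps)
    finally show ?thesis using i by (simp add: cm_inner_lebT)
  qed
  show "cm_inner T f g = cm_inner T g f" for f g by (rule cm_inner_commute)
  show "0 \<le> cm_inner T f f" for f by (simp add: cm_inner_lebT)
  show "f = (\<lambda>_. 0)" if f: "f \<in> cm_space T" "cm_inner T f f = 0" for f
  proof -
    note d = has_cm_deriv_cm_deriv[OF f(1)]
    have "AE s in lebT T. (cm_deriv T f s)\<^sup>2 = 0"
      using f(2) d by (subst (asm) cm_inner_lebT, subst integral_nonneg_eq_0_iff_AE[symmetric])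
        (auto simp: has_cm_deriv_iff square_integrable_def power2_eq_square)
    then have "(\<integral>s. indicator {0..t} s * cm_deriv T f s \<partial>lebT T) = 0" for t
      by (intro integral_eq_zero_AE) auto
    then have "f t = 0" if "t \<in> {0..T}" for t using d that by (simp add: has_cm_deriv_iff)
    then show ?thesis using f(1) by (auto simp: cm_space_def fun_eq_iff)
  qed
qed (rule cm_complete[OF T])

lemma chi_comb_path_comb: "chi_comb T c s = path_comb c (\<lambda>t. chi T t s)"
  by (simp add: chi_comb_def path_comb_def)

lemma path_comb_simps [simp]:
  "path_comb [] \<omega> = 0" "path_comb ((a, t) # c) \<omega> = a * \<omega> t + path_comb c \<omega>"
  "path_comb (c @ c') \<omega> = path_comb c \<omega> + path_comb c' \<omega>"
  by (simp_all add: path_comb_def)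

definition scale_comb :: "real \<Rightarrow> (real \<times> real) list \<Rightarrow> (real \<times> real) list" where
  "scale_comb r c = map (\<lambda>(a, t). (r * a, t)) c"

lemma path_comb_scale [simp]: "path_comb (scale_comb r c) \<omega> = r * path_comb c \<omega>"
  by (induction c) (auto simp: scale_comb_def algebra_simps)

lemma chi_comb_simps [simp]:
  "chi_comb T [] = (\<lambda>_. 0)" "chi_comb T (c @ c') = (\<lambda>s. chi_comb T c s + chi_comb T c' s)"
  "chi_comb T [(1, t)] = chi T t"
  "chi_comb T (scale_comb r c) = (\<lambda>s. r * chi_comb T c s)"
  by (auto simp: chi_comb_path_comb fun_eq_iff)

lemma times_in_simps [simp]:
  "times_in T []" "times_in T ((a, t) # c) \<longleftrightarrow> t \<in> {0..T} \<and> times_in T c"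
  "times_in T (c @ c') \<longleftrightarrow> times_in T c \<and> times_in T c'"
  "times_in T (scale_comb r c) \<longleftrightarrow> times_in T c"
  by (force simp: times_in_def scale_comb_def)+

locale cameron_martin =
  fixes T :: real
  assumes T_pos: "0 < T"
begin

sublocale hilbert_function_space "cm_space T" "cm_inner T"
  using T_pos by (intro cm_space_hilbert) simp

lemma has_cm_deriv_chi:
  assumes "t \<in> {0..T}" shows "has_cm_deriv T (chi T t) (indicator {0..t})"
  unfolding has_cm_deriv_iff
proof (intro conjI ballI)
  have "finite_measure (lebT T)" by (rule finite_measure_lebT)
  then have i: "integrable (lebT T) (\<lambda>_. 1 :: real)" by (simp add: finite_measure.integrable_const)
  have m: "(indicator {0..t} :: real \<Rightarrow> real) \<in> borel_measurable (lebT T)"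
    by (intro measurable_restrict_space1) simp
  from i have "integrable (lebT T) (\<lambda>s. (indicator {0..t} s :: real)\<^sup>2)"
  proof (rule Bochner_Integration.integrable_bound)
    show "(\<lambda>s. (indicator {0..t} s :: real)\<^sup>2) \<in> borel_measurable (lebT T)" using m by measurable
    show "AE s in lebT T. norm ((indicator {0..t} s :: real)\<^sup>2) \<le> norm (1 :: real)"
      by (auto simp: indicator_def)
  qed
  with m show "square_integrable (lebT T) (indicator {0..t})" by (simp add: square_integrable_def)
  fix x assume x: "x \<in> {0..T}"
  have "(\<integral>s. indicator {0..x} s * indicator {0..t} s \<partial>lebT T) = (LINT r|lborel. indicator {0..min t x} r :: real)"
  proof -
    have "(\<integral>s. indicator {0..x} s * indicator {0..t} s \<partial>lebT T) =
        (LINT s|lborel. indicator {0..T} s *\<^sub>R (indicator {0..x} s * indicator {0..t} s :: real))"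
      by (subst integral_restrict_space) auto
    also have "\<dots> = (LINT r|lborel. indicator {0..min t x} r)"
      by (rule Bochner_Integration.integral_cong) (use x assms in \<open>auto simp: indicator_def\<close>)
    finally show ?thesis .
  qed
  then show "chi T t x = (\<integral>s. indicator {0..x} s * indicator {0..t} s \<partial>lebT T)"
    using x assms by (simp add: chi_def)
qed simp

lemma chi_mem: "t \<in> {0..T} \<Longrightarrow> chi T t \<in> cm_space T"
  using has_cm_deriv_chi by (auto simp: cm_space_def chi_def)

text \<open>
  The functions \<open>\<chi>\<^sub>t\<close> are the reproducing kernel of the Cameron-Martin space. This turns pairings into
  point evaluations, on which measurability and identities between functions can be read off.
\<close>

lemma ip_chi:
  assumes "h \<in> cm_space T" "t \<in> {0..T}"
  shows "cm_inner T h (chi T t) = h t"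
proof -
  note d = has_cm_deriv_cm_deriv[OF assms(1)]
  have "cm_inner T h (chi T t) = (\<integral>s. cm_deriv T h s * indicator {0..t} s \<partial>lebT T)"
    using cm_inner_eqT[OF d has_cm_deriv_chi[OF assms(2)]] T_pos by simp
  also have "\<dots> = (\<integral>s. indicator {0..t} s * cm_deriv T h s \<partial>lebT T)"
    by (simp add: mult.commute)
  also have "\<dots> = h t" using d assms(2) by (simp add: has_cm_deriv_iff)
  finally show ?thesis .
qed

lemma ip_chi_left: "h \<in> cm_space T \<Longrightarrow> t \<in> {0..T} \<Longrightarrow> cm_inner T (chi T t) h = h t"
  using ip_chi cm_inner_commute by metis

lemma chi_comb_mem: "times_in T c \<Longrightarrow> chi_comb T c \<in> cm_space T"
proof (induction c)
  case Nil
  then show ?case using zero_mem by simp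
next
  case (Cons p c)
  obtain a t where at: "p = (a, t)" by force
  have "(\<lambda>s. a * chi T t s + 1 * chi_comb T c s) \<in> cm_space T"
    using Cons by (intro lin_mem chi_mem) (auto simp: at)
  then show ?case by (simp add: at chi_comb_path_comb fun_eq_iff cong: if_cong)
qed

lemma ip_chi_comb:
  assumes "h \<in> cm_space T" "times_in T c"
  shows "cm_inner T h (chi_comb T c) = path_comb c h"
  using assms(2)
proof (induction c)
  case Nil
  then show ?case using ip_zero[OF assms(1)] by (simp add: cm_inner_commute[of T h])
next
  case (Cons p c)
  obtain a t where at: "p = (a, t)" by force
  have t: "t \<in> {0..T}" "times_in T c" using Cons.prems by (auto simp: at)
  have "chi_comb T (p # c) = (\<lambda>s. a * chi T t s + 1 * chi_comb T c s)"
    by (simp add: at chi_comb_path_comb fun_eq_iff)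
  then have "cm_inner T (chi_comb T (p # c)) h =
      a * cm_inner T (chi T t) h + 1 * cm_inner T (chi_comb T c) h"
    using ip_lin[OF chi_mem[OF t(1)] chi_comb_mem[OF t(2)] assms(1), of a 1] by simp
  then show ?case using Cons.IH[OF t(2)] ip_chi_left[OF assms(1) t(1)]
    by (simp add: at cm_inner_commute[of T h])
qed

text \<open>
  Since \<open>h s - h t = \<langle>h, \<chi>\<^sub>s - \<chi>\<^sub>t\<rangle>\<close> and \<open>\<chi>\<^sub>s - \<chi>\<^sub>t\<close> has squared norm \<open>\<bar>s - t\<bar>\<close>.
\<close>

lemma cm_holder:
  assumes h: "h \<in> cm_space T" and st: "s \<in> {0..T}" "t \<in> {0..T}"
  shows "\<bar>h s - h t\<bar> \<le> nrm h * sqrt \<bar>s - t\<bar>"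
proof -
  have d: "(\<lambda>u. chi T s u - chi T t u) \<in> cm_space T" using diff_mem chi_mem st by simp
  have "cm_inner T (\<lambda>u. chi T s u - chi T t u) (\<lambda>u. chi T s u - chi T t u) = (s - min t s) - (min s t - t)"
    unfolding ip_diff[OF chi_mem[OF st(1)] chi_mem[OF st(2)] d] ip_chi_left[OF d st(1)] ip_chi_left[OF d st(2)]
    using st by (simp add: chi_def min.commute)
  also have "\<dots> = \<bar>s - t\<bar>" by (auto simp: min_def)
  finally have n: "nrm (\<lambda>u. chi T s u - chi T t u) = sqrt \<bar>s - t\<bar>" by (simp add: nrm_def)
  have "cm_inner T h (\<lambda>u. chi T s u - chi T t u) = h s - h t"
    using ip_diff_right[OF chi_mem[OF st(1)] chi_mem[OF st(2)] h] ip_chi[OF h] st by simp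
  then show ?thesis using cauchy_schwarz[OF h d] n by simp
qed

lemma cm_zero_at_0: "h \<in> cm_space T \<Longrightarrow> h 0 = 0"
proof -
  assume h: "h \<in> cm_space T"
  have "chi T 0 = (\<lambda>_. 0)" using T_pos by (auto simp: chi_def)
  then show "h 0 = 0" using ip_chi_left[OF h, of 0] ip_zero[OF h] T_pos by simp
qed

lemma cm_borel:
  assumes "h \<in> cm_space T"
  shows "h \<in> borel_measurable (restrict_space borel {0..T})"
proof (rule borel_measurable_continuous_on_restrict)
  show "continuous_on {0..T} h"
    unfolding continuous_on_sequentially comp_def
  proof (intro ballI allI impI)
    fix x :: "nat \<Rightarrow> real" and a assume a: "a \<in> {0..T}" and x: "(\<forall>n. x n \<in> {0..T}) \<and> x \<longlonglongrightarrow> a"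
    have "(\<lambda>n. h (x n) - h a) \<longlonglongrightarrow> 0"
    proof (rule Lim_null_comparison)
      show "\<forall>\<^sub>F n in sequentially. norm (h (x n) - h a) \<le> nrm h * sqrt \<bar>x n - a\<bar>"
        using cm_holder[OF assms] a x by (auto intro!: always_eventually)
      have "(\<lambda>n. nrm h * sqrt \<bar>x n - a\<bar>) \<longlonglongrightarrow> nrm h * sqrt \<bar>a - a\<bar>"
        using x by (intro tendsto_intros) auto
      then show "(\<lambda>n. nrm h * sqrt \<bar>x n - a\<bar>) \<longlonglongrightarrow> 0" by simp
    qed
    then show "(\<lambda>n. h (x n)) \<longlonglongrightarrow> h a" by (simp add: LIM_zero_iff)
  qed
qed

section \<open>Polygonal interpolation\<close>

definition grid :: "nat \<Rightarrow> nat \<Rightarrow> real" where "grid n i = T * real i / 2 ^ n"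

text \<open>
  The coefficients of the polygon through the values of \<open>f\<close> at the grid points, expressed in the \<open>\<chi>\<^sub>t\<close>:
  \<open>\<chi>\<close> at the right end minus \<open>\<chi>\<close> at the left end of a grid interval is 0 before it, has slope 1 on it
  and is constant after it. The coefficients depend on \<open>f\<close> only through finitely many values.
\<close>

definition interp :: "nat \<Rightarrow> (real \<Rightarrow> real) \<Rightarrow> (real \<times> real) list" where
  "interp n f = concat (map (\<lambda>i. let a = (f (grid n (Suc i)) - f (grid n i)) * 2 ^ n / T
     in [(a, grid n (Suc i)), (- a, grid n i)]) [0..<2 ^ n])"

lemma grid_mem: "i \<le> 2 ^ n \<Longrightarrow> grid n i \<in> {0..T}"
proof -
  assume "i \<le> 2 ^ n"
  then have "real i \<le> 2 ^ n" by (metis of_nat_le_iff of_nat_numeral of_nat_power)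
  then show ?thesis using T_pos by (simp add: grid_def field_simps)
qed

lemma times_in_interp: "times_in T (interp n f)"
  unfolding times_in_def interp_def using grid_mem by (auto simp: Let_def simp del: atLeastAtMost_iff)

lemma path_comb_interp:
  "path_comb (interp n f) \<omega> =
     (\<Sum>i<2 ^ n. (f (grid n (Suc i)) - f (grid n i)) * 2 ^ n / T * (\<omega> (grid n (Suc i)) - \<omega> (grid n i)))"
proof -
  have "path_comb (concat (map (\<lambda>i. [(a i, t i), (- a i, u i)]) [0..<m])) \<omega> = (\<Sum>i<m. a i * (\<omega> (t i) - \<omega> (u i)))"
    for a t u :: "nat \<Rightarrow> real" and m
    by (induction m) (auto simp: algebra_simps)
  then show ?thesis unfolding interp_def Let_def .
qed

abbreviation "pw_lin n f \<equiv> chi_comb T (interp n f)"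

lemma pw_lin_mem: "pw_lin n f \<in> cm_space T"
  by (intro chi_comb_mem times_in_interp)

lemma pw_lin_grid:
  assumes f: "f 0 = 0" and j: "j \<le> 2 ^ n"
  shows "pw_lin n f (grid n j) = f (grid n j)"
proof -
  have mono: "grid n i \<le> grid n k \<longleftrightarrow> i \<le> k" for i k using T_pos by (simp add: grid_def divide_le_cancel)
  have chi: "chi T (grid n (Suc i)) (grid n j) - chi T (grid n i) (grid n j) = (if i < j then T / 2 ^ n else 0)" for i
  proof -
    have "chi T (grid n k) (grid n j) = min (grid n j) (grid n k)" for k
      using grid_mem[OF j] by (simp add: chi_def del: atLeastAtMost_iff)
    moreover have "grid n (Suc i) - grid n i = T / 2 ^ n" by (simp add: grid_def field_simps)
    ultimately show ?thesis using mono[of j "Suc i"] mono[of j i] mono[of i j] mono[of "Suc i" j] by (auto simp: min_def)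
  qed
  have "pw_lin n f (grid n j) =
      (\<Sum>i<2 ^ n. if i < j then f (grid n (Suc i)) - f (grid n i) else 0)"
    unfolding chi_comb_path_comb path_comb_interp chi using T_pos by (intro sum.cong) auto
  also have "\<dots> = (\<Sum>i\<in>{..<2 ^ n} \<inter> {i. i < j}. f (grid n (Suc i)) - f (grid n i))"
    by (simp add: sum.inter_restrict)
  also have "{..<2 ^ n} \<inter> {i. i < j} = {..<j}" using j by auto
  also have "(\<Sum>i<j. f (grid n (Suc i)) - f (grid n i)) = f (grid n j) - f (grid n 0)"
    by (rule sum_lessThan_telescope)
  finally show ?thesis using f by (simp add: grid_def)
qed

lemma grid_refine: "n \<le> m \<Longrightarrow> grid n i = grid m (i * 2 ^ (m - n))"
proof -
  assume "n \<le> m"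
  then have "(2::real) ^ m = 2 ^ n * 2 ^ (m - n)" by (simp flip: power_add)
  then show ?thesis by (simp add: grid_def field_simps)
qed

lemma path_comb_interp_cong:
  assumes "\<And>j. j \<le> 2 ^ n \<Longrightarrow> g (grid n j) = h (grid n j)"
  shows "path_comb (interp n f) g = path_comb (interp n f) h"
  unfolding path_comb_interp using assms by (intro sum.cong) auto

text \<open>
  The polygon \<open>pw_lin n f\<close> is the orthogonal projection of \<open>f\<close> on the span of the \<open>\<chi>\<^sub>t\<close> for grid points \<open>t\<close>, since
  pairing with it only sees values at grid points, where \<open>f\<close> and all finer polygons agree with it.
\<close>

lemma pw_lin_ip:
  assumes f: "f \<in> cm_space T" and "n \<le> m"
  shows "cm_inner T (pw_lin m f) (pw_lin n f) = cm_inner T (pw_lin n f) (pw_lin n f)"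
proof -
  have "path_comb (interp n f) (pw_lin m f) = path_comb (interp n f) (pw_lin n f)"
  proof (rule path_comb_interp_cong)
    fix j :: nat assume j: "j \<le> 2 ^ n"
    then have "j * 2 ^ (m - n) \<le> 2 ^ n * 2 ^ (m - n)" by simp
    also have "\<dots> = 2 ^ m" using \<open>n \<le> m\<close> by (simp flip: power_add)
    finally have "pw_lin m f (grid m (j * 2 ^ (m - n))) = f (grid m (j * 2 ^ (m - n)))"
      by (intro pw_lin_grid cm_zero_at_0 f)
    then show "pw_lin m f (grid n j) = pw_lin n f (grid n j)"
      using pw_lin_grid[of f j n, OF cm_zero_at_0[OF f] j] grid_refine[OF \<open>n \<le> m\<close>] by simp
  qed
  then show ?thesis by (simp add: ip_chi_comb pw_lin_mem times_in_interp)
qed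

lemma pw_lin_ip_self:
  assumes f: "f \<in> cm_space T"
  shows "cm_inner T f (pw_lin n f) = cm_inner T (pw_lin n f) (pw_lin n f)"
proof -
  have "path_comb (interp n f) f = path_comb (interp n f) (pw_lin n f)"
    by (rule path_comb_interp_cong) (simp add: pw_lin_grid cm_zero_at_0 f)
  then show ?thesis using f by (simp add: ip_chi_comb pw_lin_mem times_in_interp)
qed

lemma pw_lin_dist:
  assumes f: "f \<in> cm_space T" and "n \<le> m"
  shows "cm_inner T (\<lambda>s. pw_lin m f s - pw_lin n f s) (\<lambda>s. pw_lin m f s - pw_lin n f s) =
      cm_inner T (pw_lin m f) (pw_lin m f) - cm_inner T (pw_lin n f) (pw_lin n f)"
  unfolding ip_diff[OF pw_lin_mem pw_lin_mem diff_mem[OF pw_lin_mem pw_lin_mem]]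
    ip_diff_right[OF pw_lin_mem pw_lin_mem pw_lin_mem]
  using pw_lin_ip[OF assms] cm_inner_commute[of T "pw_lin n f" "pw_lin m f"] by simp

lemma pw_lin_dist_self:
  assumes f: "f \<in> cm_space T"
  shows "cm_inner T (\<lambda>s. f s - pw_lin n f s) (\<lambda>s. f s - pw_lin n f s) =
      cm_inner T f f - cm_inner T (pw_lin n f) (pw_lin n f)"
  unfolding ip_diff[OF f pw_lin_mem diff_mem[OF f pw_lin_mem]]
    ip_diff_right[OF f pw_lin_mem f] ip_diff_right[OF f pw_lin_mem pw_lin_mem]
  using pw_lin_ip_self[OF assms] cm_inner_commute[of T "pw_lin n f" f] by simp

lemma zero_of_zero_on_grid:
  assumes h: "h \<in> cm_space T" and z: "\<And>n j. j \<le> 2 ^ n \<Longrightarrow> h (grid n j) = 0"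
  shows "h = (\<lambda>_. 0)"
proof
  fix t
  show "h t = 0"
  proof (cases "t \<in> {0..T}")
    case True
    have "\<bar>h t\<bar> \<le> nrm h * sqrt (T / 2 ^ n)" for n
    proof -
      define x where "x = t * 2 ^ n / T"
      define j where "j = nat \<lfloor>x\<rfloor>"
      have x: "0 \<le> x" "x \<le> 2 ^ n" using True T_pos by (auto simp: x_def field_simps)
      then have j: "real j \<le> x" "x \<le> real j + 1" unfolding j_def by linarith+
      then have "real j \<le> 2 ^ n" using x by linarith
      then have j2: "j \<le> 2 ^ n" by (metis of_nat_le_iff of_nat_numeral of_nat_power)
      have t: "t = T * x / 2 ^ n" using T_pos by (simp add: x_def)
      have "t - grid n j = T * (x - real j) / 2 ^ n" by (simp add: t grid_def field_simps)
      also have "\<bar>\<dots>\<bar> \<le> T / 2 ^ n" using j T_pos by (simp add: abs_mult divide_right_mono)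
      finally have "sqrt \<bar>t - grid n j\<bar> \<le> sqrt (T / 2 ^ n)" by (rule real_sqrt_le_mono)
      then have "nrm h * sqrt \<bar>t - grid n j\<bar> \<le> nrm h * sqrt (T / 2 ^ n)"
        by (intro mult_left_mono nrm_nonneg h)
      then show ?thesis using cm_holder[OF h True grid_mem[OF j2]] z[OF j2] by simp
    qed
    moreover have "(\<lambda>n. nrm h * sqrt (T * (1/2) ^ n)) \<longlonglongrightarrow> nrm h * sqrt (T * 0)"
      by (intro tendsto_intros LIMSEQ_realpow_zero) auto
    ultimately have "\<bar>h t\<bar> \<le> 0"
      by (intro LIMSEQ_le_const[where X="\<lambda>n. nrm h * sqrt (T * (1/2) ^ n)"]) (auto simp: power_divide)
    then show ?thesis by simp
  next
    case False then show ?thesis using h by (auto simp: cm_space_def)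
  qed
qed

text \<open>
  Orthogonality makes the squared norms of the polygons increase, bounded by that of \<open>f\<close>, so the
  polygons form a Cauchy sequence. Their limit agrees with \<open>f\<close> at all dyadic points, hence everywhere.
\<close>

lemma pw_lin_tends:
  assumes f: "f \<in> cm_space T"
  shows "tends (\<lambda>n. pw_lin n f) f"
proof -
  let ?P = "\<lambda>n. pw_lin n f"
  define N where "N n = cm_inner T (?P n) (?P n)" for n
  have dist: "cm_inner T (\<lambda>s. ?P m s - ?P n s) (\<lambda>s. ?P m s - ?P n s) = N m - N n" if "n \<le> m" for m n
    using pw_lin_dist[OF f that] by (simp add: N_def)
  have "N n \<le> N m" if "n \<le> m" for n m
    using dist[OF that] ip_nonneg[OF diff_mem[OF pw_lin_mem pw_lin_mem], of m f n f] by simp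
  then have "incseq N" by (simp add: incseq_def)
  moreover have "\<forall>n. N n \<le> cm_inner T f f"
  proof
    fix n
    show "N n \<le> cm_inner T f f"
      using pw_lin_dist_self[OF f, of n] ip_nonneg[OF diff_mem[OF f pw_lin_mem], of n f] by (simp add: N_def)
  qed
  ultimately have "\<exists>L. N \<longlonglongrightarrow> L" by (elim incseq_convergent) auto
  then have C: "Cauchy N" using LIMSEQ_imp_Cauchy by blast
  have "\<exists>y\<in>cm_space T. (\<lambda>n. cm_inner T (\<lambda>s. ?P n s - y s) (\<lambda>s. ?P n s - y s)) \<longlonglongrightarrow> 0"
  proof (rule ip_complete[OF pw_lin_mem])
    fix e :: real assume "0 < e"
    then have "\<exists>M. \<forall>m\<ge>M. \<forall>n\<ge>M. norm (N m - N n) < e" by (rule CauchyD[OF C])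
    then obtain M where M: "\<And>m n. m \<ge> M \<Longrightarrow> n \<ge> M \<Longrightarrow> \<bar>N m - N n\<bar> < e" by auto
    have "cm_inner T (\<lambda>s. ?P m s - ?P n s) (\<lambda>s. ?P m s - ?P n s) < e" if "m \<ge> M" "n \<ge> M" for m n
    proof (cases "n \<le> m")
      case True
      then show ?thesis using dist[OF True] M[OF that] by simp
    next
      case False
      then have "n \<ge> m" by simp
      have "nrm (\<lambda>s. ?P m s - ?P n s) = nrm (\<lambda>s. ?P n s - ?P m s)"
        by (rule nrm_diff_commute[OF pw_lin_mem pw_lin_mem])
      then have "cm_inner T (\<lambda>s. ?P m s - ?P n s) (\<lambda>s. ?P m s - ?P n s) = N n - N m"
        using dist[OF \<open>n \<ge> m\<close>] by (simp add: nrm_def)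
      then show ?thesis using M[OF that] by simp
    qed
    then show "\<exists>M. \<forall>m\<ge>M. \<forall>n\<ge>M. cm_inner T (\<lambda>s. ?P m s - ?P n s) (\<lambda>s. ?P m s - ?P n s) < e" by blast
  qed
  then obtain y where y: "y \<in> cm_space T" "(\<lambda>n. cm_inner T (\<lambda>s. ?P n s - y s) (\<lambda>s. ?P n s - y s)) \<longlonglongrightarrow> 0"
    by blast
  have ty: "tends ?P y" by (subst tends_iff_sq[OF pw_lin_mem y(1)]) (rule y(2))
  have "(\<lambda>s. y s - f s) = (\<lambda>_. 0)"
  proof (rule zero_of_zero_on_grid[OF diff_mem[OF y(1) f]])
    fix n j :: nat assume j: "j \<le> 2 ^ n"
    have g: "grid n j \<in> {0..T}" by (rule grid_mem[OF j])
    have "(\<lambda>m. cm_inner T (?P m) (chi T (grid n j))) \<longlonglongrightarrow> cm_inner T y (chi T (grid n j))"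
      by (rule tends_ip[OF pw_lin_mem y(1) ty chi_mem[OF g]])
    then have "(\<lambda>m. ?P m (grid n j)) \<longlonglongrightarrow> y (grid n j)"
      by (simp add: ip_chi[OF pw_lin_mem g] ip_chi[OF y(1) g])
    moreover have "?P m (grid n j) = f (grid n j)" if "m \<ge> n" for m
    proof -
      have "j * 2 ^ (m - n) \<le> 2 ^ n * 2 ^ (m - n)" using j by simp
      also have "\<dots> = 2 ^ m" using that by (simp flip: power_add)
      finally show ?thesis
        using pw_lin_grid[of f "j * 2 ^ (m - n)" m, OF cm_zero_at_0[OF f]] grid_refine[OF that, of j] by simp
    qed
    then have "(\<lambda>m. ?P m (grid n j)) \<longlonglongrightarrow> f (grid n j)"
      by (intro tendsto_eventually) (auto simp: eventually_sequentially)
    ultimately show "y (grid n j) - f (grid n j) = 0" using LIMSEQ_unique by fastforce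
  qed
  then have "y = f" by (auto simp: fun_eq_iff)
  then show ?thesis using ty by simp
qed

section \<open>Covariance operators\<close>

lemma covariance_operator_sym_op: "covariance_operator T G \<Longrightarrow> sym_op G"
  unfolding covariance_operator_def sym_op_def by blast

text \<open>
  Evaluation of \<open>Kh\<close> at \<open>u\<close> is a bounded functional of \<open>h\<close>: it is the pairing with the primitive of
  \<open>K(u, \<cdot>)\<close>. This gives linearity of \<open>K\<close> without manipulating integrals.
\<close>

lemma kernel_op_repr:
  assumes K: "admissible_kernel T K" and u: "u \<in> {0..T}"
  obtains k where "k \<in> cm_space T" "\<And>h. h \<in> cm_space T \<Longrightarrow> kernel_op T K h u = cm_inner T h k"
proof -
  define kd where "kd r = indicator {0..u} r * K u r" for r
  define k where "k = (\<lambda>x. if x \<in> {0..T} then LINT r:{0..x}|lborel. kd r else 0)"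
  have kd: "has_cm_deriv T k kd"
  proof -
    have "(\<lambda>s. indicator {0..T} s *\<^sub>R (kd s)\<^sup>2) = (\<lambda>r. indicator {0..u} r *\<^sub>R (K u r)\<^sup>2)"
      using u by (auto simp: kd_def indicator_def)
    then show ?thesis
      using K u unfolding has_cm_deriv_def admissible_kernel_def set_integrable_def
        set_borel_measurable_def by (auto simp: kd_def[abs_def] k_def)
  qed
  then have "k \<in> cm_space T" by (auto simp: cm_space_def k_def)
  moreover have "kernel_op T K h u = cm_inner T h k" if "h \<in> cm_space T" for h
  proof -
    have "cm_inner T h k = (LINT r:{0..T}|lborel. cm_deriv T h r * kd r)"
      by (rule cm_inner_eq[OF has_cm_deriv_cm_deriv[OF that] kd]) (use T_pos in simp)
    also have "\<dots> = (LINT r:{0..u}|lborel. K u r * cm_deriv T h r)"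
      unfolding set_lebesgue_integral_def kd_def using u
      by (intro Bochner_Integration.integral_cong) (auto simp: indicator_def)
    finally show ?thesis using u by (simp add: kernel_op_def)
  qed
  ultimately show thesis using that by blast
qed

lemma kernel_op_lin:
  assumes K: "admissible_kernel T K" and hg: "h \<in> cm_space T" "g \<in> cm_space T"
  shows "kernel_op T K (\<lambda>s. a * h s + b * g s) = (\<lambda>s. a * kernel_op T K h s + b * kernel_op T K g s)"
proof
  fix u
  show "kernel_op T K (\<lambda>s. a * h s + b * g s) u = a * kernel_op T K h u + b * kernel_op T K g u"
  proof (cases "u \<in> {0..T}")
    case True
    then obtain k where k: "k \<in> cm_space T" "\<And>h. h \<in> cm_space T \<Longrightarrow> kernel_op T K h u = cm_inner T h k"
      using kernel_op_repr[OF K] by blast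
    show ?thesis
      unfolding k(2)[OF hg(1)] k(2)[OF hg(2)] k(2)[OF lin_mem[OF hg]] by (rule ip_lin[OF hg k(1)])
  next
    case False
    then show ?thesis unfolding kernel_op_def by (simp only: if_False)
  qed
qed

lemma kernel_cov_op_sym_op:
  assumes K: "admissible_kernel T K" and adj: "is_cm_adjoint T (kernel_op T K) Kstar"
  shows "sym_op (kernel_cov_op T K Kstar)"
proof -
  have Ks: "Kstar h \<in> cm_space T" if "h \<in> cm_space T" for h
    using adj that by (simp add: is_cm_adjoint_def)
  have Km: "kernel_op T K h \<in> cm_space T" if "h \<in> cm_space T" for h
    using K that by (simp add: admissible_kernel_def)
  have ad: "cm_inner T (kernel_op T K h) g = cm_inner T h (Kstar g)"
    if "h \<in> cm_space T" "g \<in> cm_space T" for h g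
    using adj that by (simp add: is_cm_adjoint_def)
  have lin: "Kstar (\<lambda>s. a * h s + b * g s) = (\<lambda>s. a * Kstar h s + b * Kstar g s)"
    if hg: "h \<in> cm_space T" "g \<in> cm_space T" for a b h g
  proof (rule eq_by_ip)
    fix f assume f: "f \<in> cm_space T"
    have K': "cm_inner T (Kstar x) f = cm_inner T x (kernel_op T K f)" if "x \<in> cm_space T" for x
      using ad[OF f that] by (metis cm_inner_commute)
    show "cm_inner T (Kstar (\<lambda>s. a * h s + b * g s)) f = cm_inner T (\<lambda>s. a * Kstar h s + b * Kstar g s) f"
      unfolding K'[OF lin_mem[OF hg]] ip_lin[OF hg Km[OF f]] ip_lin[OF Ks[OF hg(1)] Ks[OF hg(2)] f]
        K'[OF hg(1)] K'[OF hg(2)] ..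
  qed (intro Ks lin_mem hg)+
  show ?thesis unfolding sym_op_def kernel_cov_op_def
  proof (intro conjI ballI allI)
    fix h g assume hg: "h \<in> cm_space T" "g \<in> cm_space T"
    show "kernel_op T K (Kstar h) \<in> cm_space T" using Ks Km hg by blast
    show "kernel_op T K (Kstar (\<lambda>s. a * h s + b * g s)) =
        (\<lambda>s. a * kernel_op T K (Kstar h) s + b * kernel_op T K (Kstar g) s)" for a b
      unfolding lin[OF hg] by (rule kernel_op_lin[OF K Ks[OF hg(1)] Ks[OF hg(2)]])
    show "cm_inner T (kernel_op T K (Kstar h)) g = cm_inner T h (kernel_op T K (Kstar g))"
      using ad[OF Ks[OF hg(1)] hg(2)] ad[OF Ks[OF hg(2)] hg(1)] by (metis cm_inner_commute)
  qed
qed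

end

section \<open>A monotone class theorem\<close>

text \<open>
  Properties preserved by linear combinations and bounded pointwise limits, such as being integrated to 0
  against a fixed integrable function, pass from \<open>A\<close> to the whole class by induction. If \<open>A\<close> is closed under
  products up to this closure, the class contains the indicators of all events that \<open>A\<close> generates.
\<close>

inductive_set bp_closure :: "'a set \<Rightarrow> ('a \<Rightarrow> real) set \<Rightarrow> ('a \<Rightarrow> real) set" for S A where
  base: "f \<in> A \<Longrightarrow> f \<in> bp_closure S A"
| lin: "f \<in> bp_closure S A \<Longrightarrow> g \<in> bp_closure S A \<Longrightarrow> (\<lambda>x. a * f x + b * g x) \<in> bp_closure S A"
| lim: "(\<And>n::nat. F n \<in> bp_closure S A) \<Longrightarrow> (\<And>n x. x \<in> S \<Longrightarrow> \<bar>F n x\<bar> \<le> C) \<Longrightarrow>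
    (\<And>x. x \<in> S \<Longrightarrow> (\<lambda>n. F n x) \<longlonglongrightarrow> f x) \<Longrightarrow> f \<in> bp_closure S A"

lemma bp_closure_bounded:
  assumes A: "\<And>f. f \<in> A \<Longrightarrow> \<exists>C. \<forall>x\<in>S. \<bar>f x\<bar> \<le> C" and f: "f \<in> bp_closure S A"
  shows "\<exists>C. \<forall>x\<in>S. \<bar>f x\<bar> \<le> C"
  using f
proof induction
  case (base f)
  then show ?case by (rule A)
next
  case (lin f g a b)
  then obtain C D where "\<And>x. x \<in> S \<Longrightarrow> \<bar>f x\<bar> \<le> C" "\<And>x. x \<in> S \<Longrightarrow> \<bar>g x\<bar> \<le> D" by blast
  then have "\<bar>a * f x + b * g x\<bar> \<le> \<bar>a\<bar> * C + \<bar>b\<bar> * D" if "x \<in> S" for x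
    using that by (intro order_trans[OF abs_triangle_ineq] add_mono) (auto simp: abs_mult intro: mult_left_mono)
  then show ?case by blast
next
  case (lim F C f)
  have "\<bar>f x\<bar> \<le> C" if "x \<in> S" for x
    using tendsto_rabs[OF lim.hyps(3)[OF that]] by (rule LIMSEQ_le_const2) (use lim.hyps(2) that in blast)
  then show ?case by blast
qed

lemma bp_closure_measurable:
  assumes A: "A \<subseteq> borel_measurable M" and f: "f \<in> bp_closure (space M) A"
  shows "f \<in> borel_measurable M"
  using f
proof induction
  case (base f)
  then show ?case using A by blast
next
  case (lin f g a b)
  from lin.IH show ?case by measurable
next
  case (lim F C f)
  show ?case by (rule borel_measurable_LIMSEQ_real[OF lim.hyps(3) lim.IH])
qed

locale multiplicative_class =
  fixes S :: "'a set" and A :: "('a \<Rightarrow> real) set"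
  assumes bounded: "f \<in> A \<Longrightarrow> \<exists>C. \<forall>x\<in>S. \<bar>f x\<bar> \<le> C"
    and mult_base: "f \<in> A \<Longrightarrow> g \<in> A \<Longrightarrow> (\<lambda>x. f x * g x) \<in> bp_closure S A"
    and const_1: "(\<lambda>_. 1) \<in> A"
begin

abbreviation "H \<equiv> bp_closure S A"

lemma bp_bounded: "f \<in> H \<Longrightarrow> \<exists>C. \<forall>x\<in>S. \<bar>f x\<bar> \<le> C"
  by (rule bp_closure_bounded[OF bounded])

lemma bp_cong:
  assumes "f \<in> H" "\<And>x. x \<in> S \<Longrightarrow> f x = g x"
  shows "g \<in> H"
proof -
  obtain C where C: "\<And>x. x \<in> S \<Longrightarrow> \<bar>f x\<bar> \<le> C" using bp_bounded[OF assms(1)] by blast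
  show ?thesis
    by (rule bp_closure.lim[where F="\<lambda>_. f" and C=C]) (use assms C in auto)
qed

lemma bp_const: "(\<lambda>_. c) \<in> H"
  using bp_closure.lin[OF bp_closure.base[OF const_1] bp_closure.base[OF const_1], where a=c and b=0] by simp

text \<open>
  Multiplicativity is shown in two rounds: first with one factor in \<open>A\<close>, then with both factors in the class.
\<close>

lemma bp_mult_of_base:
  assumes f: "f \<in> H" and g: "g \<in> H" and base: "\<And>f'. f' \<in> A \<Longrightarrow> (\<lambda>x. f' x * g x) \<in> H"
  shows "(\<lambda>x. f x * g x) \<in> H"
  using f
proof induction
  case (base f)
  then show ?case using assms(3) by blast
next
  case (lin f f' a b)
  have "(\<lambda>x. (a * f x + b * f' x) * g x) = (\<lambda>x. a * (f x * g x) + b * (f' x * g x))"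
    by (simp add: fun_eq_iff algebra_simps)
  then show ?case using bp_closure.lin[OF lin.IH, where a=a and b=b] by simp
next
  case (lim F C f)
  obtain D where D: "\<And>x. x \<in> S \<Longrightarrow> \<bar>g x\<bar> \<le> D" using bp_bounded[OF g] by blast
  show ?case
  proof (rule bp_closure.lim)
    show "(\<lambda>x. F n x * g x) \<in> H" for n by (rule lim.IH)
    show "\<bar>F n x * g x\<bar> \<le> C * D" if "x \<in> S" for n x
    proof -
      have "\<bar>F n x\<bar> * \<bar>g x\<bar> \<le> C * D"
        using lim.hyps(2)[OF that, of n] D[OF that] by (intro mult_mono) auto
      then show ?thesis by (simp add: abs_mult)
    qed
    show "(\<lambda>n. F n x * g x) \<longlonglongrightarrow> f x * g x" if "x \<in> S" for x
      using lim.hyps(3)[OF that] by (intro tendsto_intros)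
  qed
qed

lemma bp_mult:
  assumes "f \<in> H" "g \<in> H"
  shows "(\<lambda>x. f x * g x) \<in> H"
proof (rule bp_mult_of_base[OF assms])
  fix f' assume f': "f' \<in> A"
  have "(\<lambda>x. g x * f' x) \<in> H"
    by (rule bp_mult_of_base[OF assms(2) bp_closure.base[OF f']]) (rule mult_base[OF _ f'])
  then show "(\<lambda>x. f' x * g x) \<in> H" by (simp add: mult.commute)
qed

lemma bp_poly:
  assumes "real_polynomial_function p" "f \<in> H"
  shows "(\<lambda>x. p (f x)) \<in> H"
  using assms(1)
proof (induction p)
  case (linear h)
  have "h y = h 1 * y + 0 * y" for y
    using linear_simps(5)[OF linear, of y 1] by (simp add: mult.commute)
  then have "(\<lambda>x. h (f x)) = (\<lambda>x. h 1 * f x + 0 * f x)" by (rule ext)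
  then show ?case
    using bp_closure.lin[OF assms(2) assms(2), where a="h 1" and b=0] by simp
next
  case (const c)
  then show ?case by (rule bp_const)
next
  case (add p q)
  then show ?case using bp_closure.lin[OF add.IH, where a=1 and b=1] by simp
next
  case (mult p q)
  show ?case by (rule bp_mult[OF mult.IH])
qed

text \<open>
  Weierstrass: on the bounded range of \<open>f\<close>, \<open>\<phi>\<close> is a uniform limit of polynomials.
\<close>

lemma bp_continuous:
  fixes \<phi> :: "real \<Rightarrow> real"
  assumes \<phi>: "continuous_on UNIV \<phi>" and f: "f \<in> H"
  shows "(\<lambda>x. \<phi> (f x)) \<in> H"
proof -
  obtain C where C: "\<And>x. x \<in> S \<Longrightarrow> \<bar>f x\<bar> \<le> C" using bp_bounded[OF f] by blast
  have c: "continuous_on {-C..C} \<phi>" using \<phi> by (rule continuous_on_subset) simp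
  have "\<exists>p. real_polynomial_function p \<and> (\<forall>x\<in>{-C..C}. \<bar>\<phi> x - p x\<bar> < 1 / real (Suc n))" for n
  proof -
    have "0 < 1 / real (Suc n)" by simp
    then obtain p where "real_polynomial_function p" "\<And>x. x \<in> {-C..C} \<Longrightarrow> \<bar>\<phi> x - p x\<bar> < 1 / real (Suc n)"
      using Stone_Weierstrass_real_polynomial_function[OF compact_Icc c] by blast
    then show ?thesis by blast
  qed
  then obtain p where p: "\<And>n. real_polynomial_function (p n)"
    "\<And>n x. x \<in> {-C..C} \<Longrightarrow> \<bar>\<phi> x - p n x\<bar> < 1 / real (Suc n)" by metis
  have "bounded (\<phi> ` {-C..C})"
    by (intro compact_imp_bounded compact_continuous_image c compact_Icc)
  then obtain D where "\<forall>y\<in>\<phi> ` {-C..C}. norm y \<le> D" unfolding bounded_iff by blast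
  then have D: "\<bar>\<phi> x\<bar> \<le> D" if "x \<in> {-C..C}" for x using that by auto
  have mem: "f x \<in> {-C..C}" if "x \<in> S" for x using C[OF that] by (auto simp: abs_le_iff)
  show ?thesis
  proof (rule bp_closure.lim)
    show "(\<lambda>x. p n (f x)) \<in> H" for n by (rule bp_poly[OF p(1) f])
    show "\<bar>p n (f x)\<bar> \<le> D + 1" if "x \<in> S" for n x
    proof -
      have "1 / real (Suc n) \<le> 1" by simp
      then show ?thesis using D[OF mem[OF that]] p(2)[OF mem[OF that], of n] by linarith
    qed
    show "(\<lambda>n. p n (f x)) \<longlonglongrightarrow> \<phi> (f x)" if "x \<in> S" for x
    proof -
      have "(\<lambda>n. p n (f x) - \<phi> (f x)) \<longlonglongrightarrow> 0"
      proof (rule Lim_null_comparison)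
        show "\<forall>\<^sub>F n in sequentially. norm (p n (f x) - \<phi> (f x)) \<le> 1 / real (Suc n)"
          using p(2)[OF mem[OF that]] by (intro always_eventually) (auto simp: abs_minus_commute intro: less_imp_le)
        show "(\<lambda>n. 1 / real (Suc n)) \<longlonglongrightarrow> 0" by (rule LIMSEQ_Suc[OF lim_1_over_n])
      qed
      then show ?thesis by (simp add: LIM_zero_iff)
    qed
  qed
qed

definition bp_sets :: "'a set set" where "bp_sets = {B. B \<subseteq> S \<and> indicator B \<in> H}"

lemma bp_sets_sigma_algebra: "sigma_algebra S bp_sets"
proof (rule sigma_algebra.intro)
  have dI: "S - B \<in> bp_sets" if "B \<in> bp_sets" for B
  proof -
    have "(\<lambda>x. 1 * 1 + (-1) * indicator B x) \<in> H"
      using that by (intro bp_closure.lin bp_const) (auto simp: bp_sets_def)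
    then have "indicator (S - B) \<in> H" by (rule bp_cong) (auto simp: indicator_def)
    then show ?thesis by (auto simp: bp_sets_def)
  qed
  have iI: "B \<inter> D \<in> bp_sets" if "B \<in> bp_sets" "D \<in> bp_sets" for B D
  proof -
    have "(\<lambda>x. indicator B x * indicator D x) \<in> H"
      using that by (intro bp_mult[of "indicator B" "indicator D"]) (auto simp: bp_sets_def)
    then have "indicator (B \<inter> D) \<in> H" by (rule bp_cong) (auto simp: indicator_def)
    then show ?thesis using that by (auto simp: bp_sets_def)
  qed
  have e: "{} \<in> bp_sets"
    using bp_cong[OF bp_const[of 0], of "indicator {}"] by (simp add: bp_sets_def)
  have un: "B \<union> D \<in> bp_sets" if "B \<in> bp_sets" "D \<in> bp_sets" for B D
  proof -
    have "B \<union> D = S - ((S - B) \<inter> (S - D))" using that by (auto simp: bp_sets_def)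
    then show ?thesis using dI iI that by simp
  qed
  show "algebra S bp_sets"
    unfolding algebra_iff_Un using e dI un by (auto simp: bp_sets_def)
  show "sigma_algebra_axioms bp_sets"
  proof
    fix B :: "nat \<Rightarrow> 'a set" assume B: "range B \<subseteq> bp_sets"
    have fin: "(\<Union>i<n. B i) \<in> bp_sets" for n
    proof (induction n)
      case 0
      then show ?case using e by simp
    next
      case (Suc n)
      then show ?case using un[of "B n"] B by (auto simp: lessThan_Suc)
    qed
    have "indicator (\<Union>i. B i) \<in> H"
    proof (rule bp_closure.lim[of "\<lambda>n. indicator (\<Union>i<n. B i)"])
      show "indicator (\<Union>i<n. B i) \<in> H" for n using fin by (simp add: bp_sets_def)
      show "\<bar>indicator (\<Union>i<n. B i) x :: real\<bar> \<le> 1" for n x by (simp add: indicator_def)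
      show "(\<lambda>n. indicator (\<Union>i<n. B i) x :: real) \<longlonglongrightarrow> indicator (\<Union>i. B i) x" for x
        by (rule LIMSEQ_indicator_UN)
    qed
    then show "(\<Union>i. B i) \<in> bp_sets" using B by (auto simp: bp_sets_def)
  qed
qed

text \<open>
  The limits \<open>X\<close> need not be bounded, as is the case for a coordinate. Composed with a bounded continuous
  function they are bounded limits again, and \<open>\<phi> k\<close> increases to the indicator of the half line above \<open>a\<close>.
\<close>

lemma bp_sets_greater:
  assumes F: "\<And>n::nat. F n \<in> H" and X: "\<And>x. x \<in> S \<Longrightarrow> (\<lambda>n. F n x) \<longlonglongrightarrow> X x"
  shows "{x \<in> S. X x > a} \<in> bp_sets"
proof -
  define \<phi> where "\<phi> k y = min 1 (real k * max 0 (y - a))" for k :: nat and y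
  have \<phi>c: "continuous_on UNIV (\<phi> k)" for k unfolding \<phi>_def by (intro continuous_intros)
  have \<phi>b: "\<bar>\<phi> k y\<bar> \<le> 1" for k y by (auto simp: \<phi>_def)
  have 1: "(\<lambda>x. \<phi> k (X x)) \<in> H" for k
  proof (rule bp_closure.lim)
    show "(\<lambda>x. \<phi> k (F n x)) \<in> H" for n by (rule bp_continuous[OF \<phi>c F])
    show "(\<lambda>n. \<phi> k (F n x)) \<longlonglongrightarrow> \<phi> k (X x)" if "x \<in> S" for x
      by (rule continuous_on_tendsto_compose[OF \<phi>c X[OF that]]) auto
  qed (rule \<phi>b)
  have "indicator {x \<in> S. X x > a} \<in> H"
  proof (rule bp_closure.lim[OF 1 \<phi>b])
    fix x assume x: "x \<in> S"
    show "(\<lambda>k. \<phi> k (X x)) \<longlonglongrightarrow> indicator {x \<in> S. X x > a} x"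
    proof (cases "X x > a")
      case True
      obtain N :: nat where N: "1 / (X x - a) < real N" using reals_Archimedean2 by blast
      have "\<phi> k (X x) = 1" if "k \<ge> N" for k
      proof -
        have "1 / (X x - a) < real k" using N that by (meson less_le_trans of_nat_le_iff)
        then show ?thesis using True by (simp add: \<phi>_def field_simps)
      qed
      then show ?thesis using True x
        by (intro tendsto_eventually) (auto simp: eventually_sequentially)
    next
      case False
      then show ?thesis by (simp add: \<phi>_def)
    qed
  qed
  then show ?thesis by (auto simp: bp_sets_def)
qed

end

text \<open>
  The trigonometric functions of a path are those whose expectations a characteristic function determines.
\<close>

definition trig :: "real \<Rightarrow> ((real \<Rightarrow> real) \<Rightarrow> real) set" where
  "trig T = {(\<lambda>\<omega>. cos (path_comb c \<omega>)) | c. times_in T c} \<union> {(\<lambda>\<omega>. sin (path_comb c \<omega>)) | c. times_in T c}"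

text \<open>
  The addition theorems make the trigonometric functions a multiplicative class, and a coordinate is the
  limit \<open>\<omega> t = lim n * sin (\<omega> t / n)\<close>. So the class contains the indicators of all measurable sets of
  paths: what holds for trigonometric functions and survives bounded limits holds for all events.
\<close>

lemma (in cameron_martin) indicator_in_trig_closure:
  assumes \<Omega>: "path_space T \<Omega>"
    and B: "B \<in> sets \<Omega>"
  shows "indicator B \<in> bp_closure (space \<Omega>) (trig T)"
proof -
  let ?cl = "bp_closure (space \<Omega>) (trig T)"
  have cosA: "(\<lambda>\<omega>. cos (path_comb c \<omega>)) \<in> trig T" and sinA: "(\<lambda>\<omega>. sin (path_comb c \<omega>)) \<in> trig T"
    if "times_in T c" for c using that by (auto simp: trig_def)
  have prod: "f \<in> ?cl" if c: "times_in T c" "times_in T d"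
    and f: "f = (\<lambda>\<omega>. a * g (path_comb (c @ d) \<omega>) + b * g (path_comb (c @ scale_comb (-1) d) \<omega>))"
    and g: "g = sin \<or> g = cos" for f a b g c d
    unfolding f using c g cosA[of "c @ d"] cosA[of "c @ scale_comb (-1) d"] sinA[of "c @ d"] sinA[of "c @ scale_comb (-1) d"]
    by (intro bp_closure.lin bp_closure.base) auto
  interpret multiplicative_class "space \<Omega>" "trig T"
  proof
    show "\<exists>C. \<forall>x\<in>space \<Omega>. \<bar>f x\<bar> \<le> C" if "f \<in> trig T" for f
      using that by (intro exI[of _ 1]) (auto simp: trig_def)
    show "(\<lambda>_. 1) \<in> trig T" using cosA[of "[]"] by simp
    fix f g assume "f \<in> trig T" "g \<in> trig T"
    then consider c d where "times_in T c" "times_in T d" "f = (\<lambda>\<omega>. cos (path_comb c \<omega>))" "g = (\<lambda>\<omega>. cos (path_comb d \<omega>))"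
      | c d where "times_in T c" "times_in T d" "f = (\<lambda>\<omega>. cos (path_comb c \<omega>))" "g = (\<lambda>\<omega>. sin (path_comb d \<omega>))"
      | c d where "times_in T c" "times_in T d" "f = (\<lambda>\<omega>. sin (path_comb c \<omega>))" "g = (\<lambda>\<omega>. cos (path_comb d \<omega>))"
      | c d where "times_in T c" "times_in T d" "f = (\<lambda>\<omega>. sin (path_comb c \<omega>))" "g = (\<lambda>\<omega>. sin (path_comb d \<omega>))"
      by (auto simp: trig_def)
    then show "(\<lambda>x. f x * g x) \<in> ?cl"
    proof cases
      case 1
      show ?thesis by (rule prod[OF 1(1,2), where g=cos and a="1/2" and b="1/2"])
        (auto simp: 1 cos_add cos_diff fun_eq_iff field_simps)
    next
      case 2
      show ?thesis by (rule prod[OF 2(1,2), where g=sin and a="1/2" and b="-1/2"])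
        (auto simp: 2 sin_add sin_diff fun_eq_iff field_simps)
    next
      case 3
      show ?thesis by (rule prod[OF 3(1,2), where g=sin and a="1/2" and b="1/2"])
        (auto simp: 3 sin_add sin_diff fun_eq_iff field_simps)
    next
      case 4
      show ?thesis by (rule prod[OF 4(1,2), where g=cos and a="-1/2" and b="1/2"])
        (auto simp: 4 cos_add cos_diff fun_eq_iff field_simps)
    qed
  qed
  interpret sa: sigma_algebra "space \<Omega>" bp_sets by (rule bp_sets_sigma_algebra)
  define N where "N = measure_of (space \<Omega>) bp_sets (\<lambda>_. 0)"
  have N: "space N = space \<Omega>" "sets N = bp_sets"
    unfolding N_def using sa.space_closed by (auto simp: sa.sets_measure_of_eq)
  have coord: "(\<lambda>\<omega>. \<omega> t) \<in> borel_measurable N" if t: "t \<in> {0..T}" for t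
    unfolding borel_measurable_iff_greater N
  proof
    fix a
    have c: "times_in T [(1 / real (Suc n), t)]" for n using t by simp
    define F where "F n = (\<lambda>\<omega>::real\<Rightarrow>real. real (Suc n) * sin (path_comb [(1 / real (Suc n), t)] \<omega>) + 0 * 1)" for n
    have F: "F n \<in> ?cl" for n
      unfolding F_def using c by (intro bp_closure.lin bp_const bp_closure.base sinA)
    have lim: "(\<lambda>n. F n \<omega>) \<longlonglongrightarrow> \<omega> t" for \<omega>
    proof -
      have "((\<lambda>h. sin (\<omega> t * h)) has_real_derivative \<omega> t) (at 0)"
        by (auto intro!: derivative_eq_intros)
      then have "((\<lambda>h. sin (\<omega> t * h) / h) \<longlongrightarrow> \<omega> t) (at 0)"
        by (simp add: has_field_derivative_iff)
      moreover have "filterlim (\<lambda>n. 1 / real (Suc n)) (at 0) sequentially"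
        using LIMSEQ_Suc[OF lim_1_over_n[where 'a=real]] by (simp add: filterlim_at)
      ultimately have "(\<lambda>n. sin (\<omega> t * (1 / real (Suc n))) / (1 / real (Suc n))) \<longlonglongrightarrow> \<omega> t"
        by (rule filterlim_compose)
      then show ?thesis by (simp add: F_def mult.commute)
    qed
    show "{\<omega> \<in> space \<Omega>. a < \<omega> t} \<in> bp_sets"
      using bp_sets_greater[of F "\<lambda>\<omega>. \<omega> t" a] F lim by simp
  qed
  have "sigma_sets (space \<Omega>) {{\<omega> \<in> space \<Omega>. \<omega> t \<in> B} | t B. t \<in> {0..T} \<and> B \<in> sets borel} \<subseteq> bp_sets"
  proof (rule sa.sigma_sets_subset, clarify)
    fix t B assume t: "t \<in> {0..T}" and "B \<in> sets (borel :: real measure)"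
    from measurable_sets[OF coord[OF t] this(2)]
    show "{\<omega> \<in> space \<Omega>. \<omega> t \<in> B} \<in> bp_sets" by (simp add: N vimage_def Int_def conj_commute)
  qed
  then show ?thesis using \<Omega> B by (auto simp: path_space_def bp_sets_def)
qed

section \<open>Gaussian laws and their characteristic functions\<close>

lemma bounded_integrable:
  fixes f :: "'a \<Rightarrow> real"
  assumes "prob_space M" "f \<in> borel_measurable M" "\<And>x. x \<in> space M \<Longrightarrow> \<bar>f x\<bar> \<le> C"
  shows "integrable M f"
proof -
  interpret prob_space M by fact
  show ?thesis by (rule integrable_const_bound[of _ C]) (use assms in \<open>auto intro!: AE_I2\<close>)
qed

text \<open>
  The functions \<open>S n = sin (W h) / h\<close>, \<open>h = 1 / (n+1)\<close>, tend to \<open>W\<close> and are dominated by \<open>\<bar>W\<bar>\<close>, and their squares are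
  expressed by \<open>cos (2 h W)\<close>. The characteristic function bounds their second moments by \<open>\<alpha>\<close>, so Fatou
  gives integrability of \<open>W\<^sup>2\<close>, after which dominated convergence gives its integral.
\<close>

lemma second_moment_from_char:
  fixes W :: "'a \<Rightarrow> real"
  assumes M: "prob_space M" and W[measurable]: "W \<in> borel_measurable M"
    and \<alpha>: "0 \<le> \<alpha>" and char: "\<And>s. (\<integral>x. cos (s * W x) \<partial>M) = exp (- (s\<^sup>2 * \<alpha>) / 2)"
  shows "square_integrable M W" "(\<integral>x. (W x)\<^sup>2 \<partial>M) = \<alpha>"
proof -
  interpret prob_space M by fact
  define h where "h n = 1 / real (Suc n)" for n
  have h: "h n > 0" "h \<longlonglongrightarrow> 0" for n
    unfolding h_def using LIMSEQ_Suc[OF lim_1_over_n[where 'a=real]] by auto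
  define S where "S n x = sin (W x * h n) / h n" for n x
  have Sm[measurable]: "S n \<in> borel_measurable M" for n unfolding S_def by measurable
  have Sle: "\<bar>S n x\<bar> \<le> \<bar>W x\<bar>" for n x
    using abs_sin_x_le_abs_x[of "W x * h n"] h(1)[of n] by (simp add: S_def abs_mult field_simps)
  have Slim: "(\<lambda>n. S n x) \<longlonglongrightarrow> W x" for x
  proof -
    have "((\<lambda>h. sin (W x * h)) has_real_derivative W x) (at 0)"
      by (auto intro!: derivative_eq_intros)
    then have "((\<lambda>h. sin (W x * h) / h) \<longlongrightarrow> W x) (at 0)"
      by (simp add: has_field_derivative_iff)
    moreover have "filterlim h (at 0) sequentially"
      using h by (auto simp: filterlim_at intro!: always_eventually less_imp_neq[symmetric])
    ultimately show ?thesis unfolding S_def by (rule filterlim_compose)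
  qed
  have S2: "(S n x)\<^sup>2 = (1 - cos (2 * h n * W x)) / (2 * (h n)\<^sup>2)" for n x
    using cos_double_sin[of "W x * h n"] h(1)[of n]
    by (simp add: S_def power_divide field_simps)
  have Sint: "(\<integral>x. (S n x)\<^sup>2 \<partial>M) = (1 - exp (- (2 * (h n)\<^sup>2) * \<alpha>)) / (2 * (h n)\<^sup>2)" for n
  proof -
    have "integrable M (\<lambda>x. cos (2 * h n * W x))"
      by (rule bounded_integrable[OF M, of _ 1]) auto
    then have "(\<integral>x. (S n x)\<^sup>2 \<partial>M) = (1 - (\<integral>x. cos (2 * h n * W x) \<partial>M)) / (2 * (h n)\<^sup>2)"
      unfolding S2 by (simp add: prob_space)
    also have "(\<integral>x. cos (2 * h n * W x) \<partial>M) = exp (- (2 * (h n)\<^sup>2) * \<alpha>)"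
      unfolding char by (simp add: power_mult_distrib)
    finally show ?thesis .
  qed
  have S_si: "square_integrable M (S n)" for n
  proof -
    have "integrable M (\<lambda>x. (S n x)\<^sup>2)"
    proof (rule bounded_integrable[OF M])
      fix x
      have "\<bar>S n x\<bar> \<le> \<bar>1 / h n\<bar>" using h(1)[of n] by (simp add: S_def divide_right_mono)
      then have "(S n x)\<^sup>2 \<le> (1 / h n)\<^sup>2" by (rule abs_le_square_iff[THEN iffD1])
      then show "\<bar>(S n x)\<^sup>2\<bar> \<le> (1 / h n)\<^sup>2" by simp
    qed simp
    then show ?thesis by (simp add: square_integrable_def)
  qed
  have Sint_le: "(\<integral>x. (S n x)\<^sup>2 \<partial>M) \<le> \<alpha>" for n
  proof -
    have "1 - exp (- (2 * (h n)\<^sup>2) * \<alpha>) \<le> 2 * (h n)\<^sup>2 * \<alpha>"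
      using exp_ge_add_one_self[of "- (2 * (h n)\<^sup>2) * \<alpha>"] by simp
    then show ?thesis unfolding Sint using h(1)[of n] by (simp add: field_simps)
  qed
  have "(\<integral>\<^sup>+x. ennreal ((W x - 0)\<^sup>2) \<partial>M) \<le> ennreal \<alpha>"
  proof (rule fatou_square[where f=S])
    show "AE x in M. (\<lambda>n. S n x) \<longlonglongrightarrow> W x" using Slim by simp
    show "\<forall>\<^sub>F n in sequentially. (\<integral>\<^sup>+x. ennreal ((S n x - 0)\<^sup>2) \<partial>M) \<le> ennreal \<alpha>"
      using Sint_le square_integrable_nn[OF S_si] by (auto intro!: always_eventually ennreal_leI)
  qed auto
  then show W2: "square_integrable M W" by (intro square_integrable_nnI) (auto intro: le_less_trans)
  have lim1: "(\<lambda>n. \<integral>x. (S n x)\<^sup>2 \<partial>M) \<longlonglongrightarrow> (\<integral>x. (W x)\<^sup>2 \<partial>M)"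
  proof (rule integral_dominated_convergence[where w="\<lambda>x. (W x)\<^sup>2"])
    show "integrable M (\<lambda>x. (W x)\<^sup>2)" using W2 by (simp add: square_integrable_def)
    show "AE x in M. (\<lambda>n. (S n x)\<^sup>2) \<longlonglongrightarrow> (W x)\<^sup>2" using Slim by (auto intro!: tendsto_power)
    show "AE x in M. norm ((S n x)\<^sup>2) \<le> (W x)\<^sup>2" for n
      using Sle by (auto simp: abs_le_square_iff)
  qed auto
  have "((\<lambda>u. 1 - exp (- u * \<alpha>)) has_real_derivative \<alpha>) (at 0)"
    by (auto intro!: derivative_eq_intros)
  then have "((\<lambda>u. (1 - exp (- u * \<alpha>)) / u) \<longlongrightarrow> \<alpha>) (at 0)"
    by (simp add: has_field_derivative_iff)
  moreover have "filterlim (\<lambda>n. 2 * (h n)\<^sup>2) (at 0) sequentially"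
  proof -
    have "(\<lambda>n. 2 * (h n)\<^sup>2) \<longlonglongrightarrow> 2 * 0\<^sup>2" using h by (intro tendsto_intros)
    then show ?thesis using h(1) by (auto simp: filterlim_at intro!: always_eventually less_imp_neq[symmetric])
  qed
  ultimately have "(\<lambda>n. (1 - exp (- (2 * (h n)\<^sup>2) * \<alpha>)) / (2 * (h n)\<^sup>2)) \<longlonglongrightarrow> \<alpha>"
    by (rule filterlim_compose)
  then show "(\<integral>x. (W x)\<^sup>2 \<partial>M) = \<alpha>" using lim1 unfolding Sint by (rule LIMSEQ_unique[symmetric])
qed

lemma abs_cos_diff_le: "\<bar>cos x - cos y\<bar> \<le> \<bar>x - y\<bar>" for x y :: real
proof -
  have "\<bar>cos x - cos y\<bar> = 2 * (\<bar>sin ((x + y) / 2)\<bar> * \<bar>sin ((y - x) / 2)\<bar>)"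
    by (simp add: cos_diff_cos abs_mult)
  also have "\<dots> \<le> 2 * (1 * \<bar>(y - x) / 2\<bar>)"
    by (intro mult_left_mono mult_mono abs_sin_x_le_abs_x) auto
  finally show ?thesis by (simp add: abs_minus_commute)
qed

text \<open>
  Differentiating the characteristic function at \<open>s = 0\<close> under the integral sign yields
  \<open>E [W sin V] = A * \<beta> * exp (- \<kappa> / 2)\<close>. For a Gaussian pair, \<open>\<beta>\<close> is the covariance of \<open>W\<close> and \<open>V\<close>; the bound
  says that variables that are almost uncorrelated with \<open>V\<close> are almost orthogonal to \<open>sin V\<close>.
\<close>

lemma cross_moment_from_char:
  fixes W V :: "'a \<Rightarrow> real"
  assumes M: "prob_space M" and W: "square_integrable M W" and V[measurable]: "V \<in> borel_measurable M"
    and A: "\<bar>A\<bar> \<le> 1" and \<kappa>: "0 \<le> \<kappa>"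
    and char: "\<And>s. (\<integral>x. cos (s * W x + V x) \<partial>M) = A * exp (- (s\<^sup>2 * \<alpha> + 2 * s * \<beta> + \<kappa>) / 2)"
  shows "\<bar>\<integral>x. W x * sin (V x) \<partial>M\<bar> \<le> \<bar>\<beta>\<bar>"
proof -
  interpret prob_space M by fact
  have Wm[measurable]: "W \<in> borel_measurable M" using W by (simp add: square_integrable_def)
  have Wi: "integrable M W" by (rule square_integrable_integrable[OF _ W]) unfold_locales
  define h where "h n = 1 / real (Suc n)" for n
  have h: "h n > 0" "h \<longlonglongrightarrow> 0" for n
    unfolding h_def using LIMSEQ_Suc[OF lim_1_over_n[where 'a=real]] by auto
  have hf: "filterlim h (at 0) sequentially"
    using h by (auto simp: filterlim_at intro!: always_eventually less_imp_neq[symmetric])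
  define D where "D n x = (cos (h n * W x + V x) - cos (V x)) / h n" for n x
  have ci: "integrable M (\<lambda>x. cos (s * W x + V x))" for s
    by (rule bounded_integrable[OF M, of _ 1]) auto
  define F where "F s = A * exp (- (s\<^sup>2 * \<alpha> + 2 * s * \<beta> + \<kappa>) / 2)" for s
  have Dint: "(\<integral>x. D n x \<partial>M) = (F (h n) - F 0) / h n" for n
    using ci[of "h n"] ci[of 0] char[of "h n"] char[of 0] unfolding D_def F_def by simp
  have "(\<lambda>n. \<integral>x. D n x \<partial>M) \<longlonglongrightarrow> (\<integral>x. - (W x * sin (V x)) \<partial>M)"
  proof (rule integral_dominated_convergence[where w="\<lambda>x. \<bar>W x\<bar>"])
    show "AE x in M. (\<lambda>n. D n x) \<longlonglongrightarrow> - (W x * sin (V x))"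
    proof (rule AE_I2)
      fix x
      have "((\<lambda>s. cos (s * W x + V x)) has_real_derivative - (W x * sin (V x))) (at 0)"
        by (auto intro!: derivative_eq_intros)
      then have "((\<lambda>s. (cos (s * W x + V x) - cos (V x)) / s) \<longlongrightarrow> - (W x * sin (V x))) (at 0)"
        by (simp add: has_field_derivative_iff)
      from filterlim_compose[OF this hf] show "(\<lambda>n. D n x) \<longlonglongrightarrow> - (W x * sin (V x))"
        unfolding D_def .
    qed
    show "AE x in M. norm (D n x) \<le> \<bar>W x\<bar>" for n
    proof (rule AE_I2)
      fix x
      have "\<bar>cos (h n * W x + V x) - cos (V x)\<bar> \<le> h n * \<bar>W x\<bar>"
        using abs_cos_diff_le[of "h n * W x + V x" "V x"] h(1)[of n] by (simp add: abs_mult)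
      then show "norm (D n x) \<le> \<bar>W x\<bar>" using h(1)[of n] by (simp add: D_def field_simps)
    qed
  qed (use Wi in \<open>auto simp: D_def[abs_def]\<close>)
  moreover have "(\<lambda>n. (F (h n) - F 0) / h n) \<longlonglongrightarrow> - (A * \<beta> * exp (- \<kappa> / 2))"
  proof -
    have "(F has_real_derivative - (A * \<beta> * exp (- \<kappa> / 2))) (at 0)"
      unfolding F_def by (auto intro!: derivative_eq_intros)
    then have "((\<lambda>s. (F s - F 0) / s) \<longlongrightarrow> - (A * \<beta> * exp (- \<kappa> / 2))) (at 0)"
      by (simp add: has_field_derivative_iff)
    from filterlim_compose[OF this hf] show ?thesis .
  qed
  ultimately have "(\<integral>x. - (W x * sin (V x)) \<partial>M) = - (A * \<beta> * exp (- \<kappa> / 2))"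
    unfolding Dint by (rule LIMSEQ_unique)
  then have "\<bar>\<integral>x. W x * sin (V x) \<partial>M\<bar> = \<bar>A\<bar> * \<bar>\<beta>\<bar> * exp (- \<kappa> / 2)" by (simp add: abs_mult)
  also have "\<dots> \<le> 1 * \<bar>\<beta>\<bar> * 1" using A \<kappa> by (intro mult_mono) auto
  finally show ?thesis by simp
qed

lemma path_comb_measurable:
  assumes \<Omega>: "path_space T \<Omega>" and c: "times_in T c"
  shows "path_comb c \<in> borel_measurable \<Omega>"
proof -
  have coord: "(\<lambda>\<omega>. \<omega> t) \<in> borel_measurable \<Omega>" if t: "t \<in> {0..T}" for t
  proof (rule measurableI)
    fix B :: "real set" assume "B \<in> sets borel"
    then have "{\<omega> \<in> space \<Omega>. \<omega> t \<in> B} \<in> sets \<Omega>"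
      using \<Omega> t unfolding path_space_def by (metis (mono_tags, lifting) mem_Collect_eq sigma_sets.Basic)
    then show "(\<lambda>\<omega>. \<omega> t) -` B \<inter> space \<Omega> \<in> sets \<Omega>"
      by (simp add: vimage_def Int_def conj_commute)
  qed simp
  have "(\<lambda>\<omega>. path_comb c \<omega>) \<in> borel_measurable \<Omega>"
    using c
  proof (induction c)
    case Nil
    then show ?case by (simp add: path_comb_def)
  next
    case (Cons p c)
    obtain a t where p: "p = (a, t)" by force
    have "t \<in> {0..T}" "times_in T c" using Cons.prems by (auto simp: p times_in_def)
    with Cons.IH coord[of t] have "(\<lambda>\<omega>. a * \<omega> t + path_comb c \<omega>) \<in> borel_measurable \<Omega>" by measurable
    then show ?case by (simp add: path_comb_def p)
  qed
  then show ?thesis .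
qed

lemma trig_closure:
  assumes \<Omega>: "path_space T \<Omega>" and f: "f \<in> bp_closure (space \<Omega>) (trig T)"
  shows "f \<in> borel_measurable \<Omega>" "\<exists>C. \<forall>x\<in>space \<Omega>. \<bar>f x\<bar> \<le> C"
proof -
  have "trig T \<subseteq> borel_measurable \<Omega>"
    using path_comb_measurable[OF \<Omega>] by (auto simp: trig_def)
  then show "f \<in> borel_measurable \<Omega>" using f by (rule bp_closure_measurable)
  have "\<exists>C. \<forall>x\<in>space \<Omega>. \<bar>g x\<bar> \<le> C" if "g \<in> trig T" for g
    using that by (intro exI[of _ 1]) (auto simp: trig_def)
  then show "\<exists>C. \<forall>x\<in>space \<Omega>. \<bar>f x\<bar> \<le> C" using f by (rule bp_closure_bounded)
qed

lemma gaussian_law_cos_sin: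
  assumes \<Omega>: "path_space T \<Omega>" and P: "gaussian_law T \<Omega> P m G" and c: "times_in T c"
  shows "(\<integral>\<omega>. cos (path_comb c \<omega>) \<partial>P) = cos (path_comb c m) * exp (- cm_inner T (chi_comb T c) (G (chi_comb T c)) / 2)"
    and "(\<integral>\<omega>. sin (path_comb c \<omega>) \<partial>P) = sin (path_comb c m) * exp (- cm_inner T (chi_comb T c) (G (chi_comb T c)) / 2)"
proof -
  let ?q = "cm_inner T (chi_comb T c) (G (chi_comb T c))"
  have sets: "sets P = sets \<Omega>" and ps: "prob_space P" using P by (auto simp: gaussian_law_def)
  interpret prob_space P by fact
  have m[measurable]: "path_comb c \<in> borel_measurable P"
    using path_comb_measurable[OF \<Omega> c] sets by (simp cong: measurable_cong_sets)
  have "exp (\<i> * complex_of_real (path_comb c m) - complex_of_real (?q / 2)) =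
      exp (complex_of_real (- ?q / 2) + \<i> * complex_of_real (path_comb c m))" by simp
  also have "\<dots> = exp (complex_of_real (- ?q / 2)) * exp (\<i> * complex_of_real (path_comb c m))"
    by (rule exp_add)
  also have "\<dots> = complex_of_real (exp (- ?q / 2)) * cis (path_comb c m)"
    by (simp only: exp_of_real cis_conv_exp)
  finally have char: "(CLINT \<omega>|P. cis (path_comb c \<omega>)) = complex_of_real (exp (- ?q / 2)) * cis (path_comb c m)"
    using P c by (simp add: gaussian_law_def cis_conv_exp)
  have i: "integrable P (\<lambda>\<omega>. cis (path_comb c \<omega>))"
    by (rule integrable_const_bound[of _ 1]) (auto simp: cis_conv_exp)
  have "(\<integral>\<omega>. cos (path_comb c \<omega>) \<partial>P) = Re (CLINT \<omega>|P. cis (path_comb c \<omega>))"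
    using integral_Re[OF i] by simp
  then show "(\<integral>\<omega>. cos (path_comb c \<omega>) \<partial>P) = cos (path_comb c m) * exp (- ?q / 2)"
    unfolding char by simp
  have "(\<integral>\<omega>. sin (path_comb c \<omega>) \<partial>P) = Im (CLINT \<omega>|P. cis (path_comb c \<omega>))"
    using integral_Im[OF i] by simp
  then show "(\<integral>\<omega>. sin (path_comb c \<omega>) \<partial>P) = sin (path_comb c m) * exp (- ?q / 2)"
    unfolding char by simp
qed

text \<open>
  The laws \<open>P z\<close> are given one by one, with no measurability in \<open>z\<close>. But the characteristic function of
  \<open>P z\<close> depends measurably on \<open>z\<close>, and this extends from trigonometric functions to all events.
\<close>

lemma (in cameron_martin) gaussian_kernel_measurable:
  assumes \<Omega>: "path_space T \<Omega>" and P: "\<And>z. z \<in> space \<Omega> \<Longrightarrow> gaussian_law T \<Omega> (P z) z G"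
  shows "P \<in> measurable \<Omega> (subprob_algebra \<Omega>)"
proof (rule measurable_subprob_algebra)
  have ps: "prob_space (P z)" and sets: "sets (P z) = sets \<Omega>" if "z \<in> space \<Omega>" for z
    using P[OF that] by (auto simp: gaussian_law_def)
  have sp: "space (P z) = space \<Omega>" if "z \<in> space \<Omega>" for z using sets[OF that] by (rule sets_eq_imp_space_eq)
  show "subprob_space (P z)" if "z \<in> space \<Omega>" for z
    using ps[OF that] by (rule prob_space_imp_subprob_space)
  show "sets (P z) = sets \<Omega>" if "z \<in> space \<Omega>" for z using sets[OF that] .
  fix B assume B: "B \<in> sets \<Omega>"
  let ?cl = "bp_closure (space \<Omega>) (trig T)"
  have int: "integrable (P z) f" if f: "f \<in> ?cl" and z: "z \<in> space \<Omega>" for f z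
  proof -
    obtain C where "\<And>x. x \<in> space \<Omega> \<Longrightarrow> \<bar>f x\<bar> \<le> C" using trig_closure(2)[OF \<Omega> f] by blast
    moreover have "f \<in> borel_measurable (P z)"
      using trig_closure(1)[OF \<Omega> f] by (simp add: measurable_cong_sets[OF sets[OF z] refl])
    ultimately show ?thesis by (intro bounded_integrable[OF ps[OF z]]) (simp_all add: sp[OF z])
  qed
  have "(\<lambda>z. \<integral>\<omega>. f \<omega> \<partial>P z) \<in> borel_measurable \<Omega>" if "f \<in> ?cl" for f
    using that
  proof induction
    case (base f)
    then obtain c g where c: "times_in T c" and g: "g = cos \<or> g = sin" and f: "f = (\<lambda>\<omega>. g (path_comb c \<omega>))"
      by (auto simp: trig_def)
    have m[measurable]: "path_comb c \<in> borel_measurable \<Omega>" by (rule path_comb_measurable[OF \<Omega> c])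
    have gm: "g \<in> borel_measurable borel" using g by auto
    have "(\<lambda>z. g (path_comb c z) * exp (- cm_inner T (chi_comb T c) (G (chi_comb T c)) / 2)) \<in> borel_measurable \<Omega>"
      using gm by measurable
    also have "?this \<longleftrightarrow> ?case"
      by (rule measurable_cong) (use g gaussian_law_cos_sin[OF \<Omega> P c] in \<open>auto simp: f\<close>)
    finally show ?case .
  next
    case (lin f g a b)
    have "(\<lambda>z. a * (\<integral>\<omega>. f \<omega> \<partial>P z) + b * (\<integral>\<omega>. g \<omega> \<partial>P z)) \<in> borel_measurable \<Omega>"
      using lin.IH by measurable
    also have "?this \<longleftrightarrow> ?case"
      by (rule measurable_cong) (simp add: int[OF lin.hyps(1)] int[OF lin.hyps(2)])
    finally show ?case .
  next
    case (lim F C f)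
    have f: "f \<in> ?cl" by (rule bp_closure.lim[OF lim.hyps])
    have "(\<lambda>n. \<integral>\<omega>. F n \<omega> \<partial>P z) \<longlonglongrightarrow> (\<integral>\<omega>. f \<omega> \<partial>P z)" if z: "z \<in> space \<Omega>" for z
    proof (rule integral_dominated_convergence[where w="\<lambda>_. C"])
      interpret prob_space "P z" by (rule ps[OF z])
      show "integrable (P z) (\<lambda>_. C)" by simp
      show "f \<in> borel_measurable (P z)" "F n \<in> borel_measurable (P z)" for n
        using int[OF f z] int[OF lim.hyps(1) z] by simp_all
      show "AE x in P z. (\<lambda>n. F n x) \<longlonglongrightarrow> f x" using lim.hyps(3) by (intro AE_I2) (simp add: sp[OF z])
      show "AE x in P z. norm (F n x) \<le> C" for n using lim.hyps(2) by (intro AE_I2) (simp add: sp[OF z])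
    qed
    then show ?case by (rule borel_measurable_LIMSEQ_real[OF _ lim.IH])
  qed
  from this[OF indicator_in_trig_closure[OF \<Omega> B]]
  have "(\<lambda>z. \<integral>\<omega>. (indicator B \<omega> :: real) \<partial>P z) \<in> borel_measurable \<Omega>" .
  then have "(\<lambda>z. ennreal (\<integral>\<omega>. (indicator B \<omega> :: real) \<partial>P z)) \<in> borel_measurable \<Omega>"
    by (rule measurable_compose[OF _ measurable_ennreal])
  also have "?this \<longleftrightarrow> (\<lambda>z. emeasure (P z) B) \<in> borel_measurable \<Omega>"
  proof (rule measurable_cong)
    fix z assume z: "z \<in> space \<Omega>"
    interpret prob_space "P z" by (rule ps[OF z])
    show "ennreal (\<integral>\<omega>. (indicator B \<omega> :: real) \<partial>P z) = emeasure (P z) B"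
      using B sets[OF z] by (simp add: emeasure_eq_measure sp[OF z] sets.Int_space_eq2)
  qed
  finally show "(\<lambda>z. emeasure (P z) B) \<in> borel_measurable \<Omega>" .
qed

section \<open>The joint law of drift and observation\<close>

lemma L2_cauchy_schwarz:
  assumes f: "square_integrable M f" and g: "square_integrable M g"
  shows "(\<integral>x. f x * g x \<partial>M)\<^sup>2 \<le> (\<integral>x. (f x)\<^sup>2 \<partial>M) * (\<integral>x. (g x)\<^sup>2 \<partial>M)"
proof (rule discriminant_le)
  fix r
  have i: "integrable M (\<lambda>x. (f x)\<^sup>2)" "integrable M (\<lambda>x. (g x)\<^sup>2)" "integrable M (\<lambda>x. f x * g x)"
    using f g square_integrable_mult[OF f g] by (auto simp: square_integrable_def)
  have "0 \<le> (\<integral>x. (f x + r * g x)\<^sup>2 \<partial>M)" by simp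
  also have "(\<lambda>x. (f x + r * g x)\<^sup>2) = (\<lambda>x. (f x)\<^sup>2 + 2 * r * (f x * g x) + r\<^sup>2 * (g x)\<^sup>2)"
    by (simp add: fun_eq_iff power2_eq_square algebra_simps)
  finally show "0 \<le> (\<integral>x. (f x)\<^sup>2 \<partial>M) + 2 * r * (\<integral>x. f x * g x \<partial>M) + r\<^sup>2 * (\<integral>x. (g x)\<^sup>2 \<partial>M)"
    using i by simp
qed simp

lemma L2_limit_mult:
  assumes x: "\<And>n. square_integrable M (x n)" and y: "square_integrable M y"
    and lim: "(\<lambda>n. \<integral>w. (x n w - y w)\<^sup>2 \<partial>M) \<longlonglongrightarrow> 0" and g: "square_integrable M g"
  shows "(\<lambda>n. \<integral>w. x n w * g w \<partial>M) \<longlonglongrightarrow> (\<integral>w. y w * g w \<partial>M)"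
proof -
  have d: "square_integrable M (\<lambda>w. x n w - y w)" for n by (rule square_integrable_diff[OF x y])
  have "(\<lambda>n. (\<integral>w. (x n w - y w) * g w \<partial>M)\<^sup>2) \<longlonglongrightarrow> 0"
  proof (rule Lim_null_comparison)
    show "\<forall>\<^sub>F n in sequentially. norm ((\<integral>w. (x n w - y w) * g w \<partial>M)\<^sup>2) \<le>
        (\<integral>w. (x n w - y w)\<^sup>2 \<partial>M) * (\<integral>w. (g w)\<^sup>2 \<partial>M)"
      using L2_cauchy_schwarz[OF d g] by (auto intro!: always_eventually)
    show "(\<lambda>n. (\<integral>w. (x n w - y w)\<^sup>2 \<partial>M) * (\<integral>w. (g w)\<^sup>2 \<partial>M)) \<longlonglongrightarrow> 0"
      by (rule tendsto_mult_left_zero[OF lim])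
  qed
  from tendsto_real_sqrt[OF this] have "(\<lambda>n. \<integral>w. (x n w - y w) * g w \<partial>M) \<longlonglongrightarrow> 0"
    by (simp add: tendsto_rabs_zero_iff)
  moreover have "(\<integral>w. (x n w - y w) * g w \<partial>M) = (\<integral>w. x n w * g w \<partial>M) - (\<integral>w. y w * g w \<partial>M)" for n
    unfolding left_diff_distrib
    by (rule Bochner_Integration.integral_diff[OF square_integrable_mult[OF x g] square_integrable_mult[OF y g]])
  ultimately show ?thesis by (simp add: LIM_zero_iff)
qed

lemma L2_limit_square:
  assumes x: "\<And>n. square_integrable M (x n)" and y: "square_integrable M y"
    and lim: "(\<lambda>n. \<integral>w. (x n w - y w)\<^sup>2 \<partial>M) \<longlonglongrightarrow> 0"
  shows "(\<lambda>n. \<integral>w. (x n w)\<^sup>2 \<partial>M) \<longlonglongrightarrow> (\<integral>w. (y w)\<^sup>2 \<partial>M)"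
proof -
  have i: "integrable M (\<lambda>w. (x n w)\<^sup>2)" "integrable M (\<lambda>w. (y w)\<^sup>2)" "integrable M (\<lambda>w. x n w * y w)" for n
    using x y square_integrable_mult[OF x y] by (auto simp: square_integrable_def)
  have "(\<integral>w. (x n w - y w)\<^sup>2 \<partial>M) = (\<integral>w. (x n w)\<^sup>2 \<partial>M) - 2 * (\<integral>w. x n w * y w \<partial>M) + (\<integral>w. (y w)\<^sup>2 \<partial>M)" for n
  proof -
    have "(\<lambda>w. (x n w - y w)\<^sup>2) = (\<lambda>w. (x n w)\<^sup>2 - 2 * (x n w * y w) + (y w)\<^sup>2)"
      by (simp add: fun_eq_iff power2_eq_square algebra_simps)
    then show ?thesis using i by simp
  qed
  then have eq: "(\<integral>w. (x n w)\<^sup>2 \<partial>M) = (\<integral>w. (x n w - y w)\<^sup>2 \<partial>M) + 2 * (\<integral>w. x n w * y w \<partial>M) - (\<integral>w. (y w)\<^sup>2 \<partial>M)" for n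
    by (simp add: algebra_simps)
  have "(\<lambda>n. (\<integral>w. (x n w - y w)\<^sup>2 \<partial>M) + 2 * (\<integral>w. x n w * y w \<partial>M) - (\<integral>w. (y w)\<^sup>2 \<partial>M))
      \<longlonglongrightarrow> 0 + 2 * (\<integral>w. y w * y w \<partial>M) - (\<integral>w. (y w)\<^sup>2 \<partial>M)"
    by (intro tendsto_intros lim L2_limit_mult[OF x y lim y])
  then show ?thesis unfolding eq by (simp add: power2_eq_square)
qed

lemma gaussian_law_cos_phase:
  assumes \<Omega>: "path_space T \<Omega>" and P: "gaussian_law T \<Omega> P m G" and c: "times_in T c"
  shows "(\<integral>\<omega>. cos (\<theta> + path_comb c \<omega>) \<partial>P) =
    cos (\<theta> + path_comb c m) * exp (- cm_inner T (chi_comb T c) (G (chi_comb T c)) / 2)"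
proof -
  have ps: "prob_space P" and sets: "sets P = sets \<Omega>" using P by (auto simp: gaussian_law_def)
  have m: "path_comb c \<in> borel_measurable P"
    using path_comb_measurable[OF \<Omega> c] by (simp add: measurable_cong_sets[OF sets refl])
  have i: "integrable P (\<lambda>\<omega>. cos (path_comb c \<omega>))" "integrable P (\<lambda>\<omega>. sin (path_comb c \<omega>))"
    using m by (auto intro!: bounded_integrable[OF ps, of _ 1])
  have "(\<integral>\<omega>. cos (\<theta> + path_comb c \<omega>) \<partial>P) =
      cos \<theta> * (\<integral>\<omega>. cos (path_comb c \<omega>) \<partial>P) - sin \<theta> * (\<integral>\<omega>. sin (path_comb c \<omega>) \<partial>P)"
    unfolding cos_add using i by simp
  then show ?thesis
    unfolding gaussian_law_cos_sin[OF assms] cos_add by (simp add: algebra_simps)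
qed

lemma (in cameron_martin) quad_form_expand:
  assumes G: "sym_op G" and xy: "x \<in> cm_space T" "y \<in> cm_space T"
  shows "cm_inner T (\<lambda>u. s * x u + y u) (G (\<lambda>u. s * x u + y u)) =
    s\<^sup>2 * cm_inner T x (G x) + 2 * s * cm_inner T x (G y) + cm_inner T y (G y)"
proof -
  have Gm: "G x \<in> cm_space T" "G y \<in> cm_space T" using sym_op_mem[OF G] xy by auto
  have l: "(\<lambda>u. s * x u + y u) = (\<lambda>u. s * x u + 1 * y u)" by simp
  have m: "(\<lambda>u. s * x u + 1 * y u) \<in> cm_space T" by (rule lin_mem[OF xy])
  have m2: "(\<lambda>u. s * G x u + 1 * G y u) \<in> cm_space T" by (rule lin_mem[OF Gm])
  have r: "cm_inner T z (\<lambda>u. s * G x u + 1 * G y u) = s * cm_inner T z (G x) + 1 * cm_inner T z (G y)"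
    if "z \<in> cm_space T" for z
    using ip_lin[OF Gm that, of s 1] by (simp only: cm_inner_commute[of T z])
  have c: "cm_inner T y (G x) = cm_inner T x (G y)"
    using sym_op_ip[OF G xy] cm_inner_commute by metis
  show ?thesis
    unfolding l sym_op_lin[OF G xy] ip_lin[OF xy m2] r[OF xy(1)] r[OF xy(2)] c
    by (simp add: algebra_simps power2_eq_square)
qed

text \<open>
  The drift is drawn from the prior \<open>Q\<close> and the observation from \<open>P\<close> at that drift.
\<close>

locale bayes_model = cameron_martin +
  fixes \<Omega> :: "(real \<Rightarrow> real) measure" and \<Gamma> \<Gamma>\<tau> :: "(real \<Rightarrow> real) \<Rightarrow> (real \<Rightarrow> real)"
    and P :: "(real \<Rightarrow> real) \<Rightarrow> (real \<Rightarrow> real) measure" and Q :: "(real \<Rightarrow> real) measure"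
    and v :: "real \<Rightarrow> real"
  assumes \<Omega>: "path_space T \<Omega>"
    and cov: "covariance_operator T \<Gamma>" "covariance_operator T \<Gamma>\<tau>"
    and P: "z \<in> space \<Omega> \<Longrightarrow> gaussian_law T \<Omega> (P z) z \<Gamma>"
    and Q: "gaussian_law T \<Omega> Q v \<Gamma>\<tau>"
    and v: "v \<in> cm_space T"
begin

lemma \<Gamma>_sym: "sym_op \<Gamma>" "sym_op \<Gamma>\<tau>"
  using cov covariance_operator_sym_op by auto

lemma \<Gamma>_nonneg: "h \<in> cm_space T \<Longrightarrow> 0 \<le> cm_inner T h (\<Gamma> h)" "h \<in> cm_space T \<Longrightarrow> 0 \<le> cm_inner T h (\<Gamma>\<tau> h)"
  using cov by (auto simp: covariance_operator_def)

lemma prob_Q: "prob_space Q" and sets_Q: "sets Q = sets \<Omega>" and space_Q: "space Q = space \<Omega>"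
proof -
  show "prob_space Q" and s: "sets Q = sets \<Omega>" using Q by (auto simp: gaussian_law_def)
  show "space Q = space \<Omega>" using sets_eq_imp_space_eq[OF s] .
qed

lemma prob_P: "prob_space (P z)" and sets_P: "sets (P z) = sets \<Omega>" and space_P: "space (P z) = space \<Omega>"
  if "z \<in> space \<Omega>"
proof -
  show "prob_space (P z)" and s: "sets (P z) = sets \<Omega>" using P[OF that] by (auto simp: gaussian_law_def)
  show "space (P z) = space \<Omega>" using sets_eq_imp_space_eq[OF s] .
qed

lemma P_kernel: "P \<in> measurable \<Omega> (subprob_algebra \<Omega>)"
  using gaussian_kernel_measurable[OF \<Omega> P] .

lemma path_comb_m: "times_in T c \<Longrightarrow> path_comb c \<in> borel_measurable \<Omega>"
  using path_comb_measurable[OF \<Omega>] .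

definition joint :: "((real \<Rightarrow> real) \<times> (real \<Rightarrow> real)) measure" where
  "joint = Q \<bind> (\<lambda>z. distr (P z) (\<Omega> \<Otimes>\<^sub>M \<Omega>) (Pair z))"

lemma joint_kernel: "(\<lambda>z. distr (P z) (\<Omega> \<Otimes>\<^sub>M \<Omega>) (Pair z)) \<in> measurable Q (subprob_algebra (\<Omega> \<Otimes>\<^sub>M \<Omega>))"
proof -
  have "(\<lambda>z. distr (P z) (\<Omega> \<Otimes>\<^sub>M \<Omega>) (Pair z)) \<in> measurable \<Omega> (subprob_algebra (\<Omega> \<Otimes>\<^sub>M \<Omega>))"
  proof (rule measurable_distr2[OF _ P_kernel])
    show "case_prod Pair \<in> \<Omega> \<Otimes>\<^sub>M \<Omega> \<rightarrow>\<^sub>M \<Omega> \<Otimes>\<^sub>M \<Omega>" by simp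
  qed
  then show ?thesis by (simp add: measurable_cong_sets[OF sets_Q refl])
qed

lemma sets_joint: "sets joint = sets (\<Omega> \<Otimes>\<^sub>M \<Omega>)"
  unfolding joint_def using prob_space.not_empty[OF prob_Q] by (intro sets_bind) auto

lemma space_joint: "space joint = space \<Omega> \<times> space \<Omega>"
  using sets_eq_imp_space_eq[OF sets_joint] by (simp add: space_pair_measure)

lemma measurable_joint: "f \<in> borel_measurable joint \<longleftrightarrow> f \<in> borel_measurable (\<Omega> \<Otimes>\<^sub>M \<Omega>)"
  by (simp add: measurable_cong_sets[OF sets_joint refl])

lemma fst_joint: "f \<in> measurable \<Omega> N \<Longrightarrow> (\<lambda>x. f (fst x)) \<in> measurable joint N"
  and snd_joint: "f \<in> measurable \<Omega> N \<Longrightarrow> (\<lambda>x. f (snd x)) \<in> measurable joint N"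
  unfolding measurable_cong_sets[OF sets_joint refl]
  by (rule measurable_compose[OF measurable_fst], assumption) (rule measurable_compose[OF measurable_snd], assumption)

lemma nn_integral_joint:
  assumes f: "f \<in> borel_measurable joint"
  shows "(\<integral>\<^sup>+x. f x \<partial>joint) = (\<integral>\<^sup>+z. (\<integral>\<^sup>+\<omega>. f (z, \<omega>) \<partial>P z) \<partial>Q)"
proof -
  have f'[measurable]: "f \<in> borel_measurable (\<Omega> \<Otimes>\<^sub>M \<Omega>)" using f by (simp add: measurable_joint)
  have "(\<integral>\<^sup>+x. f x \<partial>joint) = (\<integral>\<^sup>+z. (\<integral>\<^sup>+x. f x \<partial>distr (P z) (\<Omega> \<Otimes>\<^sub>M \<Omega>) (Pair z)) \<partial>Q)"
    unfolding joint_def by (rule nn_integral_bind[OF f' joint_kernel])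
  also have "\<dots> = (\<integral>\<^sup>+z. (\<integral>\<^sup>+\<omega>. f (z, \<omega>) \<partial>P z) \<partial>Q)"
  proof (rule nn_integral_cong)
    fix z assume "z \<in> space Q"
    then have z: "z \<in> space \<Omega>" by (simp add: space_Q)
    show "(\<integral>\<^sup>+x. f x \<partial>distr (P z) (\<Omega> \<Otimes>\<^sub>M \<Omega>) (Pair z)) = (\<integral>\<^sup>+\<omega>. f (z, \<omega>) \<partial>P z)"
    proof (rule nn_integral_distr)
      show "f \<in> borel_measurable (distr (P z) (\<Omega> \<Otimes>\<^sub>M \<Omega>) (Pair z))" by simp
      show "Pair z \<in> P z \<rightarrow>\<^sub>M \<Omega> \<Otimes>\<^sub>M \<Omega>"
        unfolding measurable_cong_sets[OF sets_P[OF z] refl] using z by simp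
    qed
  qed
  finally show ?thesis .
qed

lemma prob_joint: "prob_space joint"
proof
  have "emeasure joint (space joint) = (\<integral>\<^sup>+x. 1 \<partial>joint)" by simp
  also have "\<dots> = (\<integral>\<^sup>+z. (\<integral>\<^sup>+\<omega>. 1 \<partial>P z) \<partial>Q)" by (rule nn_integral_joint) simp
  also have "\<dots> = (\<integral>\<^sup>+z. 1 \<partial>Q)"
    by (rule nn_integral_cong) (simp add: space_Q prob_space.emeasure_space_1[OF prob_P])
  also have "\<dots> = 1" by (simp add: prob_space.emeasure_space_1[OF prob_Q])
  finally show "emeasure joint (space joint) = 1" .
qed

lemma integral_joint:
  fixes f :: "_ \<Rightarrow> real"
  assumes f: "f \<in> borel_measurable joint" and C: "\<And>x. \<bar>f x\<bar> \<le> C"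
  shows "(\<integral>x. f x \<partial>joint) = (\<integral>z. (\<integral>\<omega>. f (z, \<omega>) \<partial>P z) \<partial>Q)"
proof -
  have f'[measurable]: "f \<in> borel_measurable (\<Omega> \<Otimes>\<^sub>M \<Omega>)" using f by (simp add: measurable_joint)
  have fz: "(\<lambda>\<omega>. f (z, \<omega>)) \<in> borel_measurable (P z)" if "z \<in> space \<Omega>" for z
    unfolding measurable_cong_sets[OF sets_P[OF that] refl] using that by measurable
  have iz: "integrable (P z) (\<lambda>\<omega>. f (z, \<omega>))" if "z \<in> space \<Omega>" for z
    by (rule bounded_integrable[OF prob_P[OF that] fz[OF that] C])
  have nn: "0 \<le> f x + C" for x using C[of x] by (simp add: abs_le_iff)
  define g where "g z = (\<integral>\<omega>. f (z, \<omega>) \<partial>P z)" for z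
  have inner: "(\<integral>\<^sup>+\<omega>. ennreal (f (z, \<omega>) + C) \<partial>P z) = ennreal (g z + C)" if z: "z \<in> space \<Omega>" for z
  proof -
    interpret prob_space "P z" by (rule prob_P[OF z])
    have "(\<integral>\<^sup>+\<omega>. ennreal (f (z, \<omega>) + C) \<partial>P z) = ennreal (\<integral>\<omega>. f (z, \<omega>) + C \<partial>P z)"
      using iz[OF z] nn by (intro nn_integral_eq_integral) auto
    then show ?thesis using iz[OF z] by (simp add: g_def prob_space)
  qed
  have gC: "\<bar>g z\<bar> \<le> C" if z: "z \<in> space \<Omega>" for z
  proof -
    interpret prob_space "P z" by (rule prob_P[OF z])
    have "\<bar>g z\<bar> \<le> (\<integral>\<omega>. \<bar>f (z, \<omega>)\<bar> \<partial>P z)" unfolding g_def by (rule integral_abs_bound)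
    also have "\<dots> \<le> (\<integral>\<omega>. C \<partial>P z)" using iz[OF z] C by (intro integral_mono) auto
    finally show ?thesis by (simp add: prob_space)
  qed
  have gm: "g \<in> borel_measurable Q"
  proof -
    have "(\<lambda>z. \<integral>\<^sup>+\<omega>. ennreal (f (z, \<omega>) + C) \<partial>P z) \<in> borel_measurable \<Omega>"
      by (rule nn_integral_measurable_subprob_algebra2[OF _ P_kernel]) measurable
    then have "(\<lambda>z. enn2real (\<integral>\<^sup>+\<omega>. ennreal (f (z, \<omega>) + C) \<partial>P z) - C) \<in> borel_measurable \<Omega>" by measurable
    also have "?this \<longleftrightarrow> g \<in> borel_measurable \<Omega>"
    proof (rule measurable_cong)
      fix z assume z: "z \<in> space \<Omega>"
      have "0 \<le> g z + C" using gC[OF z] by (simp add: abs_le_iff)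
      then show "enn2real (\<integral>\<^sup>+\<omega>. ennreal (f (z, \<omega>) + C) \<partial>P z) - C = g z" by (simp add: inner[OF z])
    qed
    finally show ?thesis by (simp add: measurable_cong_sets[OF sets_Q refl])
  qed
  interpret Q: prob_space Q by (rule prob_Q)
  interpret J: prob_space joint by (rule prob_joint)
  have gi: "integrable Q g"
    by (rule bounded_integrable[OF prob_Q gm]) (use gC in \<open>simp add: space_Q\<close>)
  have fi: "integrable joint f" by (rule bounded_integrable[OF prob_joint f C])
  have "ennreal (\<integral>x. f x + C \<partial>joint) = (\<integral>\<^sup>+x. ennreal (f x + C) \<partial>joint)"
    using fi nn by (intro nn_integral_eq_integral[symmetric]) auto
  also have "\<dots> = (\<integral>\<^sup>+z. (\<integral>\<^sup>+\<omega>. ennreal (f (z, \<omega>) + C) \<partial>P z) \<partial>Q)"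
    by (rule nn_integral_joint)
      (rule measurable_compose[OF borel_measurable_add[OF f borel_measurable_const] measurable_ennreal])
  also have "\<dots> = (\<integral>\<^sup>+z. ennreal (g z + C) \<partial>Q)"
    by (rule nn_integral_cong) (simp add: space_Q inner)
  also have "\<dots> = ennreal (\<integral>z. g z + C \<partial>Q)"
  proof (rule nn_integral_eq_integral)
    show "integrable Q (\<lambda>z. g z + C)" using gi by simp
    show "AE z in Q. 0 \<le> g z + C"
    proof (rule AE_I2)
      fix z assume "z \<in> space Q"
      then show "0 \<le> g z + C" using gC[of z] by (simp add: space_Q abs_le_iff)
    qed
  qed
  finally have "ennreal ((\<integral>x. f x \<partial>joint) + C) = ennreal ((\<integral>z. g z \<partial>Q) + C)"
    using fi gi by (simp add: J.prob_space Q.prob_space)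
  moreover have "0 \<le> (\<integral>x. f x \<partial>joint) + C"
  proof -
    have "0 \<le> (\<integral>x. f x + C \<partial>joint)" using nn by simp
    then show ?thesis using fi by (simp add: J.prob_space)
  qed
  moreover have "0 \<le> (\<integral>z. g z \<partial>Q) + C"
  proof -
    have "0 \<le> (\<integral>z. g z + C \<partial>Q)"
    proof (rule integral_nonneg_AE, rule AE_I2)
      fix z assume "z \<in> space Q"
      then show "0 \<le> g z + C" using gC[of z] by (simp add: space_Q abs_le_iff)
    qed
    then show ?thesis using gi by (simp add: Q.prob_space)
  qed
  ultimately show ?thesis by (simp add: g_def)
qed

text \<open>
  The characteristic function of the joint law: given the drift \<open>z\<close>, the observation is \<open>z\<close> plus
  Gaussian noise with covariance operator \<open>\<Gamma>\<close>, so that \<open>Z(a) + X(b)\<close> has mean \<open>\<langle>a + b, v\<rangle>\<close> and variance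
  \<open>\<langle>a + b, \<Gamma>\<tau> (a + b)\<rangle> + \<langle>b, \<Gamma> b\<rangle>\<close>. A phase \<open>\<theta>\<close> covers sines along with cosines.
\<close>

lemma joint_cos:
  assumes a: "times_in T a" and b: "times_in T b"
  shows "(\<integral>x. cos (\<theta> + path_comb a (fst x) + path_comb b (snd x)) \<partial>joint) =
    cos (\<theta> + path_comb a v + path_comb b v) *
    exp (- (cm_inner T (chi_comb T (a @ b)) (\<Gamma>\<tau> (chi_comb T (a @ b))) +
            cm_inner T (chi_comb T b) (\<Gamma> (chi_comb T b))) / 2)"
proof -
  let ?qb = "cm_inner T (chi_comb T b) (\<Gamma> (chi_comb T b))"
  let ?qa = "cm_inner T (chi_comb T (a @ b)) (\<Gamma>\<tau> (chi_comb T (a @ b)))"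
  have m: "(\<lambda>x. path_comb a (fst x)) \<in> borel_measurable joint" "(\<lambda>x. path_comb b (snd x)) \<in> borel_measurable joint"
    using fst_joint[OF path_comb_m[OF a]] snd_joint[OF path_comb_m[OF b]] .
  have "(\<integral>x. cos (\<theta> + path_comb a (fst x) + path_comb b (snd x)) \<partial>joint) =
      (\<integral>z. (\<integral>\<omega>. cos (\<theta> + path_comb a (fst (z, \<omega>)) + path_comb b (snd (z, \<omega>))) \<partial>P z) \<partial>Q)"
  proof (rule integral_joint[where C=1])
    show "(\<lambda>x. cos (\<theta> + path_comb a (fst x) + path_comb b (snd x))) \<in> borel_measurable joint"
      using m by measurable
  qed simp
  also have "\<dots> = (\<integral>z. exp (- ?qb / 2) * cos (\<theta> + path_comb (a @ b) z) \<partial>Q)"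
  proof (rule Bochner_Integration.integral_cong[OF refl])
    fix z assume "z \<in> space Q"
    then have z: "z \<in> space \<Omega>" by (simp add: space_Q)
    show "(\<integral>\<omega>. cos (\<theta> + path_comb a (fst (z, \<omega>)) + path_comb b (snd (z, \<omega>))) \<partial>P z) =
        exp (- ?qb / 2) * cos (\<theta> + path_comb (a @ b) z)"
      using gaussian_law_cos_phase[OF \<Omega> P[OF z] b, of "\<theta> + path_comb a z"]
      by (simp add: add.assoc mult.commute)
  qed
  also have "\<dots> = exp (- ?qb / 2) * (cos (\<theta> + path_comb (a @ b) v) * exp (- ?qa / 2))"
    using a b by (simp add: gaussian_law_cos_phase[OF \<Omega> Q, of "a @ b"] del: path_comb_simps chi_comb_simps)
  also have "\<dots> = cos (\<theta> + path_comb (a @ b) v) * exp (- (?qa + ?qb) / 2)"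
    by (simp add: mult.assoc add_divide_distrib mult_exp_exp del: path_comb_simps chi_comb_simps)
  finally show ?thesis by (simp add: add.assoc del: chi_comb_simps)
qed

definition centred :: "(real \<times> real) list \<Rightarrow> (real \<times> real) list \<Rightarrow> (real \<Rightarrow> real) \<times> (real \<Rightarrow> real) \<Rightarrow> real" where
  "centred a b x = path_comb a (fst x) + path_comb b (snd x) - (path_comb a v + path_comb b v)"

lemma centred_measurable:
  assumes "times_in T a" "times_in T b"
  shows "centred a b \<in> borel_measurable joint"
  unfolding centred_def[abs_def]
  using fst_joint[OF path_comb_m[OF assms(1)]] snd_joint[OF path_comb_m[OF assms(2)]] by measurable

lemma centred_cos:
  assumes abc: "times_in T a" "times_in T b" "times_in T c"
  defines "xa \<equiv> chi_comb T (a @ b)" and "xb \<equiv> chi_comb T b" and "xc \<equiv> chi_comb T c"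
  shows "(\<integral>x. cos (s * centred a b x + (\<theta> + path_comb c (snd x))) \<partial>joint) =
    cos (\<theta> + path_comb c v) *
    exp (- (s\<^sup>2 * (cm_inner T xa (\<Gamma>\<tau> xa) + cm_inner T xb (\<Gamma> xb)) +
            2 * s * (cm_inner T xa (\<Gamma>\<tau> xc) + cm_inner T xb (\<Gamma> xc)) +
            (cm_inner T xc (\<Gamma>\<tau> xc) + cm_inner T xc (\<Gamma> xc))) / 2)"
proof -
  have mem: "xa \<in> cm_space T" "xb \<in> cm_space T" "xc \<in> cm_space T"
    unfolding xa_def xb_def xc_def using abc by (auto intro!: chi_comb_mem simp del: chi_comb_simps)
  let ?a = "scale_comb s a" and ?b = "scale_comb s b @ c"
  let ?\<theta> = "\<theta> - s * (path_comb a v + path_comb b v)"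
  have c1: "chi_comb T (?a @ ?b) = (\<lambda>u. s * xa u + xc u)" "chi_comb T ?b = (\<lambda>u. s * xb u + xc u)"
    by (simp_all add: xa_def xb_def xc_def fun_eq_iff algebra_simps)
  have arg: "s * centred a b x + (\<theta> + path_comb c (snd x)) = ?\<theta> + path_comb ?a (fst x) + path_comb ?b (snd x)" for x
    by (simp add: centred_def algebra_simps)
  have "times_in T ?a" "times_in T ?b" using abc by simp_all
  from joint_cos[OF this, of ?\<theta>]
  have "(\<integral>x. cos (s * centred a b x + (\<theta> + path_comb c (snd x))) \<partial>joint) =
    cos (?\<theta> + path_comb ?a v + path_comb ?b v) *
    exp (- (cm_inner T (\<lambda>u. s * xa u + xc u) (\<Gamma>\<tau> (\<lambda>u. s * xa u + xc u)) +
            cm_inner T (\<lambda>u. s * xb u + xc u) (\<Gamma> (\<lambda>u. s * xb u + xc u))) / 2)"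
    unfolding arg c1 .
  also have "?\<theta> + path_comb ?a v + path_comb ?b v = \<theta> + path_comb c v" by (simp add: algebra_simps)
  finally show ?thesis
    unfolding quad_form_expand[OF \<Gamma>_sym(2) mem(1,3)] quad_form_expand[OF \<Gamma>_sym(1) mem(2,3)]
    by (simp add: algebra_simps)
qed

lemma centred_moments:
  assumes ab: "times_in T a" "times_in T b"
  defines "xa \<equiv> chi_comb T (a @ b)" and "xb \<equiv> chi_comb T b"
  shows "square_integrable joint (centred a b)"
    "(\<integral>x. (centred a b x)\<^sup>2 \<partial>joint) = cm_inner T xa (\<Gamma>\<tau> xa) + cm_inner T xb (\<Gamma> xb)"
proof -
  have mem: "xa \<in> cm_space T" "xb \<in> cm_space T"
    unfolding xa_def xb_def using ab by (auto intro!: chi_comb_mem simp del: chi_comb_simps)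
  have z: "cm_inner T h (G (\<lambda>_. 0)) = 0" if "h \<in> cm_space T" "sym_op G" for h G
    using sym_op_zero[OF that(2)] ip_zero[OF that(1)] by (simp add: cm_inner_commute[of T h])
  have char: "(\<integral>x. cos (s * centred a b x) \<partial>joint) =
      exp (- (s\<^sup>2 * (cm_inner T xa (\<Gamma>\<tau> xa) + cm_inner T xb (\<Gamma> xb))) / 2)" for s
    using centred_cos[OF ab, of "[]" s 0] mem
    by (simp add: z[OF _ \<Gamma>_sym(1)] z[OF _ \<Gamma>_sym(2)] zero_mem xa_def[symmetric] xb_def[symmetric] del: chi_comb_simps(2))
  have nn: "0 \<le> cm_inner T xa (\<Gamma>\<tau> xa) + cm_inner T xb (\<Gamma> xb)" using \<Gamma>_nonneg mem by (intro add_nonneg_nonneg) auto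
  note second_moment_from_char[OF prob_joint centred_measurable[OF ab] nn char]
  then show "square_integrable joint (centred a b)"
    "(\<integral>x. (centred a b x)\<^sup>2 \<partial>joint) = cm_inner T xa (\<Gamma>\<tau> xa) + cm_inner T xb (\<Gamma> xb)" .
qed

lemma centred_cross:
  assumes abc: "times_in T a" "times_in T b" "times_in T c"
  defines "xa \<equiv> chi_comb T (a @ b)" and "xb \<equiv> chi_comb T b" and "xc \<equiv> chi_comb T c"
  shows "\<bar>\<integral>x. centred a b x * sin (\<theta> + path_comb c (snd x)) \<partial>joint\<bar> \<le>
    \<bar>cm_inner T xa (\<Gamma>\<tau> xc) + cm_inner T xb (\<Gamma> xc)\<bar>"
proof (rule cross_moment_from_char[OF prob_joint])
  show "square_integrable joint (centred a b)" by (rule centred_moments[OF abc(1,2)])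
  show "(\<lambda>x. \<theta> + path_comb c (snd x)) \<in> borel_measurable joint"
    using snd_joint[OF path_comb_m[OF abc(3)]] by measurable
  have mem: "xc \<in> cm_space T" unfolding xc_def by (rule chi_comb_mem[OF abc(3)])
  show "0 \<le> cm_inner T xc (\<Gamma>\<tau> xc) + cm_inner T xc (\<Gamma> xc)" using \<Gamma>_nonneg[OF mem] by simp
  show "\<bar>cos (\<theta> + path_comb c v)\<bar> \<le> 1" by simp
qed (rule centred_cos[OF abc, folded xa_def xb_def xc_def])

end

section \<open>The posterior mean\<close>

lemma nn_integral_square_add_finite:
  fixes f g :: "'a \<Rightarrow> real"
  assumes f: "f \<in> borel_measurable M" "(\<integral>\<^sup>+x. ennreal ((f x)\<^sup>2) \<partial>M) < \<infinity>"
    and g: "g \<in> borel_measurable M" "(\<integral>\<^sup>+x. ennreal ((g x)\<^sup>2) \<partial>M) < \<infinity>"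
  shows "(\<integral>\<^sup>+x. ennreal ((f x + g x)\<^sup>2) \<partial>M) < \<infinity>"
  using square_integrable_nn[OF square_integrable_add[OF square_integrable_nnI[OF f] square_integrable_nnI[OF g]]]
  by simp

context bayes_model
begin

text \<open>
  The covariance operator of the observation under the joint law: prior plus noise.
\<close>

definition A where "A = op_sum \<Gamma>\<tau> \<Gamma>"

lemma A_apply: "A h = (\<lambda>s. \<Gamma>\<tau> h s + \<Gamma> h s)"
  by (simp add: A_def op_sum_def)

lemma A_sym: "sym_op A"
  unfolding sym_op_def
proof (intro conjI ballI allI)
  show "A h \<in> cm_space T" if "h \<in> cm_space T" for h
    unfolding A_apply by (intro add_mem sym_op_mem[OF \<Gamma>_sym(1)] sym_op_mem[OF \<Gamma>_sym(2)] that)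
  show "A (\<lambda>s. a * h s + b * g s) = (\<lambda>s. a * A h s + b * A g s)"
    if "h \<in> cm_space T" "g \<in> cm_space T" for a b h g
    unfolding A_apply sym_op_lin[OF \<Gamma>_sym(1) that] sym_op_lin[OF \<Gamma>_sym(2) that]
    by (simp add: fun_eq_iff algebra_simps)
  show "cm_inner T (A h) g = cm_inner T h (A g)" if hg: "h \<in> cm_space T" "g \<in> cm_space T" for h g
  proof -
    note m = sym_op_mem[OF \<Gamma>_sym(1)] sym_op_mem[OF \<Gamma>_sym(2)]
    show ?thesis
      unfolding A_apply ip_add[OF m(2)[OF hg(1)] m(1)[OF hg(1)] hg(2)]
        ip_add_right[OF m(2)[OF hg(2)] m(1)[OF hg(2)] hg(1)]
        sym_op_ip[OF \<Gamma>_sym(1) hg] sym_op_ip[OF \<Gamma>_sym(2) hg] ..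
  qed
qed

text \<open>
  Here \<open>U = Z\<^sub>t - \<xi>\<^sub>t\<close> is the error of \<open>\<xi>\<^sub>t = Y + v(t) - \<langle>f, v\<rangle>\<close> with \<open>Y\<close> a version of \<open>X(f)\<close>. Replacing \<open>f\<close> by
  elements \<open>x n\<close> of the span of the \<open>\<chi>\<^sub>t\<close> gives Gaussian variables \<open>W n\<close> that tend to \<open>U\<close> in \<open>L\<^sup>2\<close>. The covariance of
  \<open>W n\<close> and \<open>X(y)\<close> is \<open>\<langle>\<chi>\<^sub>t, \<Gamma>\<tau> y\<rangle> - \<langle>x n, A y\<rangle>\<close>, with limit \<open>\<langle>\<Gamma>\<tau> \<chi>\<^sub>t - A f, y\<rangle> = 0\<close>: this is where the equation for
  \<open>f\<close> comes from. The variance of \<open>W n\<close> tends to \<open>\<langle>\<chi>\<^sub>t - f, \<Gamma>\<tau> (\<chi>\<^sub>t - f)\<rangle> + \<langle>f, \<Gamma> f\<rangle>\<close>, which the same equation,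
  in the form \<open>\<Gamma>\<tau> (\<chi>\<^sub>t - f) = \<Gamma> f\<close>, reduces to \<open>\<langle>\<chi>\<^sub>t, \<Gamma> f\<rangle>\<close>.
\<close>

lemma posterior_error:
  assumes t: "t \<in> {0..T}" and f: "f \<in> cm_space T" and Af: "A f = \<Gamma>\<tau> (chi T t)"
    and X: "is_X_of T \<Omega> Q P f Y"
  defines "U \<equiv> \<lambda>x. fst x t - (Y (snd x) + (v t - cm_inner T f v))"
  shows "square_integrable joint U"
    and "(\<integral>x. (U x)\<^sup>2 \<partial>joint) = cm_inner T (chi T t) (\<Gamma> f)"
    and "times_in T b \<Longrightarrow> (\<integral>x. U x * sin (\<theta> + path_comb b (snd x)) \<partial>joint) = 0"
proof -
  interpret J: prob_space joint by (rule prob_joint)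
  have Y: "Y \<in> borel_measurable \<Omega>" using X by (simp add: is_X_of_def)
  obtain c where c: "\<And>n::nat. times_in T (c n)"
    and cf: "(\<lambda>n. cm_inner T (\<lambda>s. f s - chi_comb T (c n) s) (\<lambda>s. f s - chi_comb T (c n) s)) \<longlonglongrightarrow> 0"
    and cY: "(\<lambda>n. \<integral>\<^sup>+z. (\<integral>\<^sup>+\<omega>. ennreal ((path_comb (c n) \<omega> - Y \<omega>)\<^sup>2) \<partial>P z) \<partial>Q) \<longlonglongrightarrow> 0"
    using X unfolding is_X_of_def by blast
  define x where "x n = chi_comb T (c n)" for n
  have xm: "x n \<in> cm_space T" for n unfolding x_def by (rule chi_comb_mem[OF c])
  have xt: "tends x f"
  proof -
    have "(\<lambda>n. sqrt (cm_inner T (\<lambda>s. f s - x n s) (\<lambda>s. f s - x n s))) \<longlonglongrightarrow> sqrt 0"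
      unfolding x_def by (rule tendsto_real_sqrt[OF cf])
    then show ?thesis unfolding tends_def using nrm_diff_commute[OF xm f] by (simp add: nrm_def)
  qed
  note chit = chi_mem[OF t]
  define a where "a = [(1 :: real, t)]"
  have a: "times_in T a" using t by (simp add: a_def)
  define b' where "b' n = scale_comb (-1) (c n)" for n
  have b': "times_in T (b' n)" for n using c by (simp add: b'_def)
  define W where "W n = centred a (b' n)" for n
  have W: "square_integrable joint (W n)" for n unfolding W_def by (rule centred_moments[OF a b'])
  have xab: "chi_comb T (a @ b' n) = (\<lambda>s. chi T t s - x n s)" "chi_comb T (b' n) = (\<lambda>s. -1 * x n s)" for n
    by (simp_all add: a_def b'_def x_def chi_comb_path_comb fun_eq_iff)
  define D where "D n w = path_comb (c n) (snd w) - Y (snd w)"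
    for n and w :: "(real \<Rightarrow> real) \<times> (real \<Rightarrow> real)"
  have Dm: "D n \<in> borel_measurable joint" for n
    unfolding D_def using snd_joint[OF path_comb_m[OF c]] snd_joint[OF Y] by measurable
  have D0: "(\<lambda>n. \<integral>\<^sup>+w. ennreal ((D n w)\<^sup>2) \<partial>joint) \<longlonglongrightarrow> 0"
  proof -
    have "(\<integral>\<^sup>+w. ennreal ((D n w)\<^sup>2) \<partial>joint) = (\<integral>\<^sup>+z. (\<integral>\<^sup>+\<omega>. ennreal ((path_comb (c n) \<omega> - Y \<omega>)\<^sup>2) \<partial>P z) \<partial>Q)" for n
      using nn_integral_joint[of "\<lambda>w. ennreal ((D n w)\<^sup>2)"] Dm[of n] by (simp add: D_def[abs_def])
    then show ?thesis using cY by simp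
  qed
  have X2: "square_integrable joint (\<lambda>w. path_comb (c n) (snd w))" for n
  proof -
    have "square_integrable joint (centred [] (c n))" by (rule centred_moments) (use c in auto)
    moreover have "square_integrable joint (\<lambda>_. path_comb (c n) v)" by (simp add: square_integrable_def)
    ultimately have "square_integrable joint (\<lambda>w. centred [] (c n) w + path_comb (c n) v)"
      by (rule square_integrable_add)
    then show ?thesis by (simp add: centred_def)
  qed
  have Y2: "square_integrable joint (\<lambda>w. Y (snd w))"
  proof -
    have "\<forall>\<^sub>F n in sequentially. (\<integral>\<^sup>+w. ennreal ((D n w)\<^sup>2) \<partial>joint) < 1"
      by (rule order_tendstoD(2)[OF D0]) simp
    then obtain n where "(\<integral>\<^sup>+w. ennreal ((D n w)\<^sup>2) \<partial>joint) < 1" by (auto simp: eventually_sequentially)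
    then have "(\<integral>\<^sup>+w. ennreal ((D n w)\<^sup>2) \<partial>joint) < \<infinity>" by (rule less_trans) simp
    from square_integrable_diff[OF X2[of n] square_integrable_nnI[OF Dm this]]
    show ?thesis by (simp add: D_def)
  qed
  have D2: "square_integrable joint (D n)" for n
    using square_integrable_diff[OF X2[of n] Y2] by (simp add: D_def[abs_def])
  have D0': "(\<lambda>n. \<integral>w. (D n w)\<^sup>2 \<partial>joint) \<longlonglongrightarrow> 0"
  proof -
    have "(\<lambda>n. ennreal (\<integral>w. (D n w)\<^sup>2 \<partial>joint)) \<longlonglongrightarrow> ennreal 0"
      using D0 by (simp add: square_integrable_nn[OF D2])
    then show ?thesis by (subst (asm) tendsto_ennreal_iff) auto
  qed
  \<comment> \<open>The means of the approximations differ from \<open>v(t) - \<langle>f, v\<rangle>\<close> by \<open>e n\<close>.\<close>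
  define e where "e n = cm_inner T f v - cm_inner T (x n) v" for n
  have e0: "e \<longlonglongrightarrow> 0"
    using tendsto_diff[OF tendsto_const[of "cm_inner T f v"] tends_ip[OF xm f xt v]] by (simp add: e_def[abs_def])
  have diff: "W n w - U w = (-1) * D n w + (-1) * e n" for n w
  proof -
    have "cm_inner T (x n) v = path_comb (c n) v"
      unfolding x_def by (subst cm_inner_commute) (rule ip_chi_comb[OF v c])
    then show ?thesis by (simp add: W_def centred_def U_def D_def e_def a_def b'_def)
  qed
  have const: "square_integrable joint (\<lambda>_. k)" for k by (simp add: square_integrable_def)
  have "square_integrable joint (\<lambda>w. W 0 w - ((-1) * D 0 w + (-1) * e 0))"
    by (rule square_integrable_diff[OF W square_integrable_lin[OF D2 const]])
  moreover have "W 0 w - ((-1) * D 0 w + (-1) * e 0) = U w" for w using diff[of 0 w] by linarith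
  ultimately show U: "square_integrable joint U" by simp
  have lim: "(\<lambda>n. \<integral>w. (W n w - U w)\<^sup>2 \<partial>joint) \<longlonglongrightarrow> 0"
  proof (rule Lim_null_comparison)
    show "\<forall>\<^sub>F n in sequentially. norm (\<integral>w. (W n w - U w)\<^sup>2 \<partial>joint) \<le> 2 * (\<integral>w. (D n w)\<^sup>2 \<partial>joint) + 2 * (e n)\<^sup>2"
    proof (rule always_eventually, rule allI)
      fix n
      have i: "integrable joint (\<lambda>w. (D n w)\<^sup>2)" using D2 by (simp add: square_integrable_def)
      have "(\<integral>w. (W n w - U w)\<^sup>2 \<partial>joint) \<le> (\<integral>w. 2 * (D n w)\<^sup>2 + 2 * (e n)\<^sup>2 \<partial>joint)"
      proof (rule integral_mono)
        show "integrable joint (\<lambda>w. (W n w - U w)\<^sup>2)"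
          using square_integrable_diff[OF W U] by (simp add: square_integrable_def)
        show "integrable joint (\<lambda>w. 2 * (D n w)\<^sup>2 + 2 * (e n)\<^sup>2)" using i by simp
        show "(W n w - U w)\<^sup>2 \<le> 2 * (D n w)\<^sup>2 + 2 * (e n)\<^sup>2" for w
          unfolding diff using sum_squares_bound[of "D n w" "e n"] by (simp add: power2_eq_square algebra_simps)
      qed
      also have "\<dots> = 2 * (\<integral>w. (D n w)\<^sup>2 \<partial>joint) + 2 * (e n)\<^sup>2" using i by (simp add: J.prob_space)
      finally show "norm (\<integral>w. (W n w - U w)\<^sup>2 \<partial>joint) \<le> 2 * (\<integral>w. (D n w)\<^sup>2 \<partial>joint) + 2 * (e n)\<^sup>2" by simp
    qed
    have "(\<lambda>n. 2 * (\<integral>w. (D n w)\<^sup>2 \<partial>joint) + 2 * (e n)\<^sup>2) \<longlonglongrightarrow> 2 * 0 + 2 * 0\<^sup>2"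
      by (intro tendsto_intros D0' e0)
    then show "(\<lambda>n. 2 * (\<integral>w. (D n w)\<^sup>2 \<partial>joint) + 2 * (e n)\<^sup>2) \<longlonglongrightarrow> 0" by simp
  qed
  have Gx: "\<Gamma> h \<in> cm_space T" "\<Gamma>\<tau> h \<in> cm_space T" if "h \<in> cm_space T" for h
    using sym_op_mem[OF \<Gamma>_sym(1) that] sym_op_mem[OF \<Gamma>_sym(2) that] .
  have cm: "(\<lambda>s. chi T t s - x n s) \<in> cm_space T" "(\<lambda>s. chi T t s - f s) \<in> cm_space T" for n
    using diff_mem[OF chit xm] diff_mem[OF chit f] by simp_all
  have ct: "tends (\<lambda>n s. chi T t s - x n s) (\<lambda>s. chi T t s - f s)"
  proof -
    have "nrm (\<lambda>s. (chi T t s - x n s) - (chi T t s - f s)) = nrm (\<lambda>s. x n s - f s)" for n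
      using nrm_diff_commute[OF f xm] by simp
    then show ?thesis using xt by (simp add: tends_def)
  qed
  \<comment> \<open>The observation enters \<open>W n\<close> with a minus sign, which quadratic forms do not see.\<close>
  have neg: "cm_inner T (\<lambda>s. -1 * x n s) (\<Gamma> (\<lambda>s. -1 * x n s)) = cm_inner T (x n) (\<Gamma> (x n))" for n
    unfolding sym_op_scale[OF \<Gamma>_sym(1) xm] ip_scale[OF xm scale_mem[OF Gx(1)[OF xm]]]
      ip_scale_right[OF Gx(1)[OF xm] xm] by simp
  have "(\<lambda>n. \<integral>w. (W n w)\<^sup>2 \<partial>joint) \<longlonglongrightarrow>
      cm_inner T (\<lambda>s. chi T t s - f s) (\<Gamma>\<tau> (\<lambda>s. chi T t s - f s)) + cm_inner T f (\<Gamma> f)"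
    unfolding W_def centred_moments(2)[OF a b'] xab neg
  proof (rule tendsto_add)
    let ?d = "\<lambda>n s. chi T t s - x n s" and ?e = "\<lambda>s. chi T t s - f s"
    have "tends (\<lambda>n. \<Gamma>\<tau> (?d n)) (\<Gamma>\<tau> ?e)"
      by (rule sym_op_tends[OF \<Gamma>_sym(2), of ?d ?e]) (use cm ct in simp_all)
    then show "(\<lambda>n. cm_inner T (?d n) (\<Gamma>\<tau> (?d n))) \<longlonglongrightarrow> cm_inner T ?e (\<Gamma>\<tau> ?e)"
      by (rule tends_ip2[of ?d ?e "\<lambda>n. \<Gamma>\<tau> (?d n)" "\<Gamma>\<tau> ?e", rotated -1]) (use cm ct Gx(2)[OF cm(1)] Gx(2)[OF cm(2)] in simp_all)
    have "tends (\<lambda>n. \<Gamma> (x n)) (\<Gamma> f)" by (rule sym_op_tends[OF \<Gamma>_sym(1) xm f xt])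
    then show "(\<lambda>n. cm_inner T (x n) (\<Gamma> (x n))) \<longlonglongrightarrow> cm_inner T f (\<Gamma> f)"
      by (rule tends_ip2[OF xm f xt Gx(1)[OF xm] Gx(1)[OF f]])
  qed
  moreover have "(\<lambda>n. \<integral>w. (W n w)\<^sup>2 \<partial>joint) \<longlonglongrightarrow> (\<integral>w. (U w)\<^sup>2 \<partial>joint)"
    by (rule L2_limit_square[OF W U lim])
  ultimately have "(\<integral>w. (U w)\<^sup>2 \<partial>joint) =
      cm_inner T (\<lambda>s. chi T t s - f s) (\<Gamma>\<tau> (\<lambda>s. chi T t s - f s)) + cm_inner T f (\<Gamma> f)"
    using LIMSEQ_unique by blast
  also have "\<Gamma>\<tau> (\<lambda>s. chi T t s - f s) = (\<lambda>s. \<Gamma>\<tau> (chi T t) s - \<Gamma>\<tau> f s)" by (rule sym_op_diff[OF \<Gamma>_sym(2) chit f])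
  also have "\<dots> = \<Gamma> f" unfolding Af[symmetric] A_apply by simp
  also have "cm_inner T (\<lambda>s. chi T t s - f s) (\<Gamma> f) + cm_inner T f (\<Gamma> f) = cm_inner T (chi T t) (\<Gamma> f)"
    unfolding ip_diff[OF chit f Gx(1)[OF f]] by simp
  finally show "(\<integral>x. (U x)\<^sup>2 \<partial>joint) = cm_inner T (chi T t) (\<Gamma> f)" .
  show "(\<integral>x. U x * sin (\<theta> + path_comb b (snd x)) \<partial>joint) = 0" if b: "times_in T b"
  proof -
    define y where "y = chi_comb T b"
    have y: "y \<in> cm_space T" unfolding y_def by (rule chi_comb_mem[OF b])
    define s where "s w = sin (\<theta> + path_comb b (snd w))" for w :: "(real \<Rightarrow> real) \<times> (real \<Rightarrow> real)"
    have sm: "s \<in> borel_measurable joint" unfolding s_def using snd_joint[OF path_comb_m[OF b]] by measurable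
    have s2: "square_integrable joint s"
      unfolding square_integrable_def
    proof
      show "integrable joint (\<lambda>w. (s w)\<^sup>2)"
      proof (rule bounded_integrable[OF prob_joint, of _ 1])
        show "(\<lambda>w. (s w)\<^sup>2) \<in> borel_measurable joint" using sm by measurable
        show "\<bar>(s w)\<^sup>2\<bar> \<le> 1" for w by (simp add: s_def abs_square_le_1)
      qed
    qed (rule sm)
    define \<beta> where "\<beta> n = cm_inner T (\<lambda>s. chi T t s - x n s) (\<Gamma>\<tau> y) + cm_inner T (\<lambda>s. -1 * x n s) (\<Gamma> y)" for n
    have le: "\<bar>\<integral>w. W n w * s w \<partial>joint\<bar> \<le> \<bar>\<beta> n\<bar>" for n
      using centred_cross[OF a b' b, of n \<theta>] unfolding xab W_def s_def \<beta>_def y_def .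
    have \<beta>: "\<beta> n = cm_inner T (chi T t) (\<Gamma>\<tau> y) - cm_inner T (x n) (A y)" for n
      unfolding \<beta>_def A_apply ip_diff[OF chit xm Gx(2)[OF y]] ip_scale[OF xm Gx(1)[OF y]]
        ip_add_right[OF Gx(2)[OF y] Gx(1)[OF y] xm] by simp
    have "(\<lambda>n. cm_inner T (chi T t) (\<Gamma>\<tau> y) - cm_inner T (x n) (A y)) \<longlonglongrightarrow> cm_inner T (chi T t) (\<Gamma>\<tau> y) - cm_inner T f (A y)"
      by (intro tendsto_diff tendsto_const tends_ip[OF xm f xt] sym_op_mem[OF A_sym y])
    also have "cm_inner T f (A y) = cm_inner T (\<Gamma>\<tau> (chi T t)) y"
      using sym_op_ip[OF A_sym f y] Af by simp
    also have "\<dots> = cm_inner T (chi T t) (\<Gamma>\<tau> y)" by (rule sym_op_ip[OF \<Gamma>_sym(2) chit y])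
    finally have "(\<lambda>n. \<beta> n) \<longlonglongrightarrow> 0" unfolding \<beta> by simp
    then have "(\<lambda>n. \<bar>\<beta> n\<bar>) \<longlonglongrightarrow> 0" by (rule tendsto_rabs_zero)
    then have "(\<lambda>n. \<integral>w. W n w * s w \<partial>joint) \<longlonglongrightarrow> 0"
      by (rule Lim_null_comparison[rotated]) (use le in \<open>auto intro!: always_eventually\<close>)
    with L2_limit_mult[OF W U lim s2] have "(\<integral>w. U w * s w \<partial>joint) = 0" using LIMSEQ_unique by blast
    then show ?thesis by (simp add: s_def)
  qed
qed

text \<open>
  By the monotone class theorem, \<open>U\<close> integrates to 0 over every event of the observation, that is, its
  conditional expectation given the observation vanishes. The function \<open>g\<close> may then be unbounded.
\<close>

lemma orthogonal_to_observation:
  assumes U: "integrable joint U"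
    and trig: "\<And>\<theta> b. times_in T b \<Longrightarrow> (\<integral>x. U x * sin (\<theta> + path_comb b (snd x)) \<partial>joint) = 0"
    and g: "g \<in> borel_measurable \<Omega>" and Ug: "integrable joint (\<lambda>x. g (snd x) * U x)"
  shows "(\<integral>x. g (snd x) * U x \<partial>joint) = 0"
proof -
  interpret J: prob_space joint by (rule prob_joint)
  have Um: "U \<in> borel_measurable joint" using U by simp
  let ?cl = "bp_closure (space \<Omega>) (trig T)"
  have int: "integrable joint (\<lambda>x. U x * f (snd x))" if f: "f \<in> ?cl" for f
  proof -
    obtain C where C: "\<And>x. x \<in> space \<Omega> \<Longrightarrow> \<bar>f x\<bar> \<le> C" using trig_closure(2)[OF \<Omega> f] by blast
    show ?thesis
    proof (rule Bochner_Integration.integrable_bound)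
      show "integrable joint (\<lambda>x. C * U x)" using U by simp
      show "(\<lambda>x. U x * f (snd x)) \<in> borel_measurable joint"
        using Um snd_joint[OF trig_closure(1)[OF \<Omega> f]] by measurable
      show "AE x in joint. norm (U x * f (snd x)) \<le> norm (C * U x)"
      proof (rule AE_I2)
        fix x assume "x \<in> space joint"
        then have "\<bar>f (snd x)\<bar> \<le> C" using C by (auto simp: space_joint)
        then have "\<bar>U x\<bar> * \<bar>f (snd x)\<bar> \<le> \<bar>U x\<bar> * \<bar>C\<bar>" by (intro mult_left_mono) auto
        then show "norm (U x * f (snd x)) \<le> norm (C * U x)" by (simp add: abs_mult mult.commute)
      qed
    qed
  qed
  have cl: "(\<integral>x. U x * f (snd x) \<partial>joint) = 0" if "f \<in> ?cl" for f
    using that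
  proof induction
    case (base f)
    then consider c where "times_in T c" "f = (\<lambda>\<omega>. cos (path_comb c \<omega>))"
      | c where "times_in T c" "f = (\<lambda>\<omega>. sin (path_comb c \<omega>))" unfolding trig_def by blast
    then show ?case
    proof cases
      case 1
      \<comment> \<open>Cosines are sines with another phase.\<close>
      have "cos (path_comb c x) = sin (pi / 2 + path_comb c x)" for x by (simp add: sin_add)
      then show ?thesis using 1 trig[OF 1(1), of "pi / 2"] by simp
    next
      case 2
      then show ?thesis using trig[OF 2(1), of 0] by simp
    qed
  next
    case (lin f g a b)
    have "(\<integral>x. U x * (a * f (snd x) + b * g (snd x)) \<partial>joint) =
        (\<integral>x. a * (U x * f (snd x)) + b * (U x * g (snd x)) \<partial>joint)"
      by (rule Bochner_Integration.integral_cong) (auto simp: algebra_simps)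
    also have "\<dots> = a * (\<integral>x. U x * f (snd x) \<partial>joint) + b * (\<integral>x. U x * g (snd x) \<partial>joint)"
      using int[OF lin.hyps(1)] int[OF lin.hyps(2)] by simp
    also have "\<dots> = 0" using lin.IH by simp
    finally show ?case .
  next
    case (lim F C f)
    have f: "f \<in> ?cl" by (rule bp_closure.lim[OF lim.hyps])
    have "(\<lambda>n. \<integral>x. U x * F n (snd x) \<partial>joint) \<longlonglongrightarrow> (\<integral>x. U x * f (snd x) \<partial>joint)"
    proof (rule integral_dominated_convergence[where w="\<lambda>x. \<bar>U x\<bar> * C"])
      show "integrable joint (\<lambda>x. \<bar>U x\<bar> * C)" using U by simp
      show "(\<lambda>x. U x * f (snd x)) \<in> borel_measurable joint" using int[OF f] by simp
      show "(\<lambda>x. U x * F n (snd x)) \<in> borel_measurable joint" for n using int[OF lim.hyps(1)] by simp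
      show "AE x in joint. (\<lambda>n. U x * F n (snd x)) \<longlonglongrightarrow> U x * f (snd x)"
        using lim.hyps(3) by (intro AE_I2 tendsto_mult tendsto_const) (auto simp: space_joint)
      show "AE x in joint. norm (U x * F n (snd x)) \<le> \<bar>U x\<bar> * C" for n
        using lim.hyps(2) by (intro AE_I2) (auto simp: space_joint abs_mult intro!: mult_left_mono)
    qed
    then show ?case using lim.IH by (simp add: LIMSEQ_const_iff)
  qed
  define F where "F = vimage_algebra (space joint) snd \<Omega>"
  have snd_sp: "snd \<in> space joint \<rightarrow> space \<Omega>" by (auto simp: space_joint)
  have setsF: "sets F = {snd -` B \<inter> space joint | B. B \<in> sets \<Omega>}"
    unfolding F_def by (rule sets_vimage_algebra2[OF snd_sp])
  have snd_m: "snd \<in> measurable joint \<Omega>" unfolding measurable_cong_sets[OF sets_joint refl] by simp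
  have "subalgebra joint F"
    unfolding subalgebra_def setsF using measurable_sets[OF snd_m] by (auto simp: F_def)
  then interpret F: finite_measure_subalgebra joint F by unfold_locales
  have AE0: "AE x in joint. real_cond_exp joint F U x = 0"
  proof (rule F.real_cond_exp_charact[OF _ U])
    fix S assume "S \<in> sets F"
    then obtain B where B: "B \<in> sets \<Omega>" "S = snd -` B \<inter> space joint" using setsF by blast
    have "(\<integral>x\<in>S. U x \<partial>joint) = (\<integral>x. U x * indicator B (snd x) \<partial>joint)"
      unfolding set_lebesgue_integral_def B(2)
      by (rule Bochner_Integration.integral_cong) (auto simp: indicator_def)
    also have "\<dots> = 0" using cl[OF indicator_in_trig_closure[OF \<Omega> B(1)]] by simp
    finally show "(\<integral>x\<in>S. U x \<partial>joint) = (\<integral>x\<in>S. 0 \<partial>joint)" by simp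
  qed auto
  have gF: "(\<lambda>x. g (snd x)) \<in> borel_measurable F"
    unfolding F_def by (rule measurable_compose[OF measurable_vimage_algebra1[OF snd_sp] g])
  have "(\<integral>x. g (snd x) * U x \<partial>joint) = (\<integral>x. g (snd x) * real_cond_exp joint F U x \<partial>joint)"
    using F.real_cond_exp_intg(2)[OF Ug gF Um] by simp
  also have "\<dots> = 0" by (rule integral_eq_zero_AE) (use AE0 in auto)
  finally show ?thesis .
qed

text \<open>
  The error \<open>\<eta> - Z\<^sub>t\<close> is a function of the observation minus the error \<open>U\<close> of \<open>\<xi>\<close>, and these are orthogonal.
  If \<open>\<eta> - \<xi>\<close> is not square integrable there is no inner product to speak of, but then both sides are
  infinite because \<open>U\<close> is square integrable.
\<close>

lemma pythagoras:
  assumes t: "t \<in> {0..T}" and f: "f \<in> cm_space T" and Af: "A f = \<Gamma>\<tau> (chi T t)"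
    and X: "is_X_of T \<Omega> Q P f Y" and \<eta>: "\<eta> \<in> borel_measurable \<Omega>"
  defines "\<xi> \<equiv> \<lambda>\<omega>. Y \<omega> + (v t - cm_inner T f v)"
  shows "(\<integral>\<^sup>+x. ennreal ((\<eta> (snd x) - fst x t)\<^sup>2) \<partial>joint) =
    (\<integral>\<^sup>+x. ennreal ((\<eta> (snd x) - \<xi> (snd x))\<^sup>2) \<partial>joint) + ennreal (cm_inner T (chi T t) (\<Gamma> f))"
proof -
  interpret J: prob_space joint by (rule prob_joint)
  define U where "U x = fst x t - (Y (snd x) + (v t - cm_inner T f v))" for x :: "(real \<Rightarrow> real) \<times> (real \<Rightarrow> real)"
  note pe = posterior_error[OF t f Af X, folded U_def]
  have U: "square_integrable joint U" by (rule pe(1))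
  have Ui: "integrable joint U" by (rule square_integrable_integrable[OF _ U]) unfold_locales
  have Um: "U \<in> borel_measurable joint" using Ui by simp
  have Y: "Y \<in> borel_measurable \<Omega>" using X by (simp add: is_X_of_def)
  define g where "g \<omega> = \<eta> \<omega> - \<xi> \<omega>" for \<omega>
  have gm: "g \<in> borel_measurable \<Omega>" unfolding g_def \<xi>_def using \<eta> Y by measurable
  have gm': "(\<lambda>x. g (snd x)) \<in> borel_measurable joint" by (rule snd_joint[OF gm])
  have dm: "(\<lambda>x. \<eta> (snd x) - fst x t) \<in> borel_measurable joint"
  proof -
    have "(\<lambda>x. path_comb [(1, t)] (fst x)) \<in> borel_measurable joint" by (rule fst_joint[OF path_comb_m]) (use t in simp)
    then show ?thesis using snd_joint[OF \<eta>] by simp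
  qed
  have eq: "\<eta> (snd x) - fst x t = g (snd x) - U x" for x by (simp add: g_def \<xi>_def U_def)
  have nnU: "(\<integral>\<^sup>+x. ennreal ((U x)\<^sup>2) \<partial>joint) = ennreal (cm_inner T (chi T t) (\<Gamma> f))"
    using square_integrable_nn[OF U] pe(2) by simp
  show ?thesis
  proof (cases "(\<integral>\<^sup>+x. ennreal ((g (snd x))\<^sup>2) \<partial>joint) < \<infinity>")
    case True
    have g: "square_integrable joint (\<lambda>x. g (snd x))" by (rule square_integrable_nnI[OF gm' True])
    have gU: "integrable joint (\<lambda>x. g (snd x) * U x)" by (rule square_integrable_mult[OF g U])
    have orth: "(\<integral>x. g (snd x) * U x \<partial>joint) = 0"
      by (rule orthogonal_to_observation[OF Ui pe(3) gm gU])
    have i: "integrable joint (\<lambda>x. (g (snd x))\<^sup>2)" "integrable joint (\<lambda>x. (U x)\<^sup>2)"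
      using g U by (auto simp: square_integrable_def)
    have "(\<lambda>x. (g (snd x) - U x)\<^sup>2) = (\<lambda>x. (g (snd x))\<^sup>2 - 2 * (g (snd x) * U x) + (U x)\<^sup>2)"
      by (simp add: fun_eq_iff power2_eq_square algebra_simps)
    then have "(\<integral>x. (g (snd x) - U x)\<^sup>2 \<partial>joint) = (\<integral>x. (g (snd x))\<^sup>2 \<partial>joint) + (\<integral>x. (U x)\<^sup>2 \<partial>joint)"
      using i gU orth by simp
    then have "(\<integral>\<^sup>+x. ennreal ((g (snd x) - U x)\<^sup>2) \<partial>joint) =
        (\<integral>\<^sup>+x. ennreal ((g (snd x))\<^sup>2) \<partial>joint) + (\<integral>\<^sup>+x. ennreal ((U x)\<^sup>2) \<partial>joint)"
      unfolding square_integrable_nn[OF square_integrable_diff[OF g U]] square_integrable_nn[OF g]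
        square_integrable_nn[OF U] by simp
    then show ?thesis unfolding eq nnU by (simp add: g_def)
  next
    case False
    then have inf: "(\<integral>\<^sup>+x. ennreal ((g (snd x))\<^sup>2) \<partial>joint) = \<infinity>"
      unfolding infinity_ennreal_def using top.not_eq_extremum by blast
    have "\<not> (\<integral>\<^sup>+x. ennreal ((\<eta> (snd x) - fst x t)\<^sup>2) \<partial>joint) < \<infinity>"
    proof
      assume "(\<integral>\<^sup>+x. ennreal ((\<eta> (snd x) - fst x t)\<^sup>2) \<partial>joint) < \<infinity>"
      from nn_integral_square_add_finite[OF dm this Um] nnU
      have "(\<integral>\<^sup>+x. ennreal ((g (snd x))\<^sup>2) \<partial>joint) < \<infinity>" by (simp add: eq)
      then show False using False by simp
    qed
    then have "(\<integral>\<^sup>+x. ennreal ((\<eta> (snd x) - fst x t)\<^sup>2) \<partial>joint) = \<infinity>"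
      unfolding infinity_ennreal_def using top.not_eq_extremum by blast
    then show ?thesis using inf by (simp add: g_def)
  qed
qed

end

section \<open>Minimality and uniqueness\<close>

text \<open>
  The map \<open>f\<close> picks the solution \<open>f t\<close> of \<open>(\<Gamma>\<tau> + \<Gamma>) (f t) = \<Gamma>\<tau> \<chi>\<^sub>t\<close>; naming it avoids carrying an inverse of
  \<open>A\<close>, which is defined on the range of \<open>A\<close> only.
\<close>

locale bayes_problem = bayes_model +
  fixes \<mu> :: "real measure" and f :: "real \<Rightarrow> real \<Rightarrow> real"
  assumes fin_\<mu>: "finite_measure \<mu>" and sets_\<mu>: "sets \<mu> = sets (restrict_space borel {0..T})"
    and A_inj: "h \<in> cm_space T \<Longrightarrow> A h = (\<lambda>_. 0) \<Longrightarrow> h = (\<lambda>_. 0)"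
    and f_mem: "t \<in> {0..T} \<Longrightarrow> f t \<in> cm_space T"
    and f_eq: "t \<in> {0..T} \<Longrightarrow> A (f t) = \<Gamma>\<tau> (chi T t)"
begin

text \<open>
  This is \<open>\<langle>\<chi>\<^sub>t - f\<^sub>t, v\<rangle>\<close>, the constant that makes \<open>drift t + X(f\<^sub>t)\<close> have the mean \<open>v(t)\<close> of the target.
\<close>

definition drift :: "real \<Rightarrow> real" where "drift t = v t - cm_inner T (f t) v"

lemma space_\<mu>: "space \<mu> = {0..T}"
  using sets_eq_imp_space_eq[OF sets_\<mu>] by (simp add: space_restrict_space)

lemma cm_borel_\<mu>: "h \<in> cm_space T \<Longrightarrow> h \<in> borel_measurable \<mu>"
  using cm_borel by (simp add: measurable_cong_sets[OF sets_\<mu> refl])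

lemma coordinate_measurable: "(\<lambda>x. (snd x) (fst x)) \<in> borel_measurable (\<mu> \<Otimes>\<^sub>M \<Omega>)"
proof -
  have "(\<lambda>x. (snd x) (fst x)) \<in> borel_measurable (restrict_space borel {0..T} \<Otimes>\<^sub>M \<Omega>)"
    using \<Omega> by (simp add: path_space_def case_prod_beta')
  then show ?thesis by (simp add: measurable_cong_sets[OF sets_pair_measure_cong[OF sets_\<mu> refl] refl])
qed

lemma sets_\<mu>_joint: "sets (\<mu> \<Otimes>\<^sub>M joint) = sets (\<mu> \<Otimes>\<^sub>M (\<Omega> \<Otimes>\<^sub>M \<Omega>))"
  by (rule sets_pair_measure_cong[OF refl sets_joint])

lemma estimator_measurable:
  assumes "\<eta> \<in> estimators \<mu> \<Omega>"
  shows "(\<lambda>x. \<eta> (fst x) (snd (snd x))) \<in> borel_measurable (\<mu> \<Otimes>\<^sub>M joint)"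
    and "t \<in> {0..T} \<Longrightarrow> \<eta> t \<in> borel_measurable \<Omega>"
proof -
  have m: "(\<lambda>x. \<eta> (fst x) (snd x)) \<in> borel_measurable (\<mu> \<Otimes>\<^sub>M \<Omega>)"
    using assms by (simp add: estimators_def case_prod_beta')
  have "(\<lambda>x. (fst x, snd (snd x))) \<in> measurable (\<mu> \<Otimes>\<^sub>M (\<Omega> \<Otimes>\<^sub>M \<Omega>)) (\<mu> \<Otimes>\<^sub>M \<Omega>)" by measurable
  from measurable_compose[OF this m] show "(\<lambda>x. \<eta> (fst x) (snd (snd x))) \<in> borel_measurable (\<mu> \<Otimes>\<^sub>M joint)"
    by (simp add: measurable_cong_sets[OF sets_\<mu>_joint refl])
  show "\<eta> t \<in> borel_measurable \<Omega>" if "t \<in> {0..T}"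
  proof -
    have "Pair t \<in> measurable \<Omega> (\<mu> \<Otimes>\<^sub>M \<Omega>)" using that by (intro measurable_Pair1') (simp add: space_\<mu>)
    from measurable_compose[OF this m] show ?thesis by simp
  qed
qed

lemma target_measurable: "(\<lambda>x. (fst (snd x)) (fst x)) \<in> borel_measurable (\<mu> \<Otimes>\<^sub>M joint)"
proof -
  have "(\<lambda>x. (fst x, fst (snd x))) \<in> measurable (\<mu> \<Otimes>\<^sub>M (\<Omega> \<Otimes>\<^sub>M \<Omega>)) (\<mu> \<Otimes>\<^sub>M \<Omega>)" by measurable
  from measurable_compose[OF this coordinate_measurable] show ?thesis
    by (simp add: measurable_cong_sets[OF sets_\<mu>_joint refl])
qed

lemma pair_sf: "pair_sigma_finite \<mu> joint"
proof -
  interpret m: finite_measure \<mu> by (rule fin_\<mu>)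
  interpret j: prob_space joint by (rule prob_joint)
  show ?thesis by unfold_locales
qed

lemma bayes_risk_joint:
  assumes "\<eta> \<in> estimators \<mu> \<Omega>"
  shows "bayes_risk \<mu> Q P \<eta> = (\<integral>\<^sup>+t. (\<integral>\<^sup>+x. ennreal ((\<eta> t (snd x) - fst x t)\<^sup>2) \<partial>joint) \<partial>\<mu>)"
proof -
  interpret pair_sigma_finite \<mu> joint by (rule pair_sf)
  have m: "(\<lambda>x. ennreal ((\<eta> (fst x) (snd (snd x)) - (fst (snd x)) (fst x))\<^sup>2)) \<in> borel_measurable (\<mu> \<Otimes>\<^sub>M joint)"
    using estimator_measurable(1)[OF assms] target_measurable by measurable
  have m2: "(\<lambda>x. \<integral>\<^sup>+t. ennreal ((\<eta> t (snd x) - fst x t)\<^sup>2) \<partial>\<mu>) \<in> borel_measurable joint"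
    using M1.borel_measurable_nn_integral_fst[OF measurable_pair_swap[OF m]] by simp
  have "bayes_risk \<mu> Q P \<eta> = (\<integral>\<^sup>+x. (\<integral>\<^sup>+t. ennreal ((\<eta> t (snd x) - fst x t)\<^sup>2) \<partial>\<mu>) \<partial>joint)"
    unfolding bayes_risk_def using nn_integral_joint[OF m2] by simp
  also have "\<dots> = (\<integral>\<^sup>+t. (\<integral>\<^sup>+x. ennreal ((\<eta> t (snd x) - fst x t)\<^sup>2) \<partial>joint) \<partial>\<mu>)"
    using Fubini[OF m] by simp
  finally show ?thesis .
qed

text \<open>
  Integrating the Pythagorean identity over \<open>\<mu>\<close> splits the risk of any \<open>\<eta>\<close> into the squared distance to \<open>\<xi>\<close>
  and the integral of \<open>r t = \<langle>\<chi>\<^sub>t, \<Gamma> f\<^sub>t\<rangle>\<close>. The latter is finite, since \<open>r t \<le> \<langle>\<chi>\<^sub>t, \<Gamma>\<tau> \<chi>\<^sub>t\<rangle>\<close>, the prior variance, so it can be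
  cancelled: an estimator with the same risk has distance 0 from \<open>\<xi>\<close>.
\<close>

lemma drift_plus_X_optimal:
  assumes \<xi>: "is_drift_plus_X T \<mu> \<Omega> Q P d f \<xi>" and d: "\<And>t. t \<in> {0..T} \<Longrightarrow> d t = drift t"
  shows "unique_minimizer \<mu> \<Omega> Q P \<xi>"
    "bayes_risk \<mu> Q P \<xi> = ennreal (LINT t|\<mu>. cm_inner T (chi T t) (\<Gamma> (f t)))"
    "bayes_risk \<mu> Q P \<xi> = (INF \<eta>\<in>estimators \<mu> \<Omega>. bayes_risk \<mu> Q P \<eta>)"
proof -
  interpret pair_sigma_finite \<mu> joint by (rule pair_sf)
  interpret m: finite_measure \<mu> by (rule fin_\<mu>)
  have est: "\<xi> \<in> estimators \<mu> \<Omega>" using \<xi> by (simp add: is_drift_plus_X_def)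
  define r where "r t = cm_inner T (chi T t) (\<Gamma> (f t))" for t
  have pyth: "(\<integral>\<^sup>+x. ennreal ((\<eta> t (snd x) - fst x t)\<^sup>2) \<partial>joint) =
      (\<integral>\<^sup>+x. ennreal ((\<eta> t (snd x) - \<xi> t (snd x))\<^sup>2) \<partial>joint) + ennreal (r t)"
    if \<eta>: "\<eta> \<in> estimators \<mu> \<Omega>" and t: "t \<in> {0..T}" for \<eta> t
  proof -
    have X: "is_X_of T \<Omega> Q P (f t) (\<lambda>\<omega>. \<xi> t \<omega> - d t)" using \<xi> t by (simp add: is_drift_plus_X_def del: atLeastAtMost_iff)
    show ?thesis
      using pythagoras[OF t f_mem[OF t] f_eq[OF t] X estimator_measurable(2)[OF \<eta> t]] d[OF t]
      by (simp add: r_def drift_def)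
  qed
  have r0: "0 \<le> r t" if t: "t \<in> {0..T}" for t
  proof -
    have X: "is_X_of T \<Omega> Q P (f t) (\<lambda>\<omega>. \<xi> t \<omega> - d t)" using \<xi> t by (simp add: is_drift_plus_X_def del: atLeastAtMost_iff)
    show ?thesis unfolding r_def posterior_error(2)[OF t f_mem[OF t] f_eq[OF t] X, symmetric] by simp
  qed
  obtain C where C: "0 < C" "\<And>h. h \<in> cm_space T \<Longrightarrow> nrm (\<Gamma>\<tau> h) \<le> C * nrm h"
    using hellinger_toeplitz[OF \<Gamma>_sym(2)] by blast
  have rC: "r t \<le> C * T" if t: "t \<in> {0..T}" for t
  proof -
    note fm = f_mem[OF t] and ch = chi_mem[OF t]
    have Gm: "\<Gamma> (f t) \<in> cm_space T" "\<Gamma>\<tau> (f t) \<in> cm_space T" "\<Gamma>\<tau> (chi T t) \<in> cm_space T"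
      using sym_op_mem[OF \<Gamma>_sym(1) fm] sym_op_mem[OF \<Gamma>_sym(2) fm] sym_op_mem[OF \<Gamma>_sym(2) ch] .
    have "cm_inner T (chi T t) (\<Gamma>\<tau> (chi T t)) = cm_inner T (chi T t) (\<Gamma>\<tau> (f t)) + r t"
      unfolding f_eq[OF t, symmetric] A_apply ip_add_right[OF Gm(2,1) ch] r_def ..
    moreover have "0 \<le> cm_inner T (chi T t) (\<Gamma>\<tau> (f t))"
    proof -
      have "cm_inner T (chi T t) (\<Gamma>\<tau> (f t)) = cm_inner T (f t) (A (f t))"
        unfolding f_eq[OF t] using sym_op_ip[OF \<Gamma>_sym(2) ch fm] cm_inner_commute by metis
      also have "\<dots> = cm_inner T (f t) (\<Gamma>\<tau> (f t)) + cm_inner T (f t) (\<Gamma> (f t))"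
        unfolding A_apply by (rule ip_add_right[OF Gm(2,1) fm])
      finally show ?thesis using \<Gamma>_nonneg[OF fm] by simp
    qed
    moreover have "cm_inner T (chi T t) (\<Gamma>\<tau> (chi T t)) \<le> C * T"
    proof -
      have n2: "nrm (chi T t) * nrm (chi T t) = t"
        using nrm_sq[OF ch] ip_chi[OF ch t] t by (simp add: power2_eq_square chi_def)
      have "cm_inner T (chi T t) (\<Gamma>\<tau> (chi T t)) \<le> nrm (chi T t) * nrm (\<Gamma>\<tau> (chi T t))"
        using cauchy_schwarz[OF ch Gm(3)] by simp
      also have "\<dots> \<le> nrm (chi T t) * (C * nrm (chi T t))"
        by (intro mult_left_mono C(2)[OF ch] nrm_nonneg[OF ch])
      also have "\<dots> = C * t" using n2 by simp
      also have "\<dots> \<le> C * T" using C t by simp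
      finally show ?thesis .
    qed
    ultimately show ?thesis by simp
  qed
  have dm: "(\<lambda>x. ennreal ((\<eta> (fst x) (snd (snd x)) - \<xi> (fst x) (snd (snd x)))\<^sup>2)) \<in> borel_measurable (\<mu> \<Otimes>\<^sub>M joint)"
    if "\<eta> \<in> estimators \<mu> \<Omega>" for \<eta>
    using estimator_measurable(1)[OF that] estimator_measurable(1)[OF est] by measurable
  have dm1: "(\<lambda>t. \<integral>\<^sup>+x. ennreal ((\<eta> t (snd x) - \<xi> t (snd x))\<^sup>2) \<partial>joint) \<in> borel_measurable \<mu>"
    if "\<eta> \<in> estimators \<mu> \<Omega>" for \<eta>
    using M2.borel_measurable_nn_integral_fst[OF dm[OF that]] by simp
  have rm: "(\<lambda>t. ennreal (r t)) \<in> borel_measurable \<mu>"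
  proof -
    have "(\<lambda>x. ennreal ((\<xi> (fst x) (snd (snd x)) - (fst (snd x)) (fst x))\<^sup>2)) \<in> borel_measurable (\<mu> \<Otimes>\<^sub>M joint)"
      using estimator_measurable(1)[OF est] target_measurable by measurable
    from M2.borel_measurable_nn_integral_fst[OF this]
    have "(\<lambda>t. \<integral>\<^sup>+x. ennreal ((\<xi> t (snd x) - fst x t)\<^sup>2) \<partial>joint) \<in> borel_measurable \<mu>" by simp
    also have "?this \<longleftrightarrow> ?thesis" by (rule measurable_cong) (simp add: pyth[OF est] space_\<mu> del: atLeastAtMost_iff)
    finally show ?thesis .
  qed
  have rint: "integrable \<mu> r"
  proof (rule m.integrable_const_bound[of _ "C * T"])
    have "(\<lambda>t. enn2real (ennreal (r t))) \<in> borel_measurable \<mu>" using rm by measurable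
    also have "?this \<longleftrightarrow> r \<in> borel_measurable \<mu>" by (rule measurable_cong) (simp add: r0 space_\<mu> del: atLeastAtMost_iff)
    finally show "r \<in> borel_measurable \<mu>" .
    show "AE t in \<mu>. norm (r t) \<le> C * T"
      using r0 rC by (intro AE_I2) (simp add: space_\<mu> del: atLeastAtMost_iff)
  qed
  have rval: "(\<integral>\<^sup>+t. ennreal (r t) \<partial>\<mu>) = ennreal (\<integral>t. r t \<partial>\<mu>)"
    using rint r0 by (intro nn_integral_eq_integral AE_I2) (simp_all add: space_\<mu> del: atLeastAtMost_iff)
  have risk: "bayes_risk \<mu> Q P \<eta> = (\<integral>\<^sup>+t. (\<integral>\<^sup>+x. ennreal ((\<eta> t (snd x) - \<xi> t (snd x))\<^sup>2) \<partial>joint) \<partial>\<mu>) + ennreal (\<integral>t. r t \<partial>\<mu>)"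
    if \<eta>: "\<eta> \<in> estimators \<mu> \<Omega>" for \<eta>
  proof -
    have "bayes_risk \<mu> Q P \<eta> =
        (\<integral>\<^sup>+t. (\<integral>\<^sup>+x. ennreal ((\<eta> t (snd x) - \<xi> t (snd x))\<^sup>2) \<partial>joint) + ennreal (r t) \<partial>\<mu>)"
      unfolding bayes_risk_joint[OF \<eta>]
      by (rule nn_integral_cong) (simp add: pyth[OF \<eta>] space_\<mu> del: atLeastAtMost_iff)
    also have "\<dots> = (\<integral>\<^sup>+t. (\<integral>\<^sup>+x. ennreal ((\<eta> t (snd x) - \<xi> t (snd x))\<^sup>2) \<partial>joint) \<partial>\<mu>) + (\<integral>\<^sup>+t. ennreal (r t) \<partial>\<mu>)"
      by (rule nn_integral_add[OF dm1[OF \<eta>] rm])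
    finally show ?thesis unfolding rval .
  qed
  have risk\<xi>: "bayes_risk \<mu> Q P \<xi> = ennreal (\<integral>t. r t \<partial>\<mu>)" using risk[OF est] by simp
  then show "bayes_risk \<mu> Q P \<xi> = ennreal (LINT t|\<mu>. cm_inner T (chi T t) (\<Gamma> (f t)))" by (simp add: r_def)
  have min: "bayes_risk \<mu> Q P \<xi> \<le> bayes_risk \<mu> Q P \<eta>" if "\<eta> \<in> estimators \<mu> \<Omega>" for \<eta>
    unfolding risk\<xi> risk[OF that] by simp
  show "bayes_risk \<mu> Q P \<xi> = (INF \<eta>\<in>estimators \<mu> \<Omega>. bayes_risk \<mu> Q P \<eta>)"
  proof (rule antisym)
    show "bayes_risk \<mu> Q P \<xi> \<le> (INF \<eta>\<in>estimators \<mu> \<Omega>. bayes_risk \<mu> Q P \<eta>)" by (rule INF_greatest) (rule min)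
    show "(INF \<eta>\<in>estimators \<mu> \<Omega>. bayes_risk \<mu> Q P \<eta>) \<le> bayes_risk \<mu> Q P \<xi>" by (rule INF_lower[OF est])
  qed
  show "unique_minimizer \<mu> \<Omega> Q P \<xi>"
    unfolding unique_minimizer_def
  proof (intro conjI ballI impI est)
    show "bayes_risk \<mu> Q P \<xi> \<le> bayes_risk \<mu> Q P \<eta>" if "\<eta> \<in> estimators \<mu> \<Omega>" for \<eta> by (rule min[OF that])
    fix \<eta> assume \<eta>: "\<eta> \<in> estimators \<mu> \<Omega>" and le: "bayes_risk \<mu> Q P \<eta> \<le> bayes_risk \<mu> Q P \<xi>"
    define g where "g \<omega> = (\<integral>\<^sup>+t. ennreal ((\<eta> t \<omega> - \<xi> t \<omega>)\<^sup>2) \<partial>\<mu>)" for \<omega>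
    have em: "(\<lambda>x. \<eta> (fst x) (snd x)) \<in> borel_measurable (\<mu> \<Otimes>\<^sub>M \<Omega>)" "(\<lambda>x. \<xi> (fst x) (snd x)) \<in> borel_measurable (\<mu> \<Otimes>\<^sub>M \<Omega>)"
      using \<eta> est by (simp_all add: estimators_def case_prod_beta')
    have swap: "(\<lambda>x. (snd x, fst x)) \<in> measurable (\<Omega> \<Otimes>\<^sub>M \<mu>) (\<mu> \<Otimes>\<^sub>M \<Omega>)" by measurable
    have em': "(\<lambda>x. \<eta> (snd x) (fst x)) \<in> borel_measurable (\<Omega> \<Otimes>\<^sub>M \<mu>)" "(\<lambda>x. \<xi> (snd x) (fst x)) \<in> borel_measurable (\<Omega> \<Otimes>\<^sub>M \<mu>)"
      using measurable_compose[OF swap em(1)] measurable_compose[OF swap em(2)] by simp_all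
    have sq: "(\<lambda>x. ennreal ((\<eta> (snd x) (fst x) - \<xi> (snd x) (fst x))\<^sup>2)) \<in> borel_measurable (\<Omega> \<Otimes>\<^sub>M \<mu>)"
      using em' by measurable
    have gm: "g \<in> borel_measurable \<Omega>"
      using M1.borel_measurable_nn_integral_fst[OF sq] by (simp add: g_def[abs_def])
    have "(\<integral>\<^sup>+x. g (snd x) \<partial>joint) = (\<integral>\<^sup>+t. (\<integral>\<^sup>+x. ennreal ((\<eta> t (snd x) - \<xi> t (snd x))\<^sup>2) \<partial>joint) \<partial>\<mu>)"
      unfolding g_def using Fubini[OF dm[OF \<eta>]] by simp
    also have "\<dots> = 0"
    proof -
      have "ennreal (\<integral>t. r t \<partial>\<mu>) + (\<integral>\<^sup>+t. (\<integral>\<^sup>+x. ennreal ((\<eta> t (snd x) - \<xi> t (snd x))\<^sup>2) \<partial>joint) \<partial>\<mu>) \<le>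
          ennreal (\<integral>t. r t \<partial>\<mu>) + 0"
        using le unfolding risk[OF \<eta>] risk\<xi> by (simp add: add.commute)
      then show ?thesis by (subst (asm) ennreal_add_left_cancel_le) auto
    qed
    finally have "(\<integral>\<^sup>+z. (\<integral>\<^sup>+\<omega>. g \<omega> \<partial>P z) \<partial>Q) = 0"
      using nn_integral_joint[OF snd_joint[OF gm]] by simp
    moreover have "(\<lambda>z. \<integral>\<^sup>+\<omega>. g \<omega> \<partial>P z) \<in> borel_measurable Q"
      using measurable_compose[OF P_kernel nn_integral_measurable_subprob_algebra[OF gm]]
      by (simp add: measurable_cong_sets[OF sets_Q refl])
    ultimately have AE_z: "AE z in Q. (\<integral>\<^sup>+\<omega>. g \<omega> \<partial>P z) = 0" by (simp add: nn_integral_0_iff_AE)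
    show "AE z in Q. AE \<omega> in P z. AE t in \<mu>. \<eta> t \<omega> = \<xi> t \<omega>"
    proof (rule AE_mp[OF AE_z], rule AE_I2, rule impI)
      fix z assume "z \<in> space Q" and 0: "(\<integral>\<^sup>+\<omega>. g \<omega> \<partial>P z) = 0"
      then have z: "z \<in> space \<Omega>" by (simp add: space_Q)
      have "g \<in> borel_measurable (P z)" using gm by (simp add: measurable_cong_sets[OF sets_P[OF z] refl])
      with 0 have AE_\<omega>: "AE \<omega> in P z. g \<omega> = 0" by (simp add: nn_integral_0_iff_AE)
      show "AE \<omega> in P z. AE t in \<mu>. \<eta> t \<omega> = \<xi> t \<omega>"
      proof (rule AE_mp[OF AE_\<omega>], rule AE_I2, rule impI)
        fix \<omega> assume "\<omega> \<in> space (P z)" and g0: "g \<omega> = 0"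
        then have \<omega>: "\<omega> \<in> space \<Omega>" by (simp add: space_P[OF z])
        have "(\<lambda>t. ennreal ((\<eta> t \<omega> - \<xi> t \<omega>)\<^sup>2)) \<in> borel_measurable \<mu>"
          using measurable_compose[OF measurable_Pair1'[OF \<omega>] sq] by simp
        with g0 have "AE t in \<mu>. ennreal ((\<eta> t \<omega> - \<xi> t \<omega>)\<^sup>2) = 0" by (simp add: g_def nn_integral_0_iff_AE)
        then show "AE t in \<mu>. \<eta> t \<omega> = \<xi> t \<omega>" by eventually_elim simp
      qed
    qed
  qed
qed

section \<open>A jointly measurable version of the estimator\<close>

lemma range_dense:
  obtains \<kappa> where "\<And>x. x \<in> cm_space T \<Longrightarrow> tends (\<lambda>n. A (landweber A \<kappa> n x)) x"
  using landweber_tends[OF A_sym A_inj] by blast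

text \<open>
  The inverse of \<open>A\<close> is not bounded, so continuity of \<open>t \<mapsto> \<Gamma>\<tau> \<chi>\<^sub>t\<close> does not carry over to \<open>f\<close>. But with \<open>A (y n)\<close>
  tending to \<open>\<chi>\<^sub>s\<close>, the value \<open>f\<^sub>t(s) = \<langle>\<chi>\<^sub>s, f\<^sub>t\<rangle>\<close> is the limit of \<open>\<langle>A (y n), f\<^sub>t\<rangle> = \<langle>y n, \<Gamma>\<tau> \<chi>\<^sub>t\<rangle> = (\<Gamma>\<tau> (y n))(t)\<close>, and these
  are Cameron-Martin functions of \<open>t\<close>.
\<close>

lemma f_measurable:
  assumes s: "s \<in> {0..T}"
  shows "(\<lambda>t. f t s) \<in> borel_measurable \<mu>"
proof -
  obtain \<kappa> where \<kappa>: "\<And>x. x \<in> cm_space T \<Longrightarrow> tends (\<lambda>n. A (landweber A \<kappa> n x)) x"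
    using range_dense by blast
  define y where "y n = landweber A \<kappa> n (chi T s)" for n
  have ch: "chi T s \<in> cm_space T" by (rule chi_mem[OF s])
  have ym: "y n \<in> cm_space T" for n unfolding y_def by (rule landweber_mem[OF A_sym ch])
  have Gy: "\<Gamma>\<tau> (y n) \<in> cm_space T" for n by (rule sym_op_mem[OF \<Gamma>_sym(2) ym])
  have Ay: "A (y n) \<in> cm_space T" for n by (rule sym_op_mem[OF A_sym ym])
  have ty: "tends (\<lambda>n. A (y n)) (chi T s)" unfolding y_def by (rule \<kappa>[OF ch])
  show ?thesis
  proof (rule borel_measurable_LIMSEQ_real)
    show "\<Gamma>\<tau> (y n) \<in> borel_measurable \<mu>" for n by (rule cm_borel_\<mu>[OF Gy])
    fix t assume "t \<in> space \<mu>"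
    then have t: "t \<in> {0..T}" by (simp add: space_\<mu>)
    have "\<Gamma>\<tau> (y n) t = cm_inner T (A (y n)) (f t)" for n
    proof -
      have "\<Gamma>\<tau> (y n) t = cm_inner T (\<Gamma>\<tau> (y n)) (chi T t)" by (rule ip_chi[OF Gy t, symmetric])
      also have "\<dots> = cm_inner T (y n) (A (f t))"
        unfolding f_eq[OF t] by (rule sym_op_ip[OF \<Gamma>_sym(2) ym chi_mem[OF t]])
      also have "\<dots> = cm_inner T (A (y n)) (f t)" by (rule sym_op_ip[OF A_sym ym f_mem[OF t], symmetric])
      finally show ?thesis .
    qed
    moreover have "(\<lambda>n. cm_inner T (A (y n)) (f t)) \<longlonglongrightarrow> cm_inner T (chi T s) (f t)"
      by (rule tends_ip[OF Ay ch ty f_mem[OF t]])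
    ultimately show "(\<lambda>n. \<Gamma>\<tau> (y n) t) \<longlonglongrightarrow> f t s" by (simp add: ip_chi_left[OF f_mem[OF t] s])
  qed
qed

lemma f_grid_measurable: "i \<le> 2 ^ n \<Longrightarrow> (\<lambda>t. f t (grid n i)) \<in> borel_measurable \<mu>"
  by (rule f_measurable[OF grid_mem])

lemma drift_measurable: "drift \<in> borel_measurable \<mu>"
proof -
  have "(\<lambda>t. cm_inner T (f t) v) \<in> borel_measurable \<mu>"
  proof (rule borel_measurable_LIMSEQ_real)
    show "(\<lambda>t. path_comb (interp n (f t)) v) \<in> borel_measurable \<mu>" for n
      unfolding path_comb_interp
      by (intro borel_measurable_sum borel_measurable_times borel_measurable_divide borel_measurable_diff
          f_grid_measurable borel_measurable_const) auto
    fix t assume "t \<in> space \<mu>"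
    then have t: "t \<in> {0..T}" by (simp add: space_\<mu>)
    have "cm_inner T (pw_lin n (f t)) v = path_comb (interp n (f t)) v" for n
      by (subst cm_inner_commute) (rule ip_chi_comb[OF v times_in_interp])
    then show "(\<lambda>n. path_comb (interp n (f t)) v) \<longlonglongrightarrow> cm_inner T (f t) v"
      using tends_ip[OF pw_lin_mem f_mem[OF t] pw_lin_tends[OF f_mem[OF t]] v] by simp
  qed
  then show ?thesis unfolding drift_def[abs_def] using cm_borel_\<mu>[OF v] by measurable
qed

text \<open>
  The squared distance of \<open>f\<^sub>t\<close> from its \<open>n\<close>-th polygon, written so that it is visibly measurable in \<open>t\<close>.
\<close>

definition err :: "nat \<Rightarrow> real \<Rightarrow> real" where
  "err n t = cm_inner T (f t) (f t) - path_comb (interp n (f t)) (f t)"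

lemma err_eq:
  assumes t: "t \<in> {0..T}"
  shows "err n t = cm_inner T (\<lambda>s. f t s - pw_lin n (f t) s) (\<lambda>s. f t s - pw_lin n (f t) s)"
  unfolding pw_lin_dist_self[OF f_mem[OF t]] err_def pw_lin_ip_self[OF f_mem[OF t], symmetric]
    ip_chi_comb[OF f_mem[OF t] times_in_interp] ..

lemma err_tendsto:
  assumes t: "t \<in> {0..T}"
  shows "(\<lambda>n. err n t) \<longlonglongrightarrow> 0"
proof -
  have "tends (\<lambda>n. pw_lin n (f t)) (f t)" by (rule pw_lin_tends[OF f_mem[OF t]])
  from tendsto_power[OF this[unfolded tends_def], of 2]
  have "(\<lambda>n. (nrm (\<lambda>s. pw_lin n (f t) s - f t s))\<^sup>2) \<longlonglongrightarrow> 0" by simp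
  moreover have "(nrm (\<lambda>s. pw_lin n (f t) s - f t s))\<^sup>2 = err n t" for n
    unfolding nrm_diff_commute[OF pw_lin_mem f_mem[OF t]] err_eq[OF t]
    by (rule nrm_sq[OF diff_mem[OF f_mem[OF t] pw_lin_mem]])
  ultimately show ?thesis by simp
qed

lemma err_measurable: "err n \<in> borel_measurable \<mu>"
proof -
  have N: "(\<lambda>t. path_comb (interp n (f t)) (f t)) \<in> borel_measurable \<mu>" for n
    unfolding path_comb_interp
    by (intro borel_measurable_sum borel_measurable_times borel_measurable_divide borel_measurable_diff
        f_grid_measurable borel_measurable_const) auto
  have "(\<lambda>t. cm_inner T (f t) (f t)) \<in> borel_measurable \<mu>"
  proof (rule borel_measurable_LIMSEQ_real[OF _ N])
    fix t assume "t \<in> space \<mu>"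
    then have t: "t \<in> {0..T}" by (simp add: space_\<mu>)
    from tendsto_diff[OF tendsto_const[of "cm_inner T (f t) (f t)"] err_tendsto[OF t]]
    show "(\<lambda>n. path_comb (interp n (f t)) (f t)) \<longlonglongrightarrow> cm_inner T (f t) (f t)" by (simp add: err_def)
  qed
  then show ?thesis unfolding err_def[abs_def] using N by measurable
qed

text \<open>
  The grid has to be chosen for each \<open>t\<close> separately, as the polygons need not converge to \<open>f\<^sub>t\<close> at a rate
  uniform in \<open>t\<close>. A geometric rate is what makes \<open>X\<close> of the approximations converge almost surely.
\<close>

definition idx :: "nat \<Rightarrow> real \<Rightarrow> nat" where "idx k t = (LEAST n. err n t \<le> (1/4) ^ k)"

lemma err_idx:
  assumes t: "t \<in> {0..T}"
  shows "err (idx k t) t \<le> (1/4) ^ k"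
proof -
  have "\<forall>\<^sub>F n in sequentially. err n t < (1/4) ^ k"
    by (rule order_tendstoD(2)[OF err_tendsto[OF t]]) simp
  then obtain n where "err n t < (1/4) ^ k" by (auto simp: eventually_sequentially)
  then have "err n t \<le> (1/4) ^ k" by simp
  then show ?thesis unfolding idx_def by (rule LeastI)
qed

lemma idx_measurable: "idx k \<in> measurable \<mu> (count_space UNIV)"
  unfolding idx_def[abs_def]
proof (rule measurable_Least)
  show "Measurable.pred \<mu> (\<lambda>t. err n t \<le> (1/4) ^ k)" for n using err_measurable[of n] by measurable
qed

definition approx :: "nat \<Rightarrow> real \<Rightarrow> (real \<times> real) list" where "approx k t = interp (idx k t) (f t)"

lemma approx_times: "times_in T (approx k t)"
  by (simp add: approx_def times_in_interp)

lemma approx_measurable: "(\<lambda>x. path_comb (approx k (fst x)) (snd x)) \<in> borel_measurable (\<mu> \<Otimes>\<^sub>M \<Omega>)"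
proof -
  have 1: "(\<lambda>x. path_comb (interp n (f (fst x))) (snd x)) \<in> borel_measurable (\<mu> \<Otimes>\<^sub>M \<Omega>)" for n
  proof -
    have a: "(\<lambda>x. f (fst x) (grid n i)) \<in> borel_measurable (\<mu> \<Otimes>\<^sub>M \<Omega>)" if "i \<le> 2 ^ n" for i
      by (rule measurable_compose[OF measurable_fst f_grid_measurable[OF that]])
    have b: "(\<lambda>x. snd x (grid n i)) \<in> borel_measurable (\<mu> \<Otimes>\<^sub>M \<Omega>)" if "i \<le> 2 ^ n" for i
    proof -
      have "(\<lambda>\<omega>. path_comb [(1, grid n i)] \<omega>) \<in> borel_measurable \<Omega>"
        by (rule path_comb_m) (use grid_mem[OF that] in simp)
      then have "(\<lambda>\<omega>. \<omega> (grid n i)) \<in> borel_measurable \<Omega>" by simp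
      from measurable_compose[OF measurable_snd this] show ?thesis .
    qed
    show ?thesis
      unfolding path_comb_interp
      by (intro borel_measurable_sum borel_measurable_times borel_measurable_divide borel_measurable_diff
          a b borel_measurable_const) auto
  qed
  show ?thesis
    unfolding approx_def
    by (rule measurable_compose_countable[OF 1 measurable_compose[OF measurable_fst idx_measurable]])
qed

lemma approx_dist:
  assumes t: "t \<in> {0..T}"
  shows "nrm (\<lambda>s. f t s - chi_comb T (approx k t) s) \<le> (1/2) ^ k"
proof -
  have "nrm (\<lambda>s. f t s - chi_comb T (approx k t) s) = sqrt (err (idx k t) t)"
    unfolding nrm_def approx_def err_eq[OF t] ..
  also have "\<dots> \<le> sqrt ((1/4) ^ k)" by (rule real_sqrt_le_mono[OF err_idx[OF t]])
  also have "\<dots> = (1/2) ^ k"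
  proof -
    have "(1/4 :: real) ^ k = ((1/2) ^ k)\<^sup>2" by (simp add: power_mult_distrib power2_eq_square flip: power_mult_distrib)
    then show ?thesis by simp
  qed
  finally show ?thesis .
qed

text \<open>
  By boundedness of \<open>A\<close>, the map \<open>e \<mapsto> X(e)\<close> is bounded from the Cameron-Martin norm to \<open>L\<^sup>2\<close> of the joint law,
  uniformly over the span of the \<open>\<chi>\<^sub>t\<close>. Without this \<open>X(f)\<close> would not exist for general \<open>f\<close>.
\<close>

lemma observation_second_moment:
  obtains B where "0 \<le> B" "\<And>e. times_in T e \<Longrightarrow>
    (\<integral>\<^sup>+x. ennreal ((path_comb e (snd x))\<^sup>2) \<partial>joint) \<le> ennreal (B * (nrm (chi_comb T e))\<^sup>2)"
proof -
  interpret J: prob_space joint by (rule prob_joint)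
  obtain C where C: "0 < C" "\<And>h. h \<in> cm_space T \<Longrightarrow> nrm (A h) \<le> C * nrm h"
    using hellinger_toeplitz[OF A_sym] by blast
  have "(\<integral>\<^sup>+x. ennreal ((path_comb e (snd x))\<^sup>2) \<partial>joint) \<le> ennreal ((2 * C + 2 * (nrm v)\<^sup>2) * (nrm (chi_comb T e))\<^sup>2)"
    if e: "times_in T e" for e
  proof -
    define x where "x = chi_comb T e"
    have x: "x \<in> cm_space T" unfolding x_def by (rule chi_comb_mem[OF e])
    have ab: "times_in T []" by simp
    note cm = centred_moments[OF ab e]
    have ci: "integrable joint (\<lambda>w. (centred [] e w)\<^sup>2)" using cm(1) by (simp add: square_integrable_def)
    have "square_integrable joint (\<lambda>_. path_comb e v)" by (simp add: square_integrable_def)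
    from square_integrable_add[OF cm(1) this]
    have si: "square_integrable joint (\<lambda>w. path_comb e (snd w))" by (simp add: centred_def)
    have Gm: "\<Gamma>\<tau> x \<in> cm_space T" "\<Gamma> x \<in> cm_space T"
      using sym_op_mem[OF \<Gamma>_sym(2) x] sym_op_mem[OF \<Gamma>_sym(1) x] .
    have var: "(\<integral>w. (centred [] e w)\<^sup>2 \<partial>joint) = cm_inner T x (A x)"
      unfolding cm(2) A_apply ip_add_right[OF Gm x] by (simp add: x_def)
    have "(\<integral>w. (path_comb e (snd w))\<^sup>2 \<partial>joint) \<le> (\<integral>w. 2 * (centred [] e w)\<^sup>2 + 2 * (path_comb e v)\<^sup>2 \<partial>joint)"
    proof (rule integral_mono)
      show "integrable joint (\<lambda>w. (path_comb e (snd w))\<^sup>2)" using si by (simp add: square_integrable_def)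
      show "integrable joint (\<lambda>w. 2 * (centred [] e w)\<^sup>2 + 2 * (path_comb e v)\<^sup>2)" using ci by simp
      fix w :: "(real \<Rightarrow> real) \<times> (real \<Rightarrow> real)"
      have "path_comb e (snd w) = centred [] e w + path_comb e v" by (simp add: centred_def)
      then show "(path_comb e (snd w))\<^sup>2 \<le> 2 * (centred [] e w)\<^sup>2 + 2 * (path_comb e v)\<^sup>2"
        using sum_squares_bound[of "centred [] e w" "path_comb e v"] by (simp add: power2_sum)
    qed
    also have "\<dots> = 2 * cm_inner T x (A x) + 2 * (path_comb e v)\<^sup>2" using ci by (simp add: J.prob_space var)
    also have "\<dots> \<le> 2 * (C * (nrm x)\<^sup>2) + 2 * ((nrm v)\<^sup>2 * (nrm x)\<^sup>2)"
    proof -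
      have "cm_inner T x (A x) \<le> nrm x * nrm (A x)" using cauchy_schwarz[OF x sym_op_mem[OF A_sym x]] by simp
      also have "\<dots> \<le> nrm x * (C * nrm x)" by (intro mult_left_mono C(2)[OF x] nrm_nonneg[OF x])
      finally have 1: "cm_inner T x (A x) \<le> C * (nrm x)\<^sup>2" by (simp add: power2_eq_square mult_ac)
      have "\<bar>path_comb e v\<bar> \<le> \<bar>nrm v * nrm x\<bar>"
        using cauchy_schwarz[OF v x] ip_chi_comb[OF v e] by (simp add: x_def)
      then have "(path_comb e v)\<^sup>2 \<le> (nrm v * nrm x)\<^sup>2" by (rule abs_le_square_iff[THEN iffD1])
      then show ?thesis using 1 by (simp add: power_mult_distrib)
    qed
    also have "\<dots> = (2 * C + 2 * (nrm v)\<^sup>2) * (nrm x)\<^sup>2" by (simp add: algebra_simps)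
    finally show ?thesis unfolding square_integrable_nn[OF si] x_def by (rule ennreal_leI)
  qed
  moreover have "0 \<le> 2 * C + 2 * (nrm v)\<^sup>2" using C(1) by simp
  ultimately show thesis using that by blast
qed

text \<open>
  A version has to be chosen for every \<open>t\<close> at once such that the result is measurable in \<open>(t, \<omega>)\<close>. The
  limit along \<open>approx k t\<close> does this: each term is measurable in \<open>(t, \<omega>)\<close>, and for each \<open>t\<close> the limit exists
  almost surely and in \<open>L\<^sup>2\<close>.
\<close>

lemma drift_plus_X_exists:
  obtains \<xi> where "is_drift_plus_X T \<mu> \<Omega> Q P drift f \<xi>"
proof -
  define Z where "Z k t \<omega> = path_comb (approx k t) \<omega>" for k t \<omega>
  define \<xi> where "\<xi> t \<omega> = lim (\<lambda>k. Z k t \<omega>) + drift t" for t \<omega>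
  have Zm: "(\<lambda>x. Z k (fst x) (snd x)) \<in> borel_measurable (\<mu> \<Otimes>\<^sub>M \<Omega>)" for k
    unfolding Z_def by (rule approx_measurable)
  have Ym: "(\<lambda>x. lim (\<lambda>k. Z k (fst x) (snd x))) \<in> borel_measurable (\<mu> \<Otimes>\<^sub>M \<Omega>)"
    by (rule borel_measurable_lim_metric[OF Zm])
  have "(\<lambda>x. lim (\<lambda>k. Z k (fst x) (snd x)) + drift (fst x)) \<in> borel_measurable (\<mu> \<Otimes>\<^sub>M \<Omega>)"
    using Ym measurable_compose[OF measurable_fst drift_measurable] by (rule borel_measurable_add)
  then have est: "\<xi> \<in> estimators \<mu> \<Omega>" by (simp add: estimators_def case_prod_beta' \<xi>_def)
  obtain B where B: "0 \<le> B" "\<And>e. times_in T e \<Longrightarrow>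
    (\<integral>\<^sup>+x. ennreal ((path_comb e (snd x))\<^sup>2) \<partial>joint) \<le> ennreal (B * (nrm (chi_comb T e))\<^sup>2)"
    using observation_second_moment by blast
  have "is_X_of T \<Omega> Q P (f t) (\<lambda>\<omega>. \<xi> t \<omega> - drift t)" if t: "t \<in> {0..T}" for t
  proof -
    define Y where "Y \<omega> = lim (\<lambda>k. Z k t \<omega>)" for \<omega>
    note fm = f_mem[OF t] and am = chi_comb_mem[OF approx_times]
    have Zt: "Z k t \<in> borel_measurable \<Omega>" for k
      unfolding Z_def[abs_def] by (rule path_comb_m[OF approx_times])
    have Yt: "Y \<in> borel_measurable \<Omega>" unfolding Y_def by (rule borel_measurable_lim_metric[OF Zt])
    have dist: "(\<integral>\<^sup>+x. ennreal ((Z j t (snd x) - Z k t (snd x))\<^sup>2) \<partial>joint) \<le> ennreal (4 * B * (1/4) ^ k)"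
      if "k \<le> j" for j k
    proof -
      define e where "e = approx j t @ scale_comb (-1) (approx k t)"
      have e: "times_in T e" by (simp add: e_def approx_times)
      have ce: "chi_comb T e = (\<lambda>s. chi_comb T (approx j t) s - chi_comb T (approx k t) s)" by (simp add: e_def)
      have "nrm (chi_comb T e) \<le> nrm (\<lambda>s. chi_comb T (approx j t) s - f t s) + nrm (\<lambda>s. f t s - chi_comb T (approx k t) s)"
        unfolding ce by (rule nrm_triangle[OF am fm am])
      also have "\<dots> \<le> (1/2) ^ j + (1/2) ^ k"
        unfolding nrm_diff_commute[OF am fm] by (intro add_mono approx_dist[OF t])
      also have "\<dots> \<le> 2 * (1/2) ^ k" using power_decreasing[OF that, of "1/2 :: real"] by simp
      finally have "(nrm (chi_comb T e))\<^sup>2 \<le> (2 * (1/2) ^ k)\<^sup>2"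
        by (rule power_mono) (rule nrm_nonneg[OF chi_comb_mem[OF e]])
      also have "(2 * (1/2 :: real) ^ k)\<^sup>2 = 4 * (1/4) ^ k"
      proof -
        have "((1/2 :: real) ^ k)\<^sup>2 = ((1/2)\<^sup>2) ^ k" by (simp only: power_mult[symmetric] mult.commute)
        then show ?thesis by (simp add: power_mult_distrib power2_eq_square)
      qed
      finally have "B * (nrm (chi_comb T e))\<^sup>2 \<le> B * (4 * (1/4) ^ k)" by (rule mult_left_mono[OF _ B(1)])
      then have "ennreal (B * (nrm (chi_comb T e))\<^sup>2) \<le> ennreal (4 * B * (1/4) ^ k)"
        by (intro ennreal_leI) simp
      with B(2)[OF e] have "(\<integral>\<^sup>+x. ennreal ((path_comb e (snd x))\<^sup>2) \<partial>joint) \<le> ennreal (4 * B * (1/4) ^ k)"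
        by (rule order_trans)
      then show ?thesis by (simp add: e_def Z_def)
    qed
    have ZJ: "(\<lambda>x. Z k t (snd x)) \<in> borel_measurable joint" for k by (rule snd_joint[OF Zt])
    have YJ: "(\<lambda>x. Y (snd x)) \<in> borel_measurable joint" by (rule snd_joint[OF Yt])
    have "AE x in joint. convergent (\<lambda>k. Z k t (snd x))"
      by (rule fast_cauchy_AE_convergent[where C="4 * B", OF ZJ dist]) simp
    then have lim: "AE x in joint. (\<lambda>k. Z k t (snd x)) \<longlonglongrightarrow> Y (snd x)"
      by eventually_elim (simp add: Y_def convergent_LIMSEQ_iff)
    have close: "(\<integral>\<^sup>+x. ennreal ((Z k t (snd x) - Y (snd x))\<^sup>2) \<partial>joint) \<le> ennreal (4 * B * (1/4) ^ k)" for k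
    proof -
      have "(\<integral>\<^sup>+x. ennreal ((Y (snd x) - Z k t (snd x))\<^sup>2) \<partial>joint) \<le> ennreal (4 * B * (1/4) ^ k)"
        by (rule fatou_square[OF ZJ ZJ YJ lim]) (use dist in \<open>auto simp: eventually_sequentially\<close>)
      then show ?thesis by (simp add: power2_commute)
    qed
    have lim0: "(\<lambda>k. ennreal (4 * B * (1/4) ^ k)) \<longlonglongrightarrow> 0"
    proof -
      have "(\<lambda>k. 4 * B * (1/4) ^ k) \<longlonglongrightarrow> 4 * B * 0"
        by (intro tendsto_intros LIMSEQ_realpow_zero) auto
      then have "(\<lambda>k. ennreal (4 * B * (1/4) ^ k)) \<longlonglongrightarrow> ennreal (4 * B * 0)" by (rule tendsto_ennrealI)
      then show ?thesis by simp
    qed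
    have "(\<lambda>k. \<integral>\<^sup>+x. ennreal ((Z k t (snd x) - Y (snd x))\<^sup>2) \<partial>joint) \<longlonglongrightarrow> 0"
      by (rule tendsto_sandwich[OF _ _ tendsto_const lim0]) (use close in auto)
    moreover have "(\<integral>\<^sup>+x. ennreal ((Z k t (snd x) - Y (snd x))\<^sup>2) \<partial>joint) =
        (\<integral>\<^sup>+z. (\<integral>\<^sup>+\<omega>. ennreal ((path_comb (approx k t) \<omega> - Y \<omega>)\<^sup>2) \<partial>P z) \<partial>Q)" for k
    proof -
      have "(\<lambda>x. ennreal ((Z k t (snd x) - Y (snd x))\<^sup>2)) \<in> borel_measurable joint" using ZJ YJ by measurable
      from nn_integral_joint[OF this] show ?thesis by (simp add: Z_def)
    qed
    ultimately have c1: "(\<lambda>k. \<integral>\<^sup>+z. (\<integral>\<^sup>+\<omega>. ennreal ((path_comb (approx k t) \<omega> - Y \<omega>)\<^sup>2) \<partial>P z) \<partial>Q) \<longlonglongrightarrow> 0"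
      by simp
    have c2: "(\<lambda>k. cm_inner T (\<lambda>s. f t s - chi_comb T (approx k t) s) (\<lambda>s. f t s - chi_comb T (approx k t) s)) \<longlonglongrightarrow> 0"
    proof (rule Lim_null_comparison)
      show "\<forall>\<^sub>F k in sequentially. norm (cm_inner T (\<lambda>s. f t s - chi_comb T (approx k t) s)
          (\<lambda>s. f t s - chi_comb T (approx k t) s)) \<le> (1/4) ^ k"
      proof (rule always_eventually, rule allI)
        fix k
        show "norm (cm_inner T (\<lambda>s. f t s - chi_comb T (approx k t) s) (\<lambda>s. f t s - chi_comb T (approx k t) s)) \<le> (1/4) ^ k"
          using err_idx[OF t, of k] ip_nonneg[OF diff_mem[OF fm am], of k t] unfolding err_eq[OF t] approx_def by simp
      qed
      show "(\<lambda>k. (1/4 :: real) ^ k) \<longlonglongrightarrow> 0" by (rule LIMSEQ_realpow_zero) auto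
    qed
    have "is_X_of T \<Omega> Q P (f t) Y"
      unfolding is_X_of_def
      by (intro conjI Yt exI[of _ "\<lambda>k. approx k t"] allI approx_times c2 c1)
    moreover have "(\<lambda>\<omega>. \<xi> t \<omega> - drift t) = Y" by (simp add: \<xi>_def Y_def fun_eq_iff)
    ultimately show ?thesis by simp
  qed
  with est have "is_drift_plus_X T \<mu> \<Omega> Q P drift f \<xi>" unfolding is_drift_plus_X_def by blast
  then show thesis using that by blast
qed

lemma drift_plus_X_solves:
  assumes d: "\<And>t. t \<in> {0..T} \<Longrightarrow> d t = drift t"
  shows "(\<exists>\<xi>. is_drift_plus_X T \<mu> \<Omega> Q P d f \<xi>) \<and>
    (\<forall>\<xi>. is_drift_plus_X T \<mu> \<Omega> Q P d f \<xi> \<longrightarrow>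
      unique_minimizer \<mu> \<Omega> Q P \<xi> \<and>
      bayes_risk \<mu> Q P \<xi> = ennreal (LINT t|\<mu>. cm_inner T (chi T t) (\<Gamma> (f t))) \<and>
      bayes_risk \<mu> Q P \<xi> = (INF \<eta>\<in>estimators \<mu> \<Omega>. bayes_risk \<mu> Q P \<eta>))"
proof (intro conjI allI impI)
  obtain \<xi> where "is_drift_plus_X T \<mu> \<Omega> Q P drift f \<xi>" using drift_plus_X_exists by blast
  then have "is_drift_plus_X T \<mu> \<Omega> Q P d f \<xi>" using d unfolding is_drift_plus_X_def by simp
  then show "\<exists>\<xi>. is_drift_plus_X T \<mu> \<Omega> Q P d f \<xi>" by blast
qed (rule drift_plus_X_optimal[OF _ d], assumption+)+

section \<open>The two forms of the drift term\<close>

text \<open>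
  As \<open>A (\<chi>\<^sub>t - f\<^sub>t) = A \<chi>\<^sub>t - \<Gamma>\<tau> \<chi>\<^sub>t = \<Gamma> \<chi>\<^sub>t\<close>, the element \<open>\<chi>\<^sub>t - f\<^sub>t\<close> is \<open>(\<Gamma>\<tau> + \<Gamma>)\<^sup>-\<^sup>1 \<Gamma> \<chi>\<^sub>t\<close>.
\<close>

lemma drift_complement:
  assumes t: "t \<in> {0..T}"
  shows "(\<lambda>s. chi T t s - f t s) \<in> cm_space T" "A (\<lambda>s. chi T t s - f t s) = \<Gamma> (chi T t)"
    "cm_inner T (\<lambda>s. chi T t s - f t s) v = drift t"
proof -
  note fm = f_mem[OF t] and ch = chi_mem[OF t]
  show "(\<lambda>s. chi T t s - f t s) \<in> cm_space T" by (rule diff_mem[OF ch fm])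
  have "A (\<lambda>s. chi T t s - f t s) = (\<lambda>s. A (chi T t) s - \<Gamma>\<tau> (chi T t) s)"
    unfolding sym_op_diff[OF A_sym ch fm] f_eq[OF t] ..
  then show "A (\<lambda>s. chi T t s - f t s) = \<Gamma> (chi T t)" by (simp add: A_apply)
  show "cm_inner T (\<lambda>s. chi T t s - f t s) v = drift t"
    unfolding ip_diff[OF ch fm v] ip_chi_left[OF v t] drift_def ..
qed

text \<open>
  With \<open>A u = \<Gamma> \<chi>\<^sub>t\<close> and \<open>A w = \<Gamma> v\<close> the claim is \<open>\<langle>u, v\<rangle> = \<langle>\<chi>\<^sub>t, w\<rangle>\<close>. It is clear formally, moving \<open>A\<^sup>-\<^sup>1 \<Gamma>\<close> from one
  side to the other, but \<open>A\<^sup>-\<^sup>1\<close> is unbounded. The Landweber iterates are bounded substitutes that are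
  polynomials in \<open>A\<close>, so they commute with \<open>\<Gamma>\<close>: the identity holds for them, and they converge.
\<close>

lemma drift_commuting:
  assumes comm: "\<And>h. h \<in> cm_space T \<Longrightarrow> \<Gamma> (\<Gamma>\<tau> h) = \<Gamma>\<tau> (\<Gamma> h)"
    and w: "w \<in> cm_space T" "A w = \<Gamma> v" and t: "t \<in> {0..T}"
  shows "cm_inner T (chi T t) w = drift t"
proof -
  define u where "u = (\<lambda>s. chi T t s - f t s)"
  have u: "u \<in> cm_space T" "A u = \<Gamma> (chi T t)" "cm_inner T u v = drift t"
    unfolding u_def using drift_complement[OF t] .
  note ch = chi_mem[OF t]
  obtain \<kappa> where \<kappa>: "\<And>x. x \<in> cm_space T \<Longrightarrow> tends (\<lambda>n. A (landweber A \<kappa> n x)) x"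
    using range_dense by blast
  have lm: "landweber A \<kappa> n x \<in> cm_space T" if "x \<in> cm_space T" for n x by (rule landweber_mem[OF A_sym that])
  have Am: "A x \<in> cm_space T" if "x \<in> cm_space T" for x by (rule sym_op_mem[OF A_sym that])
  have AG: "A (\<Gamma> h) = \<Gamma> (A h)" if "h \<in> cm_space T" for h
    unfolding A_apply sym_op_add[OF \<Gamma>_sym(1) sym_op_mem[OF \<Gamma>_sym(2) that] sym_op_mem[OF \<Gamma>_sym(1) that]]
      comm[OF that] ..
  have eq: "cm_inner T (A (landweber A \<kappa> n v)) u = cm_inner T (A (landweber A \<kappa> n w)) (chi T t)" for n
  proof -
    have "cm_inner T (A (landweber A \<kappa> n v)) u = cm_inner T (landweber A \<kappa> n v) (\<Gamma> (chi T t))"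
      unfolding u(2)[symmetric] by (rule sym_op_ip[OF A_sym lm[OF v] u(1)])
    also have "\<dots> = cm_inner T (\<Gamma> (landweber A \<kappa> n v)) (chi T t)"
      by (rule sym_op_ip[OF \<Gamma>_sym(1) lm[OF v] ch, symmetric])
    also have "\<Gamma> (landweber A \<kappa> n v) = landweber A \<kappa> n (A w)"
      unfolding w(2) by (rule landweber_commute[OF A_sym \<Gamma>_sym(1) v AG])
    also have "\<dots> = A (landweber A \<kappa> n w)"
      by (rule landweber_commute[OF A_sym A_sym w(1) refl, symmetric])
    finally show ?thesis .
  qed
  have "(\<lambda>n. cm_inner T (A (landweber A \<kappa> n v)) u) \<longlonglongrightarrow> cm_inner T v u"
    by (rule tends_ip[of "\<lambda>n. A (landweber A \<kappa> n v)" v u, OF _ v \<kappa>[OF v] u(1)]) (rule Am[OF lm[OF v]])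
  moreover have "(\<lambda>n. cm_inner T (A (landweber A \<kappa> n w)) (chi T t)) \<longlonglongrightarrow> cm_inner T w (chi T t)"
    by (rule tends_ip[of "\<lambda>n. A (landweber A \<kappa> n w)" w "chi T t", OF _ w(1) \<kappa>[OF w(1)] ch]) (rule Am[OF lm[OF w(1)]])
  ultimately have "cm_inner T v u = cm_inner T w (chi T t)" unfolding eq by (rule LIMSEQ_unique)
  then show ?thesis using u(3) by (simp add: cm_inner_commute[of T v] cm_inner_commute[of T w])
qed

end

lemma kernel_cov_op_covariance:
  assumes T: "0 < T" and K: "admissible_kernel T K" and adj: "is_cm_adjoint T (kernel_op T K) Kstar"
  shows "covariance_operator T (kernel_cov_op T K Kstar)"
proof -
  interpret cameron_martin T by unfold_locales (rule T)
  have "0 \<le> cm_inner T h (kernel_cov_op T K Kstar h)" if h: "h \<in> cm_space T" for h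
  proof -
    have Ks: "Kstar h \<in> cm_space T" using adj h by (simp add: is_cm_adjoint_def)
    have "cm_inner T h (kernel_cov_op T K Kstar h) = cm_inner T (kernel_op T K (Kstar h)) h"
      unfolding kernel_cov_op_def by (rule cm_inner_commute)
    also have "\<dots> = cm_inner T (Kstar h) (Kstar h)" using adj h Ks by (simp add: is_cm_adjoint_def)
    finally show ?thesis using ip_nonneg[OF Ks] by simp
  qed
  then show ?thesis
    using kernel_cov_op_sym_op[OF K adj] unfolding covariance_operator_def sym_op_def by blast
qed

theorem proposition3p2:
  fixes T :: real
    and \<mu> :: "real measure"
    and \<Omega> :: "(real \<Rightarrow> real) measure"
    and K :: "real \<Rightarrow> real \<Rightarrow> real"
    and Kstar \<Gamma> \<Gamma>\<tau> A_inv :: "(real \<Rightarrow> real) \<Rightarrow> (real \<Rightarrow> real)"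
    and v :: "real \<Rightarrow> real"
    and P :: "(real \<Rightarrow> real) \<Rightarrow> (real \<Rightarrow> real) measure"
    and Q :: "(real \<Rightarrow> real) measure"
  assumes "0 < T"
    and "finite_measure \<mu>" and "sets \<mu> = sets (restrict_space borel {0..T})"
    and "path_space T \<Omega>"
    and "admissible_kernel T K" and "is_cm_adjoint T (kernel_op T K) Kstar"
    and "\<Gamma> = kernel_cov_op T K Kstar"
    and "\<And>z. z \<in> space \<Omega> \<Longrightarrow> gaussian_law T \<Omega> (P z) z \<Gamma>"
    and "covariance_operator T \<Gamma>\<tau>"
    and "v \<in> H_space T \<Gamma>"
    and "gaussian_law T \<Omega> Q v \<Gamma>\<tau>"
    \<comment> \<open>\<open>(\<Gamma>\<tau> + \<Gamma>)\<^sup>-\<^sup>1\<close> exists, with \<open>(\<Gamma>\<tau> + \<Gamma>)\<^sup>-\<^sup>1 \<Gamma>\<tau> \<chi>\<^sub>t\<close> defined\<close>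
    and "inj_on (op_sum \<Gamma>\<tau> \<Gamma>) (cm_space T)"
    and "\<And>t. t \<in> {0..T} \<Longrightarrow> \<Gamma>\<tau> (chi T t) \<in> op_sum \<Gamma>\<tau> \<Gamma> ` cm_space T"
    and "A_inv = op_inv T (op_sum \<Gamma>\<tau> \<Gamma>)"
  shows
    \<comment> \<open>First the drift term \<open>\<langle>\<chi>\<^sub>t, (\<Gamma>\<tau> + \<Gamma>)\<^sup>-\<^sup>1 \<Gamma> v\<rangle>\<close>, for commuting \<open>\<Gamma>\<close> and \<open>\<Gamma>\<tau>\<close>; in general
      \<open>(\<Gamma>\<tau> + \<Gamma>)\<^sup>-\<^sup>1 \<Gamma>\<close> is not self-adjoint and has to act on \<open>\<chi>\<^sub>t\<close>.\<close>
    "((\<forall>h\<in>cm_space T. \<Gamma> (\<Gamma>\<tau> h) = \<Gamma>\<tau> (\<Gamma> h)) \<and> \<Gamma> v \<in> op_sum \<Gamma>\<tau> \<Gamma> ` cm_space T \<longrightarrow>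
       (\<exists>\<xi>. is_drift_plus_X T \<mu> \<Omega> Q P (\<lambda>t. cm_inner T (chi T t) (A_inv (\<Gamma> v)))
              (\<lambda>t. A_inv (\<Gamma>\<tau> (chi T t))) \<xi>) \<and>
       (\<forall>\<xi>. is_drift_plus_X T \<mu> \<Omega> Q P (\<lambda>t. cm_inner T (chi T t) (A_inv (\<Gamma> v)))
              (\<lambda>t. A_inv (\<Gamma>\<tau> (chi T t))) \<xi> \<longrightarrow>
          unique_minimizer \<mu> \<Omega> Q P \<xi> \<and>
          bayes_risk \<mu> Q P \<xi> =
            ennreal (LINT t|\<mu>. cm_inner T (chi T t) (\<Gamma> (A_inv (\<Gamma>\<tau> (chi T t))))) \<and>
          bayes_risk \<mu> Q P \<xi> = (INF \<eta>\<in>estimators \<mu> \<Omega>. bayes_risk \<mu> Q P \<eta>))) \<and>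
     ((\<exists>\<xi>. is_drift_plus_X T \<mu> \<Omega> Q P (\<lambda>t. cm_inner T (A_inv (\<Gamma> (chi T t))) v)
              (\<lambda>t. A_inv (\<Gamma>\<tau> (chi T t))) \<xi>) \<and>
       (\<forall>\<xi>. is_drift_plus_X T \<mu> \<Omega> Q P (\<lambda>t. cm_inner T (A_inv (\<Gamma> (chi T t))) v)
              (\<lambda>t. A_inv (\<Gamma>\<tau> (chi T t))) \<xi> \<longrightarrow>
          unique_minimizer \<mu> \<Omega> Q P \<xi> \<and>
          bayes_risk \<mu> Q P \<xi> =
            ennreal (LINT t|\<mu>. cm_inner T (chi T t) (\<Gamma> (A_inv (\<Gamma>\<tau> (chi T t))))) \<and>
          bayes_risk \<mu> Q P \<xi> = (INF \<eta>\<in>estimators \<mu> \<Omega>. bayes_risk \<mu> Q P \<eta>)))"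
proof -
  define f where "f = (\<lambda>t. A_inv (\<Gamma>\<tau> (chi T t)))"
  note inj = assms(12)
  have inv: "A_inv y \<in> cm_space T" "op_sum \<Gamma>\<tau> \<Gamma> (A_inv y) = y" if "y \<in> op_sum \<Gamma>\<tau> \<Gamma> ` cm_space T" for y
    unfolding assms(14) op_inv_def
    by (rule the_inv_into_into[OF inj that subset_refl], rule f_the_inv_into_f[OF inj that])
  interpret B: bayes_model T \<Omega> \<Gamma> \<Gamma>\<tau> P Q v
  proof
    show "0 < T" by fact
    show "path_space T \<Omega>" by fact
    show "covariance_operator T \<Gamma>"
      unfolding assms(7) by (rule kernel_cov_op_covariance) fact+
    show "covariance_operator T \<Gamma>\<tau>" by fact
    show "gaussian_law T \<Omega> (P z) z \<Gamma>" if "z \<in> space \<Omega>" for z using assms(8)[OF that] .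
    show "gaussian_law T \<Omega> Q v \<Gamma>\<tau>" by fact
    show "v \<in> cm_space T" using assms(10) by (simp add: H_space_def)
  qed
  interpret B: bayes_problem T \<Omega> \<Gamma> \<Gamma>\<tau> P Q v \<mu> f
  proof (intro bayes_problem.intro bayes_problem_axioms.intro B.bayes_model_axioms)
    show "finite_measure \<mu>" "sets \<mu> = sets (restrict_space borel {0..T})" by fact+
    show "h = (\<lambda>_. 0)" if "h \<in> cm_space T" "B.A h = (\<lambda>_. 0)" for h
    proof (rule inj_onD[OF inj])
      show "op_sum \<Gamma>\<tau> \<Gamma> h = op_sum \<Gamma>\<tau> \<Gamma> (\<lambda>_. 0)"
        using that(2) B.sym_op_zero[OF B.A_sym] by (simp add: B.A_def)
    qed (use that B.zero_mem in auto)
    show "f t \<in> cm_space T" "B.A (f t) = \<Gamma>\<tau> (chi T t)" if "t \<in> {0..T}" for t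
      using inv[OF assms(13)[OF that]] by (simp_all add: f_def B.A_def)
  qed
  have d1: "cm_inner T (chi T t) (A_inv (\<Gamma> v)) = B.drift t"
    if "\<forall>h\<in>cm_space T. \<Gamma> (\<Gamma>\<tau> h) = \<Gamma>\<tau> (\<Gamma> h)" "\<Gamma> v \<in> op_sum \<Gamma>\<tau> \<Gamma> ` cm_space T" "t \<in> {0..T}" for t
    by (rule B.drift_commuting) (use that inv[OF that(2)] in \<open>auto simp: B.A_def\<close>)
  have d2: "cm_inner T (A_inv (\<Gamma> (chi T t))) v = B.drift t" if t: "t \<in> {0..T}" for t
  proof -
    note dc = B.drift_complement[OF t]
    have "A_inv (\<Gamma> (chi T t)) = (\<lambda>s. chi T t s - f t s)"
      unfolding assms(14) op_inv_def by (rule the_inv_into_f_eq[OF inj dc(2)[unfolded B.A_def] dc(1)])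
    then show ?thesis using dc(3) by simp
  qed
  show ?thesis
    using B.drift_plus_X_solves[of "\<lambda>t. cm_inner T (chi T t) (A_inv (\<Gamma> v))", OF d1]
      B.drift_plus_X_solves[of "\<lambda>t. cm_inner T (A_inv (\<Gamma> (chi T t))) v", OF d2]
    unfolding f_def by blast
qed

end
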